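(* Let $T(y,t)$ and $f(y,t)$ be real-valued functions and $\vec{J}(y,t)$ an $\mathbb{R}^n$-valued vector field, defined for $y\in\Omega(t)$ (and regular enough for the expressions below to make sense). Then $T$ satisfies the balance equations in the moving domains, that is, $$\frac{d}{dt}\int_{W(t)}T(y,t)\,dy=\int_{W(t)}f(y,t)\,dy-\int_{\partial W(t)}\vec{J}\,d\vec{s}$$ for every $W(t)=\phi(t)W_0$ with $W_0\subset\Omega_0$ an arbitrary smooth subdomain, if and only if the following equivalent conditions are satisfied: $$\frac{\partial T}{\partial t}(y,t)+\operatorname{div}_y\big(T(y,t)\vec{V}(y)\big)=f(y,t)-\operatorname{div}_y(\vec{J}),\qquad y\in\Omega(t),\ t>0,$$ or $$\frac{\partial}{\partial t}\overline{T}(x,t)+\overline{T}(x,t)\,\overline{\operatorname{div}(\vec{V})}(x,t)=\overline{f}(x,t)-\overline{\operatorname{div}_y(\vec{J})}(x,t),\qquad x\in\Omega_0,\ t>0.$$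
   Context: $\Omega_0\subset\mathbb{R}^n$ is a given domain (smooth open set). $\vec{V}:\mathbb{R}^n\to\mathbb{R}^n$ is a smooth vector field such that all solutions of the autonomous system $\dot Y=\vec{V}(Y)$ are defined for all $t\in\mathbb{R}$. For $t\in\mathbb{R}$, $\phi(t):\mathbb{R}^n\to\mathbb{R}^n$ is the flow map $\phi(t)x=Y(t;x)$, where $Y(\cdot;x)$ is the solution with $Y(0;x)=x$. The moving domain is $\Omega(t)=\phi(t)\Omega_0$, and a subdomain $W_0\subset\Omega_0$ is moved to $W(t)=\phi(t)W_0$, with boundary $\partial W(t)=\phi(t)\partial W_0$. For a function $g(y,t)$ defined for $y\in\Omega(t)$, its pull-back to $\Omega_0$ is $\overline{g}(x,t)=g(\phi(t)x,t)$, $x\in\Omega_0$; in particular $\overline{\operatorname{div}(\vec V)}(x,t)=(\operatorname{div}\vec V)(\phi(t)x)$. Here $f$ represents the rate of production/consumption of $T$ per unit volume, and $\int_{\partial W(t)}\vec{J}\,d\vec{s}$ is the outward flux of the vector field $\vec{J}$ across $\partial W(t)$. *)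

theory Defs
  imports "HOL-Analysis.Analysis"
begin

section \<open>Regularity and differential operators\<close>

text \<open>These notions are only meant for open sets \<open>S\<close>.\<close>

fun Ck_on :: "nat \<Rightarrow> 'a::real_normed_vector set \<Rightarrow> ('a \<Rightarrow> 'b::real_normed_vector) \<Rightarrow> bool" where
  "Ck_on 0 S f \<longleftrightarrow> continuous_on S f"
| "Ck_on (Suc k) S f \<longleftrightarrow>
     (\<forall>x\<in>S. f differentiable (at x)) \<and> (\<forall>h. Ck_on k S (\<lambda>x. frechet_derivative f (at x) h))"

definition Cinf_on :: "'a::real_normed_vector set \<Rightarrow> ('a \<Rightarrow> 'b::real_normed_vector) \<Rightarrow> bool" where
  "Cinf_on S f \<longleftrightarrow> (\<forall>k. Ck_on k S f)"

definition gradient :: "('a::euclidean_space \<Rightarrow> real) \<Rightarrow> 'a \<Rightarrow> 'a" where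
  "gradient g x = (\<Sum>b\<in>Basis. frechet_derivative g (at x) b *\<^sub>R b)"

definition divergence :: "('a::euclidean_space \<Rightarrow> 'a) \<Rightarrow> 'a \<Rightarrow> real" where
  "divergence F x = (\<Sum>b\<in>Basis. frechet_derivative F (at x) b \<bullet> b)"

section \<open>Smooth domains\<close>

text \<open>
  Inside \<open>U\<close>, and after relabelling and possibly reversing a coordinate axis (the vector \<open>k\<close>
  is \<open>b\<close> or \<open>- b\<close> for a standard basis vector \<open>b\<close>), the set \<open>W\<close> is the region strictly below
  the graph of \<open>g\<close> in direction \<open>k\<close>. A function of the remaining \<open>n - 1\<close> coordinates is
  encoded as a function on the whole space that is constant along \<open>k\<close>. As \<open>U\<close> is open, the
  frontier of \<open>W\<close> inside \<open>U\<close> is then the graph itself (for continuous \<open>g\<close>).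
\<close>

definition boundary_graph ::
    "'a::euclidean_space set \<Rightarrow> 'a set \<Rightarrow> 'a \<Rightarrow> ('a \<Rightarrow> real) \<Rightarrow> bool" where
  "boundary_graph W U k g \<longleftrightarrow>
     open U \<and> (k \<in> Basis \<or> - k \<in> Basis) \<and> (\<forall>x c. g (x + c *\<^sub>R k) = g x) \<and>
     W \<inter> U = {x \<in> U. x \<bullet> k < g x}"

definition smooth_domain :: "'a::euclidean_space set \<Rightarrow> bool" where
  "smooth_domain W \<longleftrightarrow>
     open W \<and> (\<forall>p\<in>frontier W. \<exists>U k g. p \<in> U \<and> boundary_graph W U k g \<and> Cinf_on U g)"

section \<open>Outward flux through the boundary\<close>

text \<open>
  On the graph \<open>x \<bullet> k = g x\<close>, with \<open>W\<close> below it, the vector \<open>N = k - gradient g\<close> is an outward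
  normal, the outward unit normal is \<open>N / norm N\<close>, and the surface element is
  \<open>norm N dz\<close>, where \<open>dz\<close> is the \<open>(n - 1)\<close>-dimensional Lebesgue measure on the
  coordinates other than the one of \<open>k\<close>. Hence the vector surface element is \<open>N dz\<close>.
  For \<open>n = 1\<close> the measure \<open>dz\<close> is the unit mass at a point.
\<close>

definition graph_flux :: "('a::euclidean_space \<Rightarrow> 'a) \<Rightarrow> 'a \<Rightarrow> ('a \<Rightarrow> real) \<Rightarrow> real" where
  "graph_flux F k g =
     (\<integral>z. (let x = (\<Sum>b\<in>Basis - {k, - k}. z b *\<^sub>R b); y = x + g x *\<^sub>R k
           in F y \<bullet> (k - gradient g y))
      \<partial>(\<Pi>\<^sub>M b\<in>Basis - {k, - k}. lborel))"

text \<open>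
  The flux of \<open>F\<close> through a compact \<open>C\<^sup>1\<close> boundary, patched together from graphs by a partition
  of unity \<open>\<eta>\<close> near the boundary. The sum does not depend on the charts and the partition.
\<close>

definition has_flux ::
    "'a::euclidean_space set \<Rightarrow> ('a \<Rightarrow> 'a) \<Rightarrow> real \<Rightarrow> bool" where
  "has_flux W F I \<longleftrightarrow>
     (\<exists>(m::nat) U k g \<eta>.
        (\<forall>i<m. boundary_graph W (U i) (k i) (g i) \<and> Ck_on 1 (U i) (g i) \<and>
               Ck_on 1 UNIV (\<eta> i) \<and> (\<forall>x. 0 \<le> \<eta> i x) \<and>
               compact (closure {x. \<eta> i x \<noteq> 0}) \<and> closure {x. \<eta> i x \<noteq> 0} \<subseteq> U i) \<and>
        (\<exists>S. open S \<and> frontier W \<subseteq> S \<and> (\<forall>x\<in>S. (\<Sum>i<m. \<eta> i x) = 1)) \<and>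
        I = (\<Sum>i<m. graph_flux (\<lambda>y. \<eta> i y *\<^sub>R F y) (k i) (g i)))"

definition flux :: "'a::euclidean_space set \<Rightarrow> ('a \<Rightarrow> 'a) \<Rightarrow> real" where
  "flux W F = (THE I. has_flux W F I)"

section \<open>Flows, moving domains and balance equations\<close>

text \<open>
  \<open>\<phi> t x = Y(t; x)\<close>. The existence of such a \<open>\<phi>\<close> on the whole real line says that all solutions
  are global; for smooth \<open>V\<close> it is unique.
\<close>

definition is_flow ::
    "('a::real_normed_vector \<Rightarrow> 'a) \<Rightarrow> (real \<Rightarrow> 'a \<Rightarrow> 'a) \<Rightarrow> bool" where
  "is_flow V \<phi> \<longleftrightarrow>
     (\<forall>x. \<phi> 0 x = x \<and> (\<forall>t. ((\<lambda>s. \<phi> s x) has_vector_derivative V (\<phi> t x)) (at t)))"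

definition pull_back ::
    "(real \<Rightarrow> 'a \<Rightarrow> 'a) \<Rightarrow> ('a \<Rightarrow> real \<Rightarrow> 'b) \<Rightarrow> 'a \<Rightarrow> real \<Rightarrow> 'b" where
  "pull_back \<phi> h x t = h (\<phi> t x) t"

text \<open>
  The fields are only given on the open sets \<open>\<phi> t ` \<Omega>\<^sub>0\<close>, so the integrals over \<open>W(t)\<close> and its
  boundary make sense for bounded subdomains whose closure lies in \<open>\<Omega>\<^sub>0\<close>.
\<close>

definition smooth_subdomain :: "'a::euclidean_space set \<Rightarrow> 'a set \<Rightarrow> bool" where
  "smooth_subdomain W\<^sub>0 \<Omega>\<^sub>0 \<longleftrightarrow> smooth_domain W\<^sub>0 \<and> bounded W\<^sub>0 \<and> closure W\<^sub>0 \<subseteq> \<Omega>\<^sub>0"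

definition satisfies_balance ::
    "(real \<Rightarrow> 'a::euclidean_space \<Rightarrow> 'a) \<Rightarrow> 'a set \<Rightarrow> ('a \<Rightarrow> real \<Rightarrow> real) \<Rightarrow>
     ('a \<Rightarrow> real \<Rightarrow> real) \<Rightarrow> ('a \<Rightarrow> real \<Rightarrow> 'a) \<Rightarrow> bool" where
  "satisfies_balance \<phi> \<Omega>\<^sub>0 T f J \<longleftrightarrow>
     (\<forall>W\<^sub>0. smooth_subdomain W\<^sub>0 \<Omega>\<^sub>0 \<longrightarrow>
       (\<forall>t>0. ((\<lambda>s. LBINT y:\<phi> s ` W\<^sub>0. T y s) has_real_derivative
                 ((LBINT y:\<phi> t ` W\<^sub>0. f y t) - flux (\<phi> t ` W\<^sub>0) (\<lambda>y. J y t))) (at t)))"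

definition eulerian_balance ::
    "('a::euclidean_space \<Rightarrow> 'a) \<Rightarrow> (real \<Rightarrow> 'a \<Rightarrow> 'a) \<Rightarrow> 'a set \<Rightarrow> ('a \<Rightarrow> real \<Rightarrow> real) \<Rightarrow>
     ('a \<Rightarrow> real \<Rightarrow> real) \<Rightarrow> ('a \<Rightarrow> real \<Rightarrow> 'a) \<Rightarrow> bool" where
  "eulerian_balance V \<phi> \<Omega>\<^sub>0 T f J \<longleftrightarrow>
     (\<forall>t>0. \<forall>y\<in>\<phi> t ` \<Omega>\<^sub>0.
        deriv (\<lambda>s. T y s) t + divergence (\<lambda>z. T z t *\<^sub>R V z) y
          = f y t - divergence (\<lambda>z. J z t) y)"

definition pulled_back_balance ::
    "('a::euclidean_space \<Rightarrow> 'a) \<Rightarrow> (real \<Rightarrow> 'a \<Rightarrow> 'a) \<Rightarrow> 'a set \<Rightarrow> ('a \<Rightarrow> real \<Rightarrow> real) \<Rightarrow>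
     ('a \<Rightarrow> real \<Rightarrow> real) \<Rightarrow> ('a \<Rightarrow> real \<Rightarrow> 'a) \<Rightarrow> bool" where
  "pulled_back_balance V \<phi> \<Omega>\<^sub>0 T f J \<longleftrightarrow>
     (\<forall>t>0. \<forall>x\<in>\<Omega>\<^sub>0.
        deriv (\<lambda>s. pull_back \<phi> T x s) t
            + pull_back \<phi> T x t * pull_back \<phi> (\<lambda>y s. divergence V y) x t
          = pull_back \<phi> f x t - pull_back \<phi> (\<lambda>y s. divergence (\<lambda>z. J z s) y) x t)"

end

theory Submission
  imports Defs
begin

text \<open>
  Let \<open>e = \<partial>\<^sub>t T + div (T V) - f + div J\<close>, which is continuous on every \<open>\<phi> t ` \<Omega>\<^sub>0\<close>. The transport theorem
  for \<open>T\<close> and the divergence theorem for \<open>J\<close> turn the balance over \<open>W(t)\<close> into \<open>\<integral>\<^bsub>W(t)\<^esub> e = 0\<close>; for images of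
  small balls this forces \<open>e = 0\<close>. The Eulerian and the pulled-back equation agree by the chain rule
  along trajectories.

  The flux is well defined because every way of patching it together from charts yields the integral
  of the divergence, and it exists because \<open>\<phi> t\<close> is a \<open>C\<^sup>1\<close> diffeomorphism, so that \<open>W(t)\<close> has boundary charts.
  The transport theorem is obtained without Jacobians: for \<open>\<psi>\<close> with compact support, \<open>\<psi> (\<phi> (- t) y)\<close> is constant
  along trajectories, so differentiating \<open>\<integral> \<psi> (\<phi> (- t) y) T y t dy\<close> produces \<open>\<partial>\<^sub>t T + div (T V)\<close> up to the
  divergence of a compactly supported field; then \<open>\<psi>\<close> tends to the indicator of \<open>W\<^sub>0\<close>.
\<close>

section \<open>Calculus of continuously differentiable maps\<close>

text \<open>The hypotheses say nothing about how \<phi> depends on the initial point. Continuity and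
  C^1 dependence, needed for the charts of W(t) and for the weights \<psi>, are derived from the
  differential equation by Gronwall estimates. The linearised equation is never solved: its solution
  appears as the limit of difference quotients. Hence two levels of regularity coexist: the test
  domains are smooth to every order, while their images are only shown to have C^1 boundaries, which
  is what the charts of a flux require. The fields are regular only on the moving open sets, so
  every identity on the whole space is applied to a compactly supported field extended by zero.
  Replacing a weight by an indicator cannot be done under a derivative. It is done after integration
  in time; differentiating back requires the integral of the rate over W(t) to be continuous in t,
  and this rests on the boundary of W(t) being a null set. Localisation uses balls, whose boundaries
  must be shown smooth to every order before they may serve as test domains.\<close>

definition C1_on :: "'a::real_normed_vector set \<Rightarrow> ('a \<Rightarrow> 'b::real_normed_vector) \<Rightarrow> bool" where
  "C1_on S f \<longleftrightarrow> (\<forall>x\<in>S. f differentiable (at x)) \<and>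
     (\<forall>h. continuous_on S (\<lambda>x. frechet_derivative f (at x) h))"

lemma Ck_on_1_iff: "Ck_on 1 S f \<longleftrightarrow> C1_on S f"
  by (simp add: C1_on_def)

lemmas fd_works = frechet_derivative_works[THEN iffD1]

lemma C1_onI:
  assumes "\<And>x. x \<in> S \<Longrightarrow> (f has_derivative f' x) (at x)"
    and "\<And>h. continuous_on S (\<lambda>x. f' x h)"
  shows "C1_on S f"
proof -
  have eq: "frechet_derivative f (at x) = f' x" if "x \<in> S" for x
    using frechet_derivative_at[OF assms(1)[OF that]] by simp
  have "continuous_on S (\<lambda>x. frechet_derivative f (at x) h)" for h
    using assms(2)[of h] by (rule continuous_on_eq) (simp add: eq)
  then show ?thesis
    using assms(1) unfolding C1_on_def differentiable_def by blast
qed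

lemma C1_on_has_derivative:
  "C1_on S f \<Longrightarrow> x \<in> S \<Longrightarrow> (f has_derivative frechet_derivative f (at x)) (at x)"
  by (simp add: C1_on_def fd_works)

lemma C1_on_continuous: "C1_on S f \<Longrightarrow> continuous_on S f"
  by (meson C1_on_has_derivative continuous_at_imp_continuous_on has_derivative_continuous)

lemma C1_on_subset: "C1_on S f \<Longrightarrow> S' \<subseteq> S \<Longrightarrow> C1_on S' f"
  by (meson C1_on_def continuous_on_subset subsetD)

text \<open>Continuity in \<open>C1_on\<close> is asked for one direction at a time, as in
  \<open>Ck_on\<close>. Expanding the direction in the standard basis upgrades this to base point
  and direction varying together.\<close>

lemma C1_on_frechet_continuous:
  fixes f :: "'a::euclidean_space \<Rightarrow> 'b::real_normed_vector"
  assumes f: "C1_on S f" and a: "continuous_on X a" "a ` X \<subseteq> S" and v: "continuous_on X v"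
  shows "continuous_on X (\<lambda>x. frechet_derivative f (at (a x)) (v x))"
proof -
  have "frechet_derivative f (at (a x)) (v x) =
      (\<Sum>b\<in>Basis. (v x \<bullet> b) *\<^sub>R frechet_derivative f (at (a x)) b)" if "x \<in> X" for x
  proof -
    have l: "linear (frechet_derivative f (at (a x)))"
      using C1_on_has_derivative[OF f, of "a x"] that a(2) has_derivative_linear by blast
    have "frechet_derivative f (at (a x)) (\<Sum>b\<in>Basis. (v x \<bullet> b) *\<^sub>R b)
        = (\<Sum>b\<in>Basis. (v x \<bullet> b) *\<^sub>R frechet_derivative f (at (a x)) b)"
      by (simp add: linear_sum[OF l] linear_cmul[OF l])
    then show ?thesis by (simp add: euclidean_representation)
  qed
  moreover have "continuous_on X (\<lambda>x. \<Sum>b\<in>Basis. (v x \<bullet> b) *\<^sub>R frechet_derivative f (at (a x)) b)"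
  proof (intro continuous_intros v)
    fix b
    have "continuous_on S (\<lambda>y. frechet_derivative f (at y) b)"
      using f by (simp add: C1_on_def)
    then show "continuous_on X (\<lambda>x. frechet_derivative f (at (a x)) b)"
      using a by (rule continuous_on_compose2)
  qed
  ultimately show ?thesis
    using continuous_on_cong by fastforce
qed

lemma C1_on_compose:
  fixes f :: "'a::real_normed_vector \<Rightarrow> 'b::euclidean_space" and g :: "'b \<Rightarrow> 'c::real_normed_vector"
  assumes f: "C1_on S f" and g: "C1_on S' g" and "f ` S \<subseteq> S'"
  shows "C1_on S (\<lambda>x. g (f x))"
proof (rule C1_onI)
  fix x assume "x \<in> S"
  then show "((\<lambda>x. g (f x)) has_derivative
      (\<lambda>h. frechet_derivative g (at (f x)) (frechet_derivative f (at x) h))) (at x)"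
    using diff_chain_at[OF C1_on_has_derivative[OF f] C1_on_has_derivative[OF g]] assms(3)
    by (auto simp: o_def)
next
  fix h
  show "continuous_on S (\<lambda>x. frechet_derivative g (at (f x)) (frechet_derivative f (at x) h))"
    using f by (intro C1_on_frechet_continuous[OF g C1_on_continuous[OF f] assms(3)])
      (auto simp: C1_on_def)
qed

lemma C1_on_bilinear:
  assumes "bounded_bilinear p" and f: "C1_on S f" and g: "C1_on S g"
  shows "C1_on S (\<lambda>x. p (f x) (g x))"
proof (rule C1_onI)
  interpret bounded_bilinear p by fact
  fix x assume "x \<in> S"
  then show "((\<lambda>x. p (f x) (g x)) has_derivative
      (\<lambda>h. p (f x) (frechet_derivative g (at x) h) + p (frechet_derivative f (at x) h) (g x))) (at x)"
    by (intro FDERIV C1_on_has_derivative[OF f] C1_on_has_derivative[OF g])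
next
  interpret bounded_bilinear p by fact
  fix h
  show "continuous_on S (\<lambda>x. p (f x) (frechet_derivative g (at x) h) + p (frechet_derivative f (at x) h) (g x))"
    using C1_on_continuous[OF f] C1_on_continuous[OF g] f g
    by (intro continuous_intros continuous_on) (auto simp: C1_on_def)
qed

lemmas C1_on_scaleR = C1_on_bilinear[OF bounded_bilinear_scaleR]
lemmas C1_on_mult = C1_on_bilinear[OF bounded_bilinear_mult]
lemmas C1_on_inner = C1_on_bilinear[OF bounded_bilinear_inner]

lemma C1_on_const: "C1_on S (\<lambda>x. c)"
  by (rule C1_onI[where f'="\<lambda>x h. 0"]) auto

lemma C1_on_bounded_linear: "bounded_linear f \<Longrightarrow> C1_on S f"
  by (rule C1_onI[where f'="\<lambda>x. f"]) (auto intro: bounded_linear_imp_has_derivative)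

lemmas C1_on_id = C1_on_bounded_linear[OF bounded_linear_ident]

lemma C1_on_add:
  assumes f: "C1_on S f" and g: "C1_on S g"
  shows "C1_on S (\<lambda>x. f x + g x)"
  using f g by (intro C1_onI[where f'="\<lambda>x h. frechet_derivative f (at x) h + frechet_derivative g (at x) h"]
      has_derivative_add C1_on_has_derivative[OF f] C1_on_has_derivative[OF g] continuous_intros)
    (auto simp: C1_on_def)

lemma C1_on_minus:
  assumes f: "C1_on S f"
  shows "C1_on S (\<lambda>x. - f x)"
  using f by (intro C1_onI[where f'="\<lambda>x h. - frechet_derivative f (at x) h"]
      has_derivative_minus C1_on_has_derivative[OF f] continuous_intros)
    (auto simp: C1_on_def)

lemma C1_on_diff: "C1_on S f \<Longrightarrow> C1_on S g \<Longrightarrow> C1_on S (\<lambda>x. f x - g x)"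
  using C1_on_add[OF _ C1_on_minus, of S f g] by simp

lemma C1_on_sum: "(\<And>i. i \<in> I \<Longrightarrow> C1_on S (f i)) \<Longrightarrow> C1_on S (\<lambda>x. \<Sum>i\<in>I. f i x)"
  by (induction I rule: infinite_finite_induct) (auto intro!: C1_on_const C1_on_add)

lemma C1_on_prod:
  fixes f :: "'i \<Rightarrow> 'a::real_normed_vector \<Rightarrow> real"
  shows "(\<And>i. i \<in> I \<Longrightarrow> C1_on S (f i)) \<Longrightarrow> C1_on S (\<lambda>x. \<Prod>i\<in>I. f i x)"
  by (induction I rule: infinite_finite_induct) (auto intro!: C1_on_const C1_on_mult)

lemmas C1_intros = C1_on_scaleR C1_on_mult C1_on_inner C1_on_const C1_on_id C1_on_add
  C1_on_minus C1_on_diff C1_on_sum C1_on_prod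

lemma frechet_derivative_cong_open:
  assumes "open S" "x \<in> S" "\<And>y. y \<in> S \<Longrightarrow> f y = g y"
  shows "frechet_derivative f (at x) = frechet_derivative g (at x)"
  using has_derivative_transform_within_open[OF _ assms(1,2), of f _ UNIV g]
    has_derivative_transform_within_open[OF _ assms(1,2), of g _ UNIV f] assms(3)
  unfolding frechet_derivative_def by metis

lemma C1_on_cong_open:
  assumes "open S" "\<And>y. y \<in> S \<Longrightarrow> f y = g y" "C1_on S f"
  shows "C1_on S g"
proof (rule C1_onI)
  fix x assume "x \<in> S"
  then show "(g has_derivative frechet_derivative f (at x)) (at x)"
    using has_derivative_transform_within_open[OF C1_on_has_derivative[OF assms(3)] assms(1), of x g] assms(2)
    by auto
qed (use assms(3) in \<open>auto simp: C1_on_def\<close>)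

section \<open>Gluing and extension by zero\<close>

lemma C1_on_open_Un:
  assumes "open S" "open S'" "C1_on S f" "C1_on S' f"
  shows "C1_on (S \<union> S') f"
  using assms by (auto simp: C1_on_def intro: continuous_on_open_Un)

text \<open>The open sets \<open>S\<close> and \<open>- K\<close> cover the space, and
  \<open>f\<close> is zero on the second. In this way a field that is regular only on a moving
  domain becomes a global one after being cut off.\<close>

lemma C1_on_extend_zero:
  assumes "open S" "C1_on S f" "closed K" "K \<subseteq> S" "\<And>x. x \<notin> K \<Longrightarrow> f x = 0"
  shows "C1_on UNIV f"
proof -
  have "C1_on (- K) f"
    by (rule C1_on_cong_open[OF _ _ C1_on_const[of _ 0]]) (use assms in auto)
  from C1_on_open_Un[OF assms(1) _ assms(2) this] assms(3)
  have "C1_on (S \<union> - K) f" by auto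
  moreover have "S \<union> - K = UNIV" using assms(4) by auto
  ultimately show ?thesis by simp
qed

lemma continuous_on_extend_zero:
  assumes "open S" "continuous_on S f" "closed K" "K \<subseteq> S" "\<And>x. x \<notin> K \<Longrightarrow> f x = 0"
  shows "continuous_on UNIV f"
proof -
  have "continuous_on (- K) f"
    using assms(5) by (subst continuous_on_cong[OF refl, of _ _ "\<lambda>x. 0"]) auto
  from continuous_on_open_Un[OF assms(1) _ assms(2) this] assms(3)
  have "continuous_on (S \<union> - K) f" by auto
  moreover have "S \<union> - K = UNIV" using assms(4) by auto
  ultimately show ?thesis by simp
qed

lemma frechet_derivative_zero_outside:
  assumes "closed K" "\<And>x. x \<notin> K \<Longrightarrow> f x = 0" "x \<notin> K"
  shows "frechet_derivative f (at x) = (\<lambda>h. 0)"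
  using frechet_derivative_cong_open[of "- K" x f "\<lambda>x. 0"] assms by auto

lemma divergence_zero_outside:
  assumes "closed K" "\<And>x. x \<notin> K \<Longrightarrow> F x = 0" "x \<notin> K"
  shows "divergence F x = 0"
  by (simp add: divergence_def frechet_derivative_zero_outside[OF assms])

lemma divergence_cong_open:
  assumes "open S" "x \<in> S" "\<And>y. y \<in> S \<Longrightarrow> F y = G y"
  shows "divergence F x = divergence G x"
  using frechet_derivative_cong_open[OF assms, of "\<lambda>y. y"] by (simp add: divergence_def)

lemma continuous_on_divergence: "C1_on S F \<Longrightarrow> continuous_on S (divergence F)"
  unfolding divergence_def by (intro continuous_intros) (auto simp: C1_on_def)

section \<open>Sum and product rules for the divergence, and the gradient\<close>

lemma divergence_add:
  assumes "F differentiable (at x)" "G differentiable (at x)"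
  shows "divergence (\<lambda>y. F y + G y) x = divergence F x + divergence G x"
proof -
  have "frechet_derivative (\<lambda>y. F y + G y) (at x) = (\<lambda>h. frechet_derivative F (at x) h + frechet_derivative G (at x) h)"
    by (rule frechet_derivative_at[symmetric]) (intro has_derivative_add fd_works assms)
  then show ?thesis by (simp add: divergence_def inner_add_left sum.distrib)
qed

lemma divergence_sum:
  assumes "finite I" "\<And>i. i \<in> I \<Longrightarrow> F i differentiable (at x)"
  shows "divergence (\<lambda>y. \<Sum>i\<in>I. F i y) x = (\<Sum>i\<in>I. divergence (F i) x)"
  using assms
proof (induction I rule: finite_induct)
  case empty
  then show ?case by (simp add: divergence_def)
next
  case (insert i I)
  then show ?case by (simp add: divergence_add)
qed

lemma divergence_scaleR:
  assumes "u differentiable (at x)" "F differentiable (at x)"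
  shows "divergence (\<lambda>y. u y *\<^sub>R F y) x = u x * divergence F x + frechet_derivative u (at x) (F x)"
proof -
  let ?u = "frechet_derivative u (at x)" and ?F = "frechet_derivative F (at x)"
  have "((\<lambda>y. u y *\<^sub>R F y) has_derivative (\<lambda>h. u x *\<^sub>R ?F h + ?u h *\<^sub>R F x)) (at x)"
    using assms by (intro has_derivative_scaleR fd_works)
  then have 1: "frechet_derivative (\<lambda>y. u y *\<^sub>R F y) (at x) = (\<lambda>h. u x *\<^sub>R ?F h + ?u h *\<^sub>R F x)"
    by (metis frechet_derivative_at)
  have l: "linear ?u" using assms(1) by (rule linear_frechet_derivative)
  have "?u (F x) = ?u (\<Sum>b\<in>Basis. (F x \<bullet> b) *\<^sub>R b)" by (simp add: euclidean_representation)
  also have "\<dots> = (\<Sum>b\<in>Basis. (F x \<bullet> b) * ?u b)" by (simp add: linear_sum[OF l] linear_cmul[OF l])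
  finally show ?thesis
    by (simp add: 1 divergence_def inner_add_left sum.distrib sum_distrib_left mult.commute)
qed

lemma frechet_derivative_eq_gradient:
  assumes "g differentiable (at x)"
  shows "frechet_derivative g (at x) h = gradient g x \<bullet> h"
proof -
  let ?g = "frechet_derivative g (at x)"
  have l: "linear ?g" using assms by (rule linear_frechet_derivative)
  have "?g h = ?g (\<Sum>b\<in>Basis. (h \<bullet> b) *\<^sub>R b)" by (simp add: euclidean_representation)
  also have "\<dots> = (\<Sum>b\<in>Basis. (h \<bullet> b) * ?g b)" by (simp add: linear_sum[OF l] linear_cmul[OF l])
  finally show ?thesis
    unfolding gradient_def inner_sum_left by (simp add: inner_commute mult.commute)
qed

lemma C1_on_local:
  assumes "\<And>x. x \<in> S \<Longrightarrow> \<exists>T. open T \<and> x \<in> T \<and> C1_on T f"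
  shows "C1_on S f"
proof (rule C1_onI)
  fix x assume "x \<in> S"
  then show "(f has_derivative frechet_derivative f (at x)) (at x)"
    using assms C1_on_has_derivative by blast
next
  fix h
  have "isCont (\<lambda>x. frechet_derivative f (at x) h) x" if "x \<in> S" for x
    using assms[OF that] by (auto simp: C1_on_def continuous_on_eq_continuous_at)
  then show "continuous_on S (\<lambda>x. frechet_derivative f (at x) h)"
    by (simp add: continuous_at_imp_continuous_on)
qed

lemma continuous_on_gradient: "C1_on S g \<Longrightarrow> continuous_on S (gradient g)"
  unfolding gradient_def by (intro continuous_intros) (auto simp: C1_on_def)

lemma gradient_cong_open:
  assumes "open S" "x \<in> S" "\<And>y. y \<in> S \<Longrightarrow> f y = g y"
  shows "gradient f x = gradient g x"
  using frechet_derivative_cong_open[OF assms, of "\<lambda>y. y"] by (simp add: gradient_def)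

section \<open>Cutoff functions and partitions of unity\<close>

text \<open>Cutoffs of class C^1 suffice for the integral identities, so this squared ramp takes the
  place of the usual exp (- 1 / s).\<close>

lemma C1_max_zero_square: "C1_on UNIV (\<lambda>s::real. (max 0 s)\<^sup>2)"
proof (rule C1_onI)
  fix x :: real
  have "((\<lambda>s. (max 0 s)\<^sup>2) has_real_derivative 2 * max 0 x) (at x)"
  proof (cases x "0::real" rule: linorder_cases)
    case less
    have "((\<lambda>s::real. 0) has_real_derivative 2 * max 0 x) (at x)" using less by simp
    from this show ?thesis
      by (rule has_field_derivative_transform_within_open[where S="{..<0}"]) (use less in auto)
  next
    case greater
    have "((\<lambda>s::real. s\<^sup>2) has_real_derivative 2 * max 0 x) (at x)"
      using greater by (auto intro!: derivative_eq_intros)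
    from this show ?thesis
      by (rule has_field_derivative_transform_within_open[where S="{0<..}"]) (use greater in auto)
  next
    case equal
    have "((\<lambda>h::real. ((max 0 h)\<^sup>2) / h) \<longlongrightarrow> 0) (at 0)"
    proof (rule Lim_null_comparison)
      show "\<forall>\<^sub>F h in at 0. norm ((max 0 h)\<^sup>2 / h) \<le> \<bar>h::real\<bar>"
        by (rule always_eventually) (auto simp: max_def power2_eq_square)
      show "((\<lambda>h::real. \<bar>h\<bar>) \<longlongrightarrow> 0) (at 0)"
        by (auto intro!: tendsto_eq_intros)
    qed
    then show ?thesis using equal by (simp add: DERIV_def)
  qed
  then show "((\<lambda>s. (max 0 s)\<^sup>2) has_derivative (\<lambda>h. 2 * max 0 x * h)) (at x)"
    by (simp add: has_field_derivative_def)
qed (intro continuous_intros)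

text \<open>The inner square makes the step flat at 0 and the outer square makes it flat at 1, which
  gives class C^1 across both ends.\<close>

definition smooth_step :: "real \<Rightarrow> real" where
  "smooth_step s = 1 - (max 0 (1 - (max 0 s)\<^sup>2))\<^sup>2"

lemma C1_smooth_step: "C1_on UNIV smooth_step"
  unfolding smooth_step_def
  by (intro C1_intros C1_on_compose[OF _ C1_max_zero_square] C1_max_zero_square) auto

lemma smooth_step_le_0: "s \<le> 0 \<Longrightarrow> smooth_step s = 0"
  and smooth_step_ge_1: "1 \<le> s \<Longrightarrow> smooth_step s = 1"
  and smooth_step_nonneg: "0 \<le> smooth_step s"
  and smooth_step_le_1: "smooth_step s \<le> 1"
proof -
  show "s \<le> 0 \<Longrightarrow> smooth_step s = 0" by (simp add: smooth_step_def)
  show "1 \<le> s \<Longrightarrow> smooth_step s = 1" by (simp add: smooth_step_def)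
  show "0 \<le> smooth_step s" by (simp add: smooth_step_def abs_square_le_1 max_def)
  show "smooth_step s \<le> 1" by (simp add: smooth_step_def)
qed

text \<open>The squared distance is used because the distance itself is not differentiable at
  \<open>p\<close>. The bump is 1 up to radius r and 0 from radius sqrt 2 * r on; the radius 2 * r
  used below is a convenient cruder bound.\<close>

definition bump :: "'a::euclidean_space \<Rightarrow> real \<Rightarrow> 'a \<Rightarrow> real" where
  "bump p r x = smooth_step (2 - ((x - p) \<bullet> (x - p)) / r\<^sup>2)"

lemma C1_bump: "C1_on UNIV (bump p r)"
proof -
  have "C1_on UNIV (\<lambda>x. 2 - (1 / r\<^sup>2) * ((x - p) \<bullet> (x - p)))"
    by (intro C1_intros)
  from C1_on_compose[OF this C1_smooth_step] show ?thesis
    by (simp add: bump_def[abs_def])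
qed

lemma bump_bounds: "0 \<le> bump p r x" "bump p r x \<le> 1"
  by (simp_all add: bump_def smooth_step_nonneg smooth_step_le_1)

lemma bump_eq_1:
  assumes "0 < r" "x \<in> ball p r"
  shows "bump p r x = 1"
proof -
  have "(x - p) \<bullet> (x - p) \<le> r\<^sup>2"
    using assms by (simp add: dist_norm norm_minus_commute flip: power2_norm_eq_inner)
  then show ?thesis
    unfolding bump_def using assms(1) by (intro smooth_step_ge_1) (simp add: field_simps)
qed

lemma bump_eq_0:
  assumes "0 < r" "x \<notin> cball p (2 * r)"
  shows "bump p r x = 0"
proof -
  have "2 * r < norm (x - p)" using assms(2) by (simp add: dist_norm norm_minus_commute)
  then have "(2 * r)\<^sup>2 \<le> (norm (x - p))\<^sup>2" using assms(1) by (intro power_mono) auto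
  then have "4 * r\<^sup>2 \<le> (x - p) \<bullet> (x - p)" by (simp add: power_mult_distrib power2_norm_eq_inner)
  then show ?thesis
    unfolding bump_def using assms(1)
    by (intro smooth_step_le_0) (simp add: field_simps, smt (verit) zero_le_power2)
qed

text \<open>Each summand is the difference of two consecutive partial products.\<close>

lemma sum_telescoping_prod:
  fixes b :: "nat \<Rightarrow> 'a::comm_ring_1"
  shows "(\<Sum>i<m. b i * (\<Prod>j<i. 1 - b j)) = 1 - (\<Prod>j<m. 1 - b j)"
  by (induction m) (auto simp: algebra_simps)

text \<open>Bumps b i are multiplied by the product of 1 - b j over j < i. By
  \<open>sum_telescoping_prod\<close> these functions sum to 1 - (product of all 1 - b j), which is
  1 wherever some bump is 1 and never exceeds 1, so no division by a sum of bumps occurs. The sets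
  are indexed by points of \<open>K\<close> so that a chart chosen for each point can be recovered
  from \<open>p i\<close>.\<close>

lemma partition_of_unity:
  fixes K :: "'a::euclidean_space set"
  assumes "compact K" and U: "\<And>p. p \<in> K \<Longrightarrow> open (U p) \<and> p \<in> U p"
  obtains m :: nat and p and \<eta> :: "nat \<Rightarrow> 'a \<Rightarrow> real" and S where
    "\<And>i. i < m \<Longrightarrow> p i \<in> K \<and> C1_on UNIV (\<eta> i) \<and> (\<forall>x. 0 \<le> \<eta> i x) \<and>
       compact (closure {x. \<eta> i x \<noteq> 0}) \<and> closure {x. \<eta> i x \<noteq> 0} \<subseteq> U (p i)"
    "open S" "K \<subseteq> S" "\<And>x. x \<in> S \<Longrightarrow> (\<Sum>i<m. \<eta> i x) = 1" "\<And>x. (\<Sum>i<m. \<eta> i x) \<le> 1"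
proof -
  have "\<exists>r>0. cball p (2 * r) \<subseteq> U p" if "p \<in> K" for p
  proof -
    from U[OF that] obtain e where "e > 0" "cball p e \<subseteq> U p" using open_contains_cball by blast
    then show ?thesis by (intro exI[of _ "e/2"]) auto
  qed
  then obtain r where r: "\<And>p. p \<in> K \<Longrightarrow> r p > 0 \<and> cball p (2 * r p) \<subseteq> U p" by metis
  have "K \<subseteq> (\<Union>p\<in>K. ball p (r p))" using r by force
  then obtain C where C: "C \<subseteq> K" "finite C" "K \<subseteq> (\<Union>p\<in>C. ball p (r p))"
    by (rule compactE_image[OF \<open>compact K\<close>, of K "\<lambda>p. ball p (r p)", rotated]) auto
  obtain ps where ps: "set ps = C" using finite_list[OF C(2)] by blast
  define m where "m = length ps"
  define b where "b i = bump (ps ! i) (r (ps ! i))" for i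
  define \<eta> where "\<eta> i x = b i x * (\<Prod>j<i. 1 - b j x)" for i x
  have b01: "0 \<le> b i x" "b i x \<le> 1" for i x by (simp_all add: b_def bump_bounds)
  have psK: "ps ! i \<in> K" if "i < m" for i using that ps C(1) m_def by auto
  show ?thesis
  proof (rule that[of m "\<lambda>i. ps ! i" \<eta> "\<Union>p\<in>C. ball p (r p)"])
    fix i assume i: "i < m"
    have "{x. \<eta> i x \<noteq> 0} \<subseteq> cball (ps ! i) (2 * r (ps ! i))"
    proof
      fix x assume "x \<in> {x. \<eta> i x \<noteq> 0}"
      then have "bump (ps ! i) (r (ps ! i)) x \<noteq> 0" by (auto simp: \<eta>_def b_def)
      then show "x \<in> cball (ps ! i) (2 * r (ps ! i))" using bump_eq_0 r[OF psK[OF i]] by blast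
    qed
    then have cl: "closure {x. \<eta> i x \<noteq> 0} \<subseteq> cball (ps ! i) (2 * r (ps ! i))"
      by (rule closure_minimal) simp
    then have "compact (closure {x. \<eta> i x \<noteq> 0})"
      by (meson bounded_cball bounded_subset closed_closure compact_eq_bounded_closed)
    moreover have "C1_on UNIV (\<eta> i)"
      unfolding \<eta>_def[abs_def] b_def by (intro C1_intros C1_bump)
    moreover have "0 \<le> \<eta> i x" for x
      using b01 unfolding \<eta>_def by (intro mult_nonneg_nonneg prod_nonneg) auto
    ultimately show "ps ! i \<in> K \<and> C1_on UNIV (\<eta> i) \<and> (\<forall>x. 0 \<le> \<eta> i x) \<and>
       compact (closure {x. \<eta> i x \<noteq> 0}) \<and> closure {x. \<eta> i x \<noteq> 0} \<subseteq> U (ps ! i)"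
      using cl r[OF psK[OF i]] psK[OF i] by auto
  next
    fix x assume "x \<in> (\<Union>p\<in>C. ball p (r p))"
    then obtain j where j: "j < m" "x \<in> ball (ps ! j) (r (ps ! j))"
      using ps unfolding m_def by (metis UN_E in_set_conv_nth)
    then have "b j x = 1" unfolding b_def using bump_eq_1 r psK by blast
    then have "(\<Prod>j<m. 1 - b j x) = 0" using j(1) by (intro prod_zero) auto
    then show "(\<Sum>i<m. \<eta> i x) = 1" by (simp add: \<eta>_def sum_telescoping_prod)
  next
    fix x
    have "0 \<le> (\<Prod>j<m. 1 - b j x)" using b01 by (intro prod_nonneg) auto
    then show "(\<Sum>i<m. \<eta> i x) \<le> 1" by (simp add: \<eta>_def sum_telescoping_prod)
  qed (use C in auto)
qed

text \<open>With the constant family \<open>U\<close> in \<open>partition_of_unity\<close>, the sum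
  of the resulting functions is a cutoff.\<close>

lemma cutoff_exists:
  fixes K :: "'a::euclidean_space set"
  assumes "compact K" "open U" "K \<subseteq> U"
  obtains \<kappa> S where "C1_on UNIV \<kappa>" "\<And>x. 0 \<le> \<kappa> x" "\<And>x. \<kappa> x \<le> (1::real)"
    "compact (closure {x. \<kappa> x \<noteq> 0})" "closure {x. \<kappa> x \<noteq> 0} \<subseteq> U"
    "open S" "K \<subseteq> S" "\<And>x. x \<in> S \<Longrightarrow> \<kappa> x = 1"
proof -
  have "open U \<and> p \<in> U" if "p \<in> K" for p using assms that by auto
  then show ?thesis
  proof (rule partition_of_unity[OF assms(1)])
    fix m :: nat and p :: "nat \<Rightarrow> 'a" and \<eta> :: "nat \<Rightarrow> 'a \<Rightarrow> real" and S
    assume P: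
      "\<And>i. i < m \<Longrightarrow> p i \<in> K \<and> C1_on UNIV (\<eta> i) \<and> (\<forall>x. 0 \<le> \<eta> i x) \<and>
         compact (closure {x. \<eta> i x \<noteq> 0}) \<and> closure {x. \<eta> i x \<noteq> 0} \<subseteq> U"
      "open S" "K \<subseteq> S" "\<And>x. x \<in> S \<Longrightarrow> (\<Sum>i<m. \<eta> i x) = 1" "\<And>x. (\<Sum>i<m. \<eta> i x) \<le> (1::real)"
    let ?D = "\<Union>i<m. closure {x. \<eta> i x \<noteq> 0}"
    have D: "compact ?D" "?D \<subseteq> U" using P(1) by (auto intro!: compact_UN)
    have "{x. (\<Sum>i<m. \<eta> i x) \<noteq> 0} \<subseteq> ?D"
    proof
      fix x assume "x \<in> {x. (\<Sum>i<m. \<eta> i x) \<noteq> 0}"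
      then obtain i where "i < m" "\<eta> i x \<noteq> 0"
        by (metis (mono_tags, lifting) lessThan_iff mem_Collect_eq sum.not_neutral_contains_not_neutral)
      then show "x \<in> ?D" using closure_subset[of "{x. \<eta> i x \<noteq> 0}"] by blast
    qed
    then have cl: "closure {x. (\<Sum>i<m. \<eta> i x) \<noteq> 0} \<subseteq> ?D"
      by (rule closure_minimal) (use D compact_imp_closed in auto)
    show ?thesis
    proof (rule that[of "\<lambda>x. \<Sum>i<m. \<eta> i x" S])
      show "compact (closure {x. (\<Sum>i<m. \<eta> i x) \<noteq> 0})"
        using cl D(1) by (meson bounded_subset closed_closure compact_eq_bounded_closed)
      show "C1_on UNIV (\<lambda>x. \<Sum>i<m. \<eta> i x)" using P(1) by (intro C1_on_sum) auto
      show "0 \<le> (\<Sum>i<m. \<eta> i x)" for x using P(1) by (intro sum_nonneg) auto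
      show "closure {x. (\<Sum>i<m. \<eta> i x) \<noteq> 0} \<subseteq> U" using cl D(2) by (rule subset_trans)
    qed (fact P)+
  qed
qed

section \<open>The divergence theorem\<close>

lemma integrable_compact_support:
  fixes f :: "'a::euclidean_space \<Rightarrow> 'b::{banach, second_countable_topology}"
  assumes "continuous_on UNIV f" "compact K" "\<And>x. x \<notin> K \<Longrightarrow> f x = 0"
  shows "integrable lborel f"
proof -
  have "integrable lborel (\<lambda>x. indicator K x *\<^sub>R f x)"
    using assms(2) continuous_on_subset[OF assms(1)] by (intro borel_integrable_compact) auto
  moreover have "(\<lambda>x. indicator K x *\<^sub>R f x) = f"
    using assms(3) by (auto simp: indicator_def)
  ultimately show ?thesis by simp
qed

lemma integrable_compact_support_indicator:
  fixes f :: "'a::euclidean_space \<Rightarrow> real"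
  assumes "continuous_on UNIV f" "compact K" "\<And>x. x \<notin> K \<Longrightarrow> f x = 0" "A \<in> sets borel"
  shows "integrable lborel (\<lambda>x. indicator A x * f x)"
  using integrable_mult_indicator[OF _ integrable_compact_support[OF assms(1-3)], of A] assms(4) by simp

lemma bounded_compact_support:
  fixes f :: "'a::euclidean_space \<Rightarrow> 'b::real_normed_vector"
  assumes "continuous_on UNIV f" "compact K" "\<And>x. x \<notin> K \<Longrightarrow> f x = 0"
  obtains M where "0 < M" "\<And>x. norm (f x) \<le> M"
proof -
  have "bounded (f ` K)"
    using assms by (meson compact_continuous_image compact_imp_bounded continuous_on_subset subset_UNIV)
  then obtain M where "0 < M" "\<And>x. x \<in> K \<Longrightarrow> norm (f x) \<le> M"
    unfolding bounded_pos by auto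
  then show ?thesis using that[of M] assms(3) by (metis less_imp_le norm_zero)
qed

text \<open>One compact set \<open>K\<close> contains the supports for all parameters, so the
  integrals reduce to a fixed box, where the Leibniz rule for continuous derivatives
  applies.\<close>

lemma lborel_integral_leibniz:
  fixes P P' :: "real \<Rightarrow> 'a::euclidean_space \<Rightarrow> real"
  assumes "compact K" "open U" "convex U" "t \<in> U"
    and deriv: "\<And>s x. s \<in> U \<Longrightarrow> ((\<lambda>s. P s x) has_real_derivative P' s x) (at s)"
    and cont: "\<And>s. s \<in> U \<Longrightarrow> continuous_on UNIV (P s)"
    and cont': "continuous_on (U \<times> UNIV) (\<lambda>(s, x). P' s x)"
    and zero: "\<And>s x. s \<in> U \<Longrightarrow> x \<notin> K \<Longrightarrow> P s x = 0"
  shows "((\<lambda>s. LBINT x. P s x) has_real_derivative (LBINT x. P' t x)) (at t)"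
proof -
  obtain a where a: "K \<subseteq> cbox (-a) a"
    using bounded_subset_cbox_symmetric[OF compact_imp_bounded[OF \<open>compact K\<close>]] by blast
  have eq: "(LBINT x. f x) = integral (cbox (-a) a) f"
    if "continuous_on UNIV f" "\<And>x. x \<notin> K \<Longrightarrow> f x = 0" for f :: "'a \<Rightarrow> real"
  proof -
    have "(LBINT x. f x) = integral UNIV f"
      by (rule integral_lborel[symmetric]) (rule integrable_compact_support[OF that(1) \<open>compact K\<close> that(2)])
    also have "\<dots> = integral UNIV (\<lambda>x. if x \<in> cbox (-a) a then f x else 0)"
      using a that(2) by (intro integral_cong) auto
    also have "\<dots> = integral (cbox (-a) a) f"
      by (rule integral_restrict_UNIV)
    finally show ?thesis .
  qed
  \<comment> \<open>Off \<open>K\<close> the map s -> P s x is constantly zero near t, so the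
    derivative vanishes there as well.\<close>
  have zero': "P' t x = 0" if "x \<notin> K" for x
  proof -
    have "((\<lambda>s. 0) has_real_derivative P' t x) (at t)"
      by (rule has_field_derivative_transform_within_open[OF deriv \<open>open U\<close>])
        (use that zero \<open>t \<in> U\<close> in auto)
    then show ?thesis by (metis DERIV_const DERIV_unique)
  qed
  have "((\<lambda>s. integral (cbox (-a) a) (P s)) has_real_derivative integral (cbox (-a) a) (P' t)) (at t within U)"
  proof (rule leibniz_rule_field_derivative[OF _ _ _ \<open>t \<in> U\<close> \<open>convex U\<close>])
    show "P s integrable_on cbox (-a) a" if "s \<in> U" for s
      using cont[OF that] by (intro integrable_continuous) (rule continuous_on_subset, auto)
    show "continuous_on (U \<times> cbox (-a) a) (\<lambda>(s, x). P' s x)"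
      using cont' by (rule continuous_on_subset) auto
  qed (rule has_field_derivative_at_within[OF deriv])
  then have "((\<lambda>s. integral (cbox (-a) a) (P s)) has_real_derivative integral (cbox (-a) a) (P' t)) (at t)"
    using at_within_open[OF \<open>t \<in> U\<close> \<open>open U\<close>] by simp
  then have "((\<lambda>s. LBINT x. P s x) has_real_derivative integral (cbox (-a) a) (P' t)) (at t)"
    by (rule has_field_derivative_transform_within_open[OF _ \<open>open U\<close> \<open>t \<in> U\<close>])
      (simp add: eq cont zero)
  moreover have "continuous_on UNIV (\<lambda>x. case (t, x) of (s, x) \<Rightarrow> P' s x)"
    by (rule continuous_on_compose2[OF cont'])
      (use \<open>t \<in> U\<close> in \<open>auto intro!: continuous_on_Pair continuous_on_const continuous_on_id\<close>)
  then have "continuous_on UNIV (P' t)" by simp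
  then have "(LBINT x. P' t x) = integral (cbox (-a) a) (P' t)"
    by (rule eq) (rule zero')
  ultimately show ?thesis by simp
qed

lemma lborel_integral_translation:
  fixes f :: "'a::euclidean_space \<Rightarrow> real"
  assumes "f \<in> borel_measurable borel"
  shows "(LBINT x. f (c + x)) = (LBINT x. f x)"
proof -
  have "(\<integral>x. f x \<partial>distr lborel borel ((+) c)) = (LBINT x. f (c + x))"
    using assms by (intro integral_distr) auto
  then show ?thesis by (simp add: lborel_distr_plus)
qed

text \<open>Translation invariance makes \<open>s \<mapsto> \<integral> u (x + s b) dx\<close> constant, so its derivative vanishes.\<close>

lemma integral_divergence_compact_support:
  fixes G :: "'a::euclidean_space \<Rightarrow> 'a"
  assumes G: "C1_on UNIV G" and K: "compact K" and zero: "\<And>x. x \<notin> K \<Longrightarrow> G x = 0"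
  shows "(LBINT x. divergence G x) = 0"
proof -
  let ?G = "\<lambda>x. frechet_derivative G (at x)"
  have 0: "?G x = (\<lambda>h. 0)" if "x \<notin> K" for x
    using frechet_derivative_zero_outside[OF compact_imp_closed[OF K] zero that] .
  have cont: "continuous_on UNIV (\<lambda>x. ?G x b \<bullet> b)" for b
    using G by (auto simp: C1_on_def intro!: continuous_intros)
  have "(LBINT x. ?G x b \<bullet> b) = 0" if "b \<in> Basis" for b
  proof -
    \<comment> \<open>The common support of all translates by at most 1, as required for
      differentiating under the integral at 0.\<close>
    define K' where "K' = (\<lambda>(s, x). x - s *\<^sub>R b) ` (cball 0 1 \<times> K)"
    have "compact K'"
      unfolding K'_def using K by (intro compact_continuous_image compact_Times)
        (auto intro!: continuous_intros simp: case_prod_unfold)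
    have P: "G (x + s *\<^sub>R b) \<bullet> b = 0" if "s \<in> ball 0 1" "x \<notin> K'" for s x
    proof -
      have "x + s *\<^sub>R b \<notin> K"
      proof
        assume "x + s *\<^sub>R b \<in> K"
        then have "x \<in> K'"
          unfolding K'_def using that(1) by (intro image_eqI[of _ _ "(s, x + s *\<^sub>R b)"]) auto
        with that show False by simp
      qed
      then show ?thesis by (simp add: zero)
    qed
    have "((\<lambda>s. LBINT x. G (x + s *\<^sub>R b) \<bullet> b) has_real_derivative
        (LBINT x. ?G (x + 0 *\<^sub>R b) b \<bullet> b)) (at 0)"
    proof (rule lborel_integral_leibniz[OF \<open>compact K'\<close>, of "ball 0 1"])
      fix s :: real and x :: 'a
      have "((\<lambda>y. G y \<bullet> b) has_derivative (\<lambda>h. ?G (x + s *\<^sub>R b) h \<bullet> b)) (at (x + s *\<^sub>R b))"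
        using C1_on_has_derivative[OF G] by (intro has_derivative_inner_left) simp
      moreover have "((\<lambda>s. x + s *\<^sub>R b) has_derivative (\<lambda>h. h *\<^sub>R b)) (at s)"
        by (auto intro!: derivative_eq_intros)
      ultimately have "((\<lambda>s. G (x + s *\<^sub>R b) \<bullet> b) has_derivative (\<lambda>h. ?G (x + s *\<^sub>R b) (h *\<^sub>R b) \<bullet> b)) (at s)"
        using diff_chain_at[of "\<lambda>s. x + s *\<^sub>R b"] by (simp add: o_def)
      moreover have "linear (?G y)" for y
        using C1_on_has_derivative[OF G] has_derivative_linear by blast
      ultimately show "((\<lambda>s. G (x + s *\<^sub>R b) \<bullet> b) has_real_derivative ?G (x + s *\<^sub>R b) b \<bullet> b) (at s)"
        unfolding has_field_derivative_def
        by (elim has_derivative_eq_rhs) (simp add: fun_eq_iff linear_cmul)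
    next
      show "continuous_on UNIV (\<lambda>x. G (x + s *\<^sub>R b) \<bullet> b)" for s
        by (intro continuous_intros continuous_on_compose2[OF C1_on_continuous[OF G]]) auto
      show "continuous_on (ball 0 1 \<times> UNIV) (\<lambda>(s, x). ?G (x + s *\<^sub>R b) b \<bullet> b)"
        unfolding case_prod_unfold
        by (intro continuous_on_compose2[OF cont[of b]] continuous_intros) auto
    qed (use P in auto)
    moreover have "(LBINT x. G (x + s *\<^sub>R b) \<bullet> b) = (LBINT x. G x \<bullet> b)" for s
    proof -
      have "(\<lambda>x. G x \<bullet> b) \<in> borel_measurable borel"
        by (intro borel_measurable_continuous_onI continuous_intros C1_on_continuous[OF G])
      from lborel_integral_translation[OF this, of "s *\<^sub>R b"] show ?thesis by (simp add: add.commute)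
    qed
    ultimately have "((\<lambda>s::real. LBINT x. G x \<bullet> b) has_real_derivative
        (LBINT x. ?G (x + 0 *\<^sub>R b) b \<bullet> b)) (at 0)"
      by simp
    then have "(LBINT x. ?G (x + 0 *\<^sub>R b) b \<bullet> b) = 0"
      by (rule DERIV_unique) (rule DERIV_const)
    then show ?thesis by simp
  qed
  moreover have "integrable lborel (\<lambda>x. ?G x b \<bullet> b)" for b
    by (rule integrable_compact_support[OF cont K]) (simp add: 0)
  ultimately show ?thesis
    unfolding divergence_def by (simp add: Bochner_Integration.integral_sum)
qed

section \<open>Slicing along a coordinate axis\<close>

lemma signed_Basis_inner_same: "k \<in> Basis \<or> - k \<in> Basis \<Longrightarrow> k \<bullet> k = 1"
  by (metis inner_minus_left inner_minus_right inner_same_Basis minus_minus)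

lemma uminus_notin_Basis:
  assumes "b \<in> Basis"
  shows "- b \<notin> Basis"
proof
  assume "- b \<in> Basis"
  then have "0 \<le> b \<bullet> (- b)" using inner_Basis[OF assms, of "- b"] by (metis order_refl zero_le_one)
  then show False using inner_same_Basis[OF assms] by simp
qed

text \<open>Lebesgue measure is a product with one factor per basis vector, and Fubini splits off
  the factor of the axis of \<open>k\<close>. If \<open>k\<close> is the negative of a basis vector,
  the inner integral is reflected, which does not change it.\<close>

lemma lborel_integral_slice:
  fixes f :: "'a::euclidean_space \<Rightarrow> real" and k :: 'a
  assumes k: "k \<in> Basis \<or> - k \<in> Basis" and f: "integrable lborel f"
  shows "(LBINT x. f x) = (\<integral>z. (LBINT s. f ((\<Sum>b\<in>Basis - {k, - k}. z b *\<^sub>R b) + s *\<^sub>R k))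
           \<partial>(\<Pi>\<^sub>M b\<in>Basis - {k, - k}. lborel))"
proof -
  define B where "B = Basis - {k, - k}"
  define \<sigma> :: real where "\<sigma> = (if k \<in> Basis then 1 else - 1)"
  define c where "c = \<sigma> *\<^sub>R k"
  have c: "c \<in> Basis" using k by (auto simp: c_def \<sigma>_def)
  have B: "Basis = insert c B" "c \<notin> B" "finite B"
    using k uminus_notin_Basis[of k] by (auto simp: B_def c_def \<sigma>_def)
  interpret product_sigma_finite "\<lambda>b::'a. lborel :: real measure" ..
  let ?S = "\<lambda>z. \<Sum>b\<in>Basis. z b *\<^sub>R b"
  have m: "?S \<in> (\<Pi>\<^sub>M b\<in>Basis. lborel) \<rightarrow>\<^sub>M borel" by measurable
  have fm: "f \<in> borel_measurable borel" using f by auto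
  have i: "integrable (\<Pi>\<^sub>M b\<in>insert c B. lborel) (\<lambda>z. f (?S z))"
    using f m fm by (subst (asm) lborel_eq) (simp add: integrable_distr_eq B(1)[symmetric])
  have "(LBINT x. f x) = (\<integral>z. f (?S z) \<partial>(\<Pi>\<^sub>M b\<in>insert c B. lborel))"
    using m fm by (subst lborel_eq) (simp add: integral_distr B(1)[symmetric])
  also have "\<dots> = (\<integral>z. (LBINT s. f (?S (z(c := s)))) \<partial>(\<Pi>\<^sub>M b\<in>B. lborel))"
    using B by (intro product_integral_insert i) auto
  also have "\<dots> = (\<integral>z. (LBINT s. f ((\<Sum>b\<in>B. z b *\<^sub>R b) + s *\<^sub>R k)) \<partial>(\<Pi>\<^sub>M b\<in>B. lborel))"
  proof (rule Bochner_Integration.integral_cong[OF refl])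
    fix z :: "'a \<Rightarrow> real"
    have "?S (z(c := s)) = (\<Sum>b\<in>B. z b *\<^sub>R b) + s *\<^sub>R c" for s
    proof -
      have "?S (z(c := s)) = s *\<^sub>R c + (\<Sum>b\<in>B. (z(c := s)) b *\<^sub>R b)"
        by (subst B(1)) (use B(2,3) in simp)
      also have "(\<Sum>b\<in>B. (z(c := s)) b *\<^sub>R b) = (\<Sum>b\<in>B. z b *\<^sub>R b)"
        using B(2) by (intro sum.cong) auto
      finally show ?thesis by simp
    qed
    then have "(LBINT s. f (?S (z(c := s)))) = (LBINT s. f ((\<Sum>b\<in>B. z b *\<^sub>R b) + (\<sigma> * s) *\<^sub>R k))"
      by (simp add: c_def mult.commute)
    also have "\<dots> = (LBINT s. f ((\<Sum>b\<in>B. z b *\<^sub>R b) + s *\<^sub>R k))"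
      by (subst lborel_integral_real_affine[of \<sigma> "\<lambda>s. f ((\<Sum>b\<in>B. z b *\<^sub>R b) + s *\<^sub>R k)" 0])
        (simp_all add: \<sigma>_def)
    finally show "(LBINT s. f (?S (z(c := s)))) = (LBINT s. f ((\<Sum>b\<in>B. z b *\<^sub>R b) + s *\<^sub>R k))" .
  qed
  finally show ?thesis unfolding B_def .
qed

abbreviation smooth_step_deriv :: "real \<Rightarrow> real" where
  "smooth_step_deriv u \<equiv> frechet_derivative smooth_step (at u) 1"

lemma smooth_step_has_real_derivative:
  "(smooth_step has_real_derivative smooth_step_deriv u) (at u)"
proof -
  have "linear (frechet_derivative smooth_step (at u))"
    using C1_on_has_derivative[OF C1_smooth_step UNIV_I] by (rule has_derivative_linear)
  then have "frechet_derivative smooth_step (at u) h = smooth_step_deriv u * h" for h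
    using linear_cmul[of "frechet_derivative smooth_step (at u)" h 1] by (simp add: mult.commute)
  with C1_on_has_derivative[OF C1_smooth_step UNIV_I, of u] show ?thesis
    unfolding has_field_derivative_def by (rule has_derivative_eq_rhs[OF _ ext])
qed

lemma continuous_on_smooth_step_deriv: "continuous_on UNIV smooth_step_deriv"
  using C1_smooth_step by (simp add: C1_on_def)

lemma smooth_step_deriv_eq_0:
  assumes "u \<notin> {0..1}"
  shows "smooth_step_deriv u = 0"
proof (cases "u < 0")
  case True
  have "frechet_derivative smooth_step (at u) = frechet_derivative (\<lambda>x. 0) (at u)"
    by (rule frechet_derivative_cong_open[of "{..<0}"]) (use True in \<open>auto simp: smooth_step_le_0\<close>)
  then show ?thesis by simp
next
  case False
  have "frechet_derivative smooth_step (at u) = frechet_derivative (\<lambda>x. 1) (at u)"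
    by (rule frechet_derivative_cong_open[of "{1<..}"]) (use False assms in \<open>auto simp: smooth_step_ge_1\<close>)
  then show ?thesis by simp
qed

text \<open>This unit mass makes the rescaled derivatives concentrate on the graph with total weight
  1, so that the layer integral tends to the flux itself.\<close>

lemma integral_smooth_step_deriv: "(LBINT u. smooth_step_deriv u) = 1"
proof -
  have "(LBINT u. smooth_step_deriv u * indicator {0..1} u) = smooth_step 1 - smooth_step 0"
    using continuous_on_smooth_step_deriv
    by (intro integral_FTC_Icc_real smooth_step_has_real_derivative)
      (auto simp: continuous_on_eq_continuous_at)
  moreover have "smooth_step_deriv u * indicator {0..1} u = smooth_step_deriv u" for u
    using smooth_step_deriv_eq_0[of u] by (cases "u \<in> {0..1}") auto
  ultimately show ?thesis by (simp add: smooth_step_ge_1 smooth_step_le_0)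
qed

text \<open>
  With \<open>\<rho>\<^sub>N = smooth_step (N (g x - x \<bullet> k))\<close>, which tends to the indicator of \<open>x \<bullet> k < g x\<close>, the
  identity \<open>\<integral> div (\<rho>\<^sub>N G) = 0\<close> turns \<open>\<integral> \<rho>\<^sub>N div G\<close> into an integral of \<open>G \<bullet> (k - gradient g)\<close> over a
  layer of thickness \<open>1 / N\<close> below the graph.
\<close>

lemma integral_divergence_below_graph:
  fixes G :: "'a::euclidean_space \<Rightarrow> 'a"
  assumes k: "k \<in> Basis \<or> - k \<in> Basis" and g: "C1_on UNIV g"
    and gk: "\<And>x c. g (x + c *\<^sub>R k) = g x"
    and G: "C1_on UNIV G" and K: "compact K" and zero: "\<And>x. x \<notin> K \<Longrightarrow> G x = 0"
  shows "(LBINT x. indicator {x. x \<bullet> k < g x} x * divergence G x) = graph_flux G k g"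
proof -
  define B where "B = Basis - {k, - k}"
  define p :: "('a \<Rightarrow> real) \<Rightarrow> 'a" where "p z = (\<Sum>b\<in>B. z b *\<^sub>R b)" for z
  define \<Phi> where "\<Phi> x = G x \<bullet> (k - gradient g x)" for x
  let ?M = "\<Pi>\<^sub>M b\<in>B. (lborel :: real measure)"
  let ?N = "\<lambda>n. real (Suc n)"
  have kk: "k \<bullet> k = 1" using k by (rule signed_Basis_inner_same)
  have kb: "b \<bullet> k = 0" if "b \<in> B" for b
    using k that inner_Basis[of b k] inner_Basis[of b "- k"] by (auto simp: B_def)
  have pk: "p z \<bullet> k = 0" for z by (simp add: p_def inner_sum_left kb)
  have pb: "p z \<bullet> b = z b" if "b \<in> B" for z b
  proof -
    have "p z \<bullet> b = (\<Sum>c\<in>B. z c * (c \<bullet> b))" by (simp add: p_def inner_sum_left)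
    also have "\<dots> = (\<Sum>c\<in>B. if c = b then z c else 0)"
      using that by (intro sum.cong) (auto simp: B_def inner_Basis)
    also have "\<dots> = z b" using that by (simp add: B_def)
    finally show ?thesis .
  qed
  have cg: "continuous_on UNIV g" using C1_on_continuous[OF g] .
  have c\<Phi>: "continuous_on UNIV \<Phi>"
    unfolding \<Phi>_def by (intro continuous_intros C1_on_continuous[OF G] continuous_on_gradient[OF g])
  have z\<Phi>: "\<Phi> x = 0" if "x \<notin> K" for x using zero[OF that] by (simp add: \<Phi>_def)
  have cd: "continuous_on UNIV (divergence G)" by (rule continuous_on_divergence[OF G])
  have zd: "divergence G x = 0" if "x \<notin> K" for x
    using divergence_zero_outside[OF compact_imp_closed[OF K] zero that] .
  define \<rho> where "\<rho> n x = smooth_step (?N n * (g x - x \<bullet> k))" for n x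
  have C\<rho>: "C1_on UNIV (\<rho> n)" for n
    unfolding \<rho>_def by (rule C1_on_compose[OF _ C1_smooth_step]) (auto intro!: C1_intros g)
  \<comment> \<open>Minus the derivative of \<open>\<rho> n\<close> along \<open>G\<close>; it lives
    on the layer where the step is not constant.\<close>
  define L where "L n x = ?N n * (smooth_step_deriv (?N n * (g x - x \<bullet> k)) * \<Phi> x)" for n x
  have cL: "continuous_on UNIV (L n)" for n
    unfolding L_def by (intro continuous_intros c\<Phi> continuous_on_compose2[OF continuous_on_smooth_step_deriv] cg) auto
  have zL: "L n x = 0" if "x \<notin> K" for n x using z\<Phi>[OF that] by (simp add: L_def)
  have iL: "integrable lborel (L n)" for n
    by (rule integrable_compact_support[OF cL K zL])
  have div: "divergence (\<lambda>x. \<rho> n x *\<^sub>R G x) x = \<rho> n x * divergence G x - L n x" for n x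
  proof -
    have d: "(g has_derivative (\<lambda>h. gradient g x \<bullet> h)) (at x)"
      by (rule has_derivative_eq_rhs[OF C1_on_has_derivative[OF g]])
        (use g in \<open>auto simp: C1_on_def frechet_derivative_eq_gradient\<close>)
    have "((\<lambda>x. ?N n * (g x - x \<bullet> k)) has_derivative (\<lambda>h. ?N n * (gradient g x \<bullet> h - h \<bullet> k))) (at x)"
      by (auto intro!: derivative_eq_intros d)
    from diff_chain_at[OF this smooth_step_has_real_derivative[of "?N n * (g x - x \<bullet> k)", unfolded has_field_derivative_def]]
    have "frechet_derivative (\<rho> n) (at x) = (\<lambda>h. smooth_step_deriv (?N n * (g x - x \<bullet> k)) * (?N n * (gradient g x \<bullet> h - h \<bullet> k)))"
      unfolding \<rho>_def by (intro frechet_derivative_at[symmetric]) (simp add: o_def)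
    then have "frechet_derivative (\<rho> n) (at x) (G x) = - L n x"
      by (simp add: L_def \<Phi>_def inner_diff_right inner_commute algebra_simps)
    moreover have "\<rho> n differentiable (at x)" "G differentiable (at x)"
      using C\<rho> G by (auto simp: C1_on_def)
    ultimately show ?thesis by (simp add: divergence_scaleR)
  qed
  have R: "(LBINT x. \<rho> n x * divergence G x) = (LBINT x. L n x)" for n
  proof -
    have "integrable lborel (\<lambda>x. \<rho> n x * divergence G x)"
      by (rule integrable_compact_support[OF _ K])
        (auto intro!: continuous_intros cd C1_on_continuous[OF C\<rho>] simp: zd)
    moreover have "(LBINT x. divergence (\<lambda>x. \<rho> n x *\<^sub>R G x) x) = 0"
      by (rule integral_divergence_compact_support[OF _ K]) (auto intro!: C1_intros C\<rho> G simp: zero)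
    ultimately show ?thesis using iL by (simp add: div)
  qed
  have lim1: "(\<lambda>n. LBINT x. \<rho> n x * divergence G x)
      \<longlonglongrightarrow> (LBINT x. indicator {x. x \<bullet> k < g x} x * divergence G x)"
  proof (rule integral_dominated_convergence[where w="\<lambda>x. norm (divergence G x)"])
    have "open {x. x \<bullet> k < g x}"
      by (intro open_Collect_less continuous_intros cg)
    then show "(\<lambda>x. indicator {x. x \<bullet> k < g x} x * divergence G x) \<in> borel_measurable lborel"
      using borel_measurable_continuous_onI[OF cd]
      by (intro borel_measurable_times borel_measurable_indicator) (auto intro: borel_open)
    show "(\<lambda>x. \<rho> n x * divergence G x) \<in> borel_measurable lborel" for n
      by (auto intro!: borel_measurable_continuous_onI continuous_intros cd C1_on_continuous[OF C\<rho>])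
    show "integrable lborel (\<lambda>x. norm (divergence G x))"
      by (intro integrable_norm integrable_compact_support[OF cd K zd])
    show "AE x in lborel. norm (\<rho> n x * divergence G x) \<le> norm (divergence G x)" for n
      by (rule AE_I2) (simp add: \<rho>_def abs_mult smooth_step_nonneg smooth_step_le_1 mult_left_le_one_le)
    have "(\<lambda>n. \<rho> n x) \<longlonglongrightarrow> indicator {x. x \<bullet> k < g x} x" for x
    proof (cases "x \<bullet> k < g x")
      case True
      then obtain n0 :: nat where n0: "1 / (g x - x \<bullet> k) \<le> real n0" using real_arch_simple by blast
      have "\<rho> n x = 1" if "n \<ge> n0" for n
      proof -
        have "1 / (g x - x \<bullet> k) \<le> ?N n" using n0 that by linarith
        then show ?thesis using True by (simp add: \<rho>_def smooth_step_ge_1 field_simps)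
      qed
      then have "\<forall>\<^sub>F n in sequentially. \<rho> n x = 1" by (auto simp: eventually_sequentially)
      then show ?thesis using True by (simp add: tendsto_eventually)
    next
      case False
      then have "\<rho> n x = 0" for n by (simp add: \<rho>_def smooth_step_le_0 mult_nonneg_nonpos)
      then show ?thesis using False by simp
    qed
    then show "AE x in lborel. (\<lambda>n. \<rho> n x * divergence G x) \<longlonglongrightarrow> indicator {x. x \<bullet> k < g x} x * divergence G x"
      by (intro AE_I2 tendsto_mult_right)
  qed
  \<comment> \<open>On the line through \<open>p z\<close> the layer is stretched to the unit
    interval by s = g (p z) - u / N. The Jacobian 1 / N cancels the factor N in \<open>L\<close>,
    which leaves an integrand bounded uniformly in n.\<close>
  define Q where "Q n z u = smooth_step_deriv u * \<Phi> (p z + (g (p z) - u / ?N n) *\<^sub>R k)" for n z u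
  have slice: "(LBINT x. L n x) = (\<integral>z. (LBINT u. Q n z u) \<partial>?M)" for n
  proof -
    have "(LBINT s. L n (p z + s *\<^sub>R k)) = (LBINT u. Q n z u)" for z
    proof -
      have "(LBINT s. L n (p z + s *\<^sub>R k))
          = \<bar>- 1 / ?N n\<bar> *\<^sub>R (LBINT u. L n (p z + (g (p z) + (- 1 / ?N n) * u) *\<^sub>R k))"
        by (rule lborel_integral_real_affine) simp
      also have "\<dots> = (LBINT u. \<bar>- 1 / ?N n\<bar> * L n (p z + (g (p z) + (- 1 / ?N n) * u) *\<^sub>R k))"
        by simp
      also have "(\<lambda>u. \<bar>- 1 / ?N n\<bar> * L n (p z + (g (p z) + (- 1 / ?N n) * u) *\<^sub>R k)) = Q n z"
        by (rule ext) (simp add: L_def Q_def gk inner_add_left pk kk del: of_nat_Suc)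
      finally show ?thesis .
    qed
    then show ?thesis
      using lborel_integral_slice[OF k iL, of n] by (simp add: B_def p_def)
  qed
  obtain C where C: "0 < C" "\<And>u. norm (smooth_step_deriv u) \<le> C"
    using bounded_compact_support[OF continuous_on_smooth_step_deriv compact_Icc smooth_step_deriv_eq_0] by metis
  obtain M where M: "0 < M" "\<And>x. norm (\<Phi> x) \<le> M"
    using bounded_compact_support[OF c\<Phi> K z\<Phi>] by metis
  obtain r where r: "0 < r" "\<And>x. x \<in> K \<Longrightarrow> norm x \<le> r"
    using compact_imp_bounded[OF K] unfolding bounded_pos by auto
  \<comment> \<open>The shadow of \<open>K\<close> on the remaining coordinates lies in this box.
    Its finite measure yields the dominating functions for the limits in both u and z.\<close>
  define Z where "Z = (\<Pi>\<^sub>E b\<in>B. {- r..r})"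
  have Qb: "norm (Q n z u) \<le> C * M * indicator Z z * indicator {0..1} u" if "z \<in> space ?M" for n z u
  proof (cases "z \<in> Z \<and> u \<in> {0..1}")
    case True
    then show ?thesis using C M by (simp add: Q_def abs_mult mult_mono)
  next
    case False
    have "Q n z u = 0"
    proof (cases "u \<in> {0..1}")
      case True
      with False have "z \<notin> Z" by simp
      moreover have "z \<in> extensional B" using that by (auto simp: space_PiM PiE_def)
      ultimately have "\<exists>b\<in>B. r < \<bar>z b\<bar>"
        unfolding Z_def PiE_iff atLeastAtMost_iff by (meson abs_le_iff minus_le_iff not_le)
      then obtain b where b: "b \<in> B" "r < \<bar>z b\<bar>" by blast
      let ?x = "p z + (g (p z) - u / ?N n) *\<^sub>R k"
      have "?x \<bullet> b = z b" using pb[OF b(1)] kb[OF b(1)] by (simp add: inner_add_left inner_commute[of k])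
      moreover have "\<bar>?x \<bullet> b\<bar> \<le> norm ?x" using b(1) by (intro Basis_le_norm) (simp add: B_def)
      ultimately have "?x \<notin> K" using r(2)[of ?x] b(2) by fastforce
      then show ?thesis by (simp add: Q_def z\<Phi>)
    next
      case False
      then show ?thesis using smooth_step_deriv_eq_0 by (simp add: Q_def)
    qed
    then show ?thesis using False by (auto simp: indicator_def)
  qed
  have cQ: "continuous_on UNIV (Q n z)" for n z
    unfolding Q_def by (intro continuous_intros continuous_on_compose2[OF c\<Phi>] continuous_on_smooth_step_deriv) auto
  have iQ: "integrable lborel (Q n z)" for n z
    by (rule integrable_compact_support[OF cQ compact_Icc[of 0 1]]) (unfold Q_def, subst smooth_step_deriv_eq_0, assumption, simp)
  have mQ: "(\<lambda>z. LBINT u. Q n z u) \<in> borel_measurable ?M" for n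
  proof -
    have [measurable]: "smooth_step_deriv \<in> borel_measurable borel" "\<Phi> \<in> borel_measurable borel" "g \<in> borel_measurable borel"
      using borel_measurable_continuous_onI c\<Phi> cg continuous_on_smooth_step_deriv by auto
    have [measurable]: "p \<in> ?M \<rightarrow>\<^sub>M borel" unfolding p_def by measurable
    show ?thesis unfolding Q_def by measurable
  qed
  have lim2: "(\<lambda>n. \<integral>z. (LBINT u. Q n z u) \<partial>?M) \<longlonglongrightarrow> (\<integral>z. \<Phi> (p z + g (p z) *\<^sub>R k) \<partial>?M)"
  proof (rule integral_dominated_convergence[where w="\<lambda>z. C * M * indicator Z z"])
    have [measurable]: "\<Phi> \<in> borel_measurable borel" "g \<in> borel_measurable borel"
      using borel_measurable_continuous_onI c\<Phi> cg by auto
    have [measurable]: "p \<in> ?M \<rightarrow>\<^sub>M borel" unfolding p_def by measurable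
    show "(\<lambda>z. \<Phi> (p z + g (p z) *\<^sub>R k)) \<in> borel_measurable ?M" by measurable
    show "(\<lambda>z. LBINT u. Q n z u) \<in> borel_measurable ?M" for n by (rule mQ)
    interpret product_sigma_finite "\<lambda>b::'a. lborel :: real measure" ..
    have "finite B" by (simp add: B_def)
    then have "emeasure ?M Z < \<infinity>"
      unfolding Z_def by (subst emeasure_PiM) (use r(1) in \<open>auto simp: ennreal_power\<close>)
    moreover have "Z \<in> sets ?M" unfolding Z_def using \<open>finite B\<close> by (intro sets_PiM_I_finite) auto
    ultimately show "integrable ?M (\<lambda>z. C * M * indicator Z z)"
      by (intro integrable_mult_right integrable_real_indicator)
    show "AE z in ?M. norm (LBINT u. Q n z u) \<le> C * M * indicator Z z" for n
    proof (rule AE_I2)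
      fix z assume z: "z \<in> space ?M"
      have "norm (LBINT u. Q n z u) \<le> (LBINT u. C * M * indicator Z z * indicator {0..1::real} u)"
        by (intro Bochner_Integration.integral_norm_bound_integral iQ Qb z) auto
      then show "norm (LBINT u. Q n z u) \<le> C * M * indicator Z z" by simp
    qed
    show "AE z in ?M. (\<lambda>n. LBINT u. Q n z u) \<longlonglongrightarrow> \<Phi> (p z + g (p z) *\<^sub>R k)"
    proof (rule AE_I2)
      fix z assume z: "z \<in> space ?M"
      have "(\<lambda>n. LBINT u. Q n z u) \<longlonglongrightarrow> (LBINT u. smooth_step_deriv u * \<Phi> (p z + g (p z) *\<^sub>R k))"
      proof (rule integral_dominated_convergence[where w="\<lambda>u. C * M * indicator Z z * indicator {0..1} u"])
        have [measurable]: "smooth_step_deriv \<in> borel_measurable borel"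
          using borel_measurable_continuous_onI continuous_on_smooth_step_deriv by auto
        show "(\<lambda>u. smooth_step_deriv u * \<Phi> (p z + g (p z) *\<^sub>R k)) \<in> borel_measurable lborel" by measurable
        show "AE u in lborel. (\<lambda>n. Q n z u) \<longlonglongrightarrow> smooth_step_deriv u * \<Phi> (p z + g (p z) *\<^sub>R k)"
        proof (rule AE_I2)
          fix u :: real
          have "(\<lambda>n. u / ?N n) \<longlonglongrightarrow> 0"
            using tendsto_mult_right_zero[OF LIMSEQ_inverse_real_of_nat, of u] by (simp add: divide_inverse)
          then have "(\<lambda>n. p z + (g (p z) - u / ?N n) *\<^sub>R k) \<longlonglongrightarrow> p z + (g (p z) - 0) *\<^sub>R k"
            by (intro tendsto_intros)
          then have "(\<lambda>n. \<Phi> (p z + (g (p z) - u / ?N n) *\<^sub>R k)) \<longlonglongrightarrow> \<Phi> (p z + g (p z) *\<^sub>R k)"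
            using c\<Phi> by (intro continuous_on_tendsto_compose[OF c\<Phi>]) auto
          then show "(\<lambda>n. Q n z u) \<longlonglongrightarrow> smooth_step_deriv u * \<Phi> (p z + g (p z) *\<^sub>R k)"
            unfolding Q_def by (rule tendsto_mult_left)
        qed
        show "AE u in lborel. norm (Q n z u) \<le> C * M * indicator Z z * indicator {0..1} u" for n
          using Qb[OF z] by (rule AE_I2)
        show "Q n z \<in> borel_measurable lborel" for n
          using borel_measurable_continuous_onI[OF cQ] by simp
      qed auto
      then show "(\<lambda>n. LBINT u. Q n z u) \<longlonglongrightarrow> \<Phi> (p z + g (p z) *\<^sub>R k)"
        by (simp add: integral_smooth_step_deriv)
    qed
  qed
  have "(LBINT x. indicator {x. x \<bullet> k < g x} x * divergence G x) = (\<integral>z. \<Phi> (p z + g (p z) *\<^sub>R k) \<partial>?M)"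
    using LIMSEQ_unique[OF lim1] lim2 by (simp add: R slice)
  also have "\<dots> = graph_flux G k g"
    by (simp add: graph_flux_def Let_def \<Phi>_def p_def B_def)
  finally show ?thesis .
qed

section \<open>The divergence theorem from one chart to a whole domain\<close>

lemma boundary_graph_axis: "boundary_graph W U k g \<Longrightarrow> k \<bullet> k = 1"
  unfolding boundary_graph_def using signed_Basis_inner_same by blast

text \<open>The chart function is C^1 only on \<open>U\<close>, while
  \<open>integral_divergence_below_graph\<close> needs a global one. Being constant along
  \<open>k\<close>, it is C^1 on the whole cylinder over \<open>U\<close>. A cutoff that depends
  only on the projection \<open>\<pi>\<close> along \<open>k\<close> extends it by zero and
  preserves the constancy along \<open>k\<close>.\<close>

lemma chart_flux_eq_integral_divergence:
  fixes F :: "'a::euclidean_space \<Rightarrow> 'a"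
  assumes chart: "boundary_graph W U k g" and g: "C1_on U g"
    and F: "C1_on UNIV F" and K: "compact K" "K \<subseteq> U" and zero: "\<And>x. x \<notin> K \<Longrightarrow> F x = 0"
  shows "(LBINT x. indicator W x * divergence F x) = graph_flux F k g"
proof -
  have U: "open U" and k: "k \<in> Basis \<or> - k \<in> Basis" and gk: "\<And>x c. g (x + c *\<^sub>R k) = g x"
    and WU: "\<And>x. x \<in> U \<Longrightarrow> x \<in> W \<longleftrightarrow> x \<bullet> k < g x"
    using chart unfolding boundary_graph_def by blast+
  have kk: "k \<bullet> k = 1" using chart by (rule boundary_graph_axis)
  define \<pi> where "\<pi> x = x - (x \<bullet> k) *\<^sub>R k" for x
  have \<pi>k: "\<pi> (x + c *\<^sub>R k) = \<pi> x" for x c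
    by (simp add: \<pi>_def inner_add_left kk algebra_simps)
  have c\<pi>: "continuous_on UNIV \<pi>" unfolding \<pi>_def by (intro continuous_intros)
  \<comment> \<open>Translates of \<open>U\<close> along \<open>k\<close>; their union is the
    cylinder over \<open>U\<close>.\<close>
  define T where "T c = {x. x + c *\<^sub>R k \<in> U}" for c
  have T: "open (T c)" for c
  proof -
    have "continuous_on UNIV (\<lambda>x. x + c *\<^sub>R k)" by (intro continuous_intros)
    from open_vimage[OF U this] show ?thesis by (simp add: T_def vimage_def)
  qed
  have gT: "C1_on (T c) g" for c
  proof -
    have "C1_on (T c) (\<lambda>x. g (x + c *\<^sub>R k))"
      by (rule C1_on_compose[OF _ g]) (auto intro!: C1_intros simp: T_def)
    then show ?thesis by (simp add: gk)
  qed
  let ?V = "\<Union>c. T c"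
  have V: "open ?V" using T by auto
  have gV: "C1_on ?V g" by (rule C1_on_local) (use T gT in blast)
  have "\<pi> ` K \<subseteq> ?V"
  proof
    fix y assume "y \<in> \<pi> ` K"
    then obtain x where "x \<in> K" "y = \<pi> x" by auto
    then have "y \<in> T (x \<bullet> k)" using K(2) by (auto simp: T_def \<pi>_def)
    then show "y \<in> ?V" by blast
  qed
  moreover have "compact (\<pi> ` K)"
    using K(1) c\<pi> by (meson compact_continuous_image continuous_on_subset subset_UNIV)
  ultimately obtain \<kappa> S where \<kappa>: "C1_on UNIV \<kappa>" "closure {x. \<kappa> x \<noteq> (0::real)} \<subseteq> ?V"
      and S: "open S" "\<pi> ` K \<subseteq> S" "\<And>x. x \<in> S \<Longrightarrow> \<kappa> x = 1"
    using cutoff_exists[OF _ V] by metis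
  define g' where "g' x = \<kappa> (\<pi> x) * g x" for x
  have g'k: "g' (x + c *\<^sub>R k) = g' x" for x c by (simp add: g'_def \<pi>k gk)
  have g'eq: "g' x = g x" if "\<pi> x \<in> S" for x using S(3)[OF that] by (simp add: g'_def)
  have "C1_on UNIV g'"
  proof (rule C1_on_extend_zero[OF V])
    have "C1_on ?V (\<lambda>x. \<kappa> (\<pi> x))"
      by (rule C1_on_compose[OF _ \<kappa>(1)]) (auto simp: \<pi>_def[abs_def] intro!: C1_intros)
    then show "C1_on ?V g'" unfolding g'_def[abs_def] by (intro C1_intros gV)
    let ?K = "\<pi> -` closure {x. \<kappa> x \<noteq> 0}"
    show "closed ?K" using c\<pi> by (auto intro: closed_vimage)
    show "?K \<subseteq> ?V"
    proof
      fix x assume "x \<in> ?K"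
      then obtain c where "\<pi> x \<in> T c" using \<kappa>(2) by blast
      then have "x \<in> T (c - x \<bullet> k)" by (simp add: T_def \<pi>_def algebra_simps)
      then show "x \<in> ?V" by blast
    qed
    show "g' x = 0" if "x \<notin> ?K" for x
      using that closure_subset[of "{x. \<kappa> x \<noteq> 0}"] by (auto simp: g'_def)
  qed
  from integral_divergence_below_graph[OF k this g'k F K(1) zero]
  have "(LBINT x. indicator {x. x \<bullet> k < g' x} x * divergence F x) = graph_flux F k g'" .
  moreover have "indicator {x. x \<bullet> k < g' x} x * divergence F x = indicator W x * divergence F x" for x
  proof (cases "x \<in> K")
    case True
    then have "g' x = g x" using S(2) by (intro g'eq) auto
    then show ?thesis using WU[of x] K(2) True by (auto simp: indicator_def)
  next
    case False
    then show ?thesis using divergence_zero_outside[OF compact_imp_closed[OF K(1)] zero] by simp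
  qed
  moreover have "graph_flux F k g' = graph_flux F k g"
  proof -
    \<comment> \<open>Where the cutoff is 1 near the line, both graphs and both gradients agree. A
      line whose projection lies outside \<open>S\<close> misses \<open>K\<close>, so
      \<open>F\<close> vanishes on it.\<close>
    have "F (x + g' x *\<^sub>R k) \<bullet> (k - gradient g' (x + g' x *\<^sub>R k)) = F (x + g x *\<^sub>R k) \<bullet> (k - gradient g (x + g x *\<^sub>R k))" for x
    proof (cases "\<pi> x \<in> S")
      case True
      have "open (\<pi> -` S)" using S(1) c\<pi> by (auto intro: open_vimage)
      then have "gradient g' (x + g x *\<^sub>R k) = gradient g (x + g x *\<^sub>R k)"
        by (rule gradient_cong_open) (use True in \<open>auto simp: \<pi>k g'eq\<close>)
      then show ?thesis using True by (simp add: g'eq)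
    next
      case False
      then have "x + c *\<^sub>R k \<notin> K" for c using S(2) \<pi>k[of x c] by auto
      then show ?thesis using zero by simp
    qed
    then show ?thesis by (simp add: graph_flux_def Let_def)
  qed
  ultimately show ?thesis by simp
qed

text \<open>A small step in direction \<open>- k\<close> lowers the height but not the graph, so it
  ends in \<open>W\<close>. Consequently the values of a field near the closure of \<open>W\<close>
  determine its flux through a chart.\<close>

lemma boundary_graph_in_closure:
  assumes "boundary_graph W U k g" "x \<in> U" "x \<bullet> k = g x"
  shows "x \<in> closure W"
proof -
  have U: "open U" and gk: "\<And>c. g (x + c *\<^sub>R k) = g x"
    and WU: "\<And>y. y \<in> U \<Longrightarrow> y \<in> W \<longleftrightarrow> y \<bullet> k < g y"
    using assms(1) unfolding boundary_graph_def by blast+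
  have kk: "k \<bullet> k = 1" using boundary_graph_axis[OF assms(1)] .
  then have nk: "norm k = 1" by (simp add: norm_eq_sqrt_inner)
  obtain d where d: "0 < d" "ball x d \<subseteq> U" using U assms(2) open_contains_ball by blast
  show ?thesis unfolding closure_approachable
  proof (intro allI impI)
    fix e :: real assume "0 < e"
    define s where "s = min d e / 2"
    have s: "0 < s" "s < d" "s < e" using \<open>0 < e\<close> d(1) by (auto simp: s_def)
    let ?y = "x + (- s) *\<^sub>R k"
    have "dist ?y x = s" using s nk by (simp add: dist_norm)
    moreover have "?y \<in> U" using d(2) s nk by (auto simp: dist_norm subset_iff)
    then have "?y \<in> W" using WU[of ?y] gk[of "- s"] assms(3) kk s by (simp add: inner_diff_left)
    ultimately show "\<exists>y\<in>W. dist y x < e" using s by (intro bexI[of _ ?y]) simp_all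
  qed
qed

text \<open>In \<open>W\<close> the field is the sum of the chart pieces, each treated by
  \<open>chart_flux_eq_integral_divergence\<close>, and a remainder that vanishes near the frontier.
  Extended by zero, the remainder is a compactly supported C^1 field, so its divergence integrates
  to 0. The result does not mention the charts.\<close>

theorem has_flux_imp_eq_integral_divergence:
  fixes F :: "'a::euclidean_space \<Rightarrow> 'a"
  assumes flux: "has_flux W F I" and W: "open W" "bounded W"
    and O: "open O'" "closure W \<subseteq> O'" and F: "C1_on O' F"
  shows "I = (LBINT x. indicator W x * divergence F x)"
proof -
  obtain m :: nat and U k g \<eta> S where
    P: "\<And>i. i < m \<Longrightarrow> boundary_graph W (U i) (k i) (g i) \<and> Ck_on 1 (U i) (g i) \<and>
               Ck_on 1 UNIV (\<eta> i) \<and> (\<forall>x. 0 \<le> \<eta> i x) \<and>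
               compact (closure {x. \<eta> i x \<noteq> 0}) \<and> closure {x. \<eta> i x \<noteq> 0} \<subseteq> U i"
    and S: "open S" "frontier W \<subseteq> S" "\<And>x. x \<in> S \<Longrightarrow> (\<Sum>i<m. \<eta> i x) = 1"
    and I: "I = (\<Sum>i<m. graph_flux (\<lambda>y. \<eta> i y *\<^sub>R F y) (k i) (g i))"
    using flux unfolding has_flux_def by blast
  have C: "compact (closure W)" using W(2) by simp
  obtain \<kappa> S' where \<kappa>: "C1_on UNIV \<kappa>" "closure {x. \<kappa> x \<noteq> (0::real)} \<subseteq> O'"
      "open S'" "closure W \<subseteq> S'" "\<And>x. x \<in> S' \<Longrightarrow> \<kappa> x = 1"
    using cutoff_exists[OF C O] by metis
  \<comment> \<open>A global C^1 field that coincides with \<open>F\<close> near the closure of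
    \<open>W\<close>.\<close>
  define E where "E x = \<kappa> x *\<^sub>R F x" for x
  have E: "C1_on UNIV E"
  proof (rule C1_on_extend_zero[OF O(1) _ _ \<kappa>(2)])
    show "C1_on O' E" unfolding E_def[abs_def] by (intro C1_intros F C1_on_subset[OF \<kappa>(1)]) auto
    show "E x = 0" if "x \<notin> closure {x. \<kappa> x \<noteq> 0}" for x
      using that closure_subset[of "{x. \<kappa> x \<noteq> 0}"] by (auto simp: E_def)
  qed simp
  have EF: "E x = F x" if "x \<in> S'" for x by (simp add: E_def \<kappa>(5)[OF that])
  have \<eta>: "C1_on UNIV (\<eta> i)" if "i < m" for i using P[OF that] unfolding Ck_on_1_iff by blast
  have \<eta>E: "C1_on UNIV (\<lambda>x. \<eta> i x *\<^sub>R E x)" if "i < m" for i by (intro C1_intros \<eta>[OF that] E)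
  have piece: "(LBINT x. indicator W x * divergence (\<lambda>x. \<eta> i x *\<^sub>R E x) x)
      = graph_flux (\<lambda>y. \<eta> i y *\<^sub>R F y) (k i) (g i)"
    and int: "integrable lborel (\<lambda>x. indicator W x * divergence (\<lambda>x. \<eta> i x *\<^sub>R E x) x)" if i: "i < m" for i
  proof -
    let ?K = "closure {x. \<eta> i x \<noteq> 0}"
    have b: "boundary_graph W (U i) (k i) (g i)" and gi: "C1_on (U i) (g i)" and K: "compact ?K" "?K \<subseteq> U i"
      using P[OF i] unfolding Ck_on_1_iff by blast+
    have z: "\<eta> i x *\<^sub>R E x = 0" if "x \<notin> ?K" for x
      using that closure_subset[of "{x. \<eta> i x \<noteq> 0}"] by auto
    have "(LBINT x. indicator W x * divergence (\<lambda>x. \<eta> i x *\<^sub>R E x) x)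
        = graph_flux (\<lambda>y. \<eta> i y *\<^sub>R E y) (k i) (g i)"
      by (rule chart_flux_eq_integral_divergence[OF b gi \<eta>E[OF i] K z])
    also have "\<dots> = graph_flux (\<lambda>y. \<eta> i y *\<^sub>R F y) (k i) (g i)"
    proof -
      \<comment> \<open>\<open>graph_flux\<close> evaluates the field on the whole graph, also
        outside \<open>U i\<close>. Where \<open>\<eta> i\<close> is nonzero the point lies in
        \<open>U i\<close>, hence in the closure of \<open>W\<close>, where \<open>E\<close> and
        \<open>F\<close> agree.\<close>
      have "\<eta> i y *\<^sub>R E y = \<eta> i y *\<^sub>R F y"
        if y: "y = (\<Sum>b\<in>Basis - {k i, - k i}. z b *\<^sub>R b) + g i (\<Sum>b\<in>Basis - {k i, - k i}. z b *\<^sub>R b) *\<^sub>R k i" for y z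
      proof (cases "\<eta> i y = 0")
        case False
        then have "y \<in> U i" using K(2) closure_subset[of "{x. \<eta> i x \<noteq> 0}"] by auto
        have ki: "k i \<in> Basis \<or> - k i \<in> Basis" and gk: "\<And>x c. g i (x + c *\<^sub>R k i) = g i x"
          using b unfolding boundary_graph_def by blast+
        have "b \<bullet> k i = 0" if "b \<in> Basis - {k i, - k i}" for b
          using ki that inner_Basis[of b "k i"] inner_Basis[of b "- k i"] by auto
        then have "(\<Sum>b\<in>Basis - {k i, - k i}. z b *\<^sub>R b) \<bullet> k i = 0" by (simp add: inner_sum_left)
        then have "y \<bullet> k i = g i y" using boundary_graph_axis[OF b] by (simp add: y gk inner_add_left)
        from boundary_graph_in_closure[OF b \<open>y \<in> U i\<close> this] have "y \<in> S'" using \<kappa>(4) by blast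
        then show ?thesis by (simp add: EF)
      qed simp
      from this[OF refl] show ?thesis unfolding graph_flux_def Let_def by (simp only:)
    qed
    finally show "(LBINT x. indicator W x * divergence (\<lambda>x. \<eta> i x *\<^sub>R E x) x)
      = graph_flux (\<lambda>y. \<eta> i y *\<^sub>R F y) (k i) (g i)" .
    show "integrable lborel (\<lambda>x. indicator W x * divergence (\<lambda>x. \<eta> i x *\<^sub>R E x) x)"
      using W(1) divergence_zero_outside[OF compact_imp_closed[OF K(1)] z]
      by (intro integrable_compact_support_indicator[OF continuous_on_divergence[OF \<eta>E[OF i]] K(1)]) auto
  qed
  \<comment> \<open>Setting the remainder to zero outside \<open>W\<close> keeps it C^1: it already
    vanishes on \<open>S\<close>, a neighbourhood of the frontier.\<close>
  define R where "R x = (if x \<in> W then (1 - (\<Sum>i<m. \<eta> i x)) *\<^sub>R E x else 0)" for x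
  have RW: "C1_on W R"
    by (rule C1_on_cong_open[OF W(1), of "\<lambda>x. (1 - (\<Sum>i<m. \<eta> i x)) *\<^sub>R E x"])
      (auto simp: R_def intro!: C1_intros C1_on_subset[OF E] C1_on_subset[OF \<eta>])
  have RS: "R x = 0" if "x \<in> S" for x using S(3)[OF that] by (simp add: R_def)
  have R: "C1_on UNIV R"
  proof (rule C1_on_extend_zero[of "W \<union> S"])
    have "C1_on S R" by (rule C1_on_cong_open[OF S(1) _ C1_on_const[of _ 0]]) (simp add: RS)
    then show "C1_on (W \<union> S) R" by (intro C1_on_open_Un W S(1) RW)
    show "closure W \<subseteq> W \<union> S" using S(2) closure_Un_frontier[of W] by auto
    show "R x = 0" if "x \<notin> closure W" for x
      using that closure_subset by (auto simp: R_def)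
  qed (use W S in auto)
  have R0: "R x = 0" if "x \<notin> closure W" for x
    using that closure_subset by (auto simp: R_def)
  have divR: "divergence R x = 0" if "x \<notin> W" for x
  proof (cases "x \<in> closure W")
    case True
    then have "x \<in> S" using that S(2) W(1) by (auto simp: frontier_def interior_open)
    then have "divergence R x = divergence (\<lambda>x. 0) x" by (intro divergence_cong_open[OF S(1)] RS)
    then show ?thesis by (simp add: divergence_def)
  qed (use divergence_zero_outside[of "closure W" R] R0 in auto)
  have iR: "integrable lborel (divergence R)"
    by (rule integrable_compact_support[OF continuous_on_divergence[OF R] C])
      (use divR closure_subset in blast)
  have split: "indicator W x * divergence F x
      = divergence R x + (\<Sum>i<m. indicator W x * divergence (\<lambda>x. \<eta> i x *\<^sub>R E x) x)" for x
  proof (cases "x \<in> W")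
    case True
    have d: "(\<lambda>x. \<eta> i x *\<^sub>R E x) differentiable (at x)" if "i < m" for i
      using \<eta>E[OF that] by (simp add: C1_on_def)
    have "divergence F x = divergence (\<lambda>x. R x + (\<Sum>i<m. \<eta> i x *\<^sub>R E x)) x"
    proof (rule divergence_cong_open[OF W(1) True])
      fix y assume y: "y \<in> W"
      then have "F y = E y" using \<kappa>(4) closure_subset by (intro EF[symmetric]) auto
      then show "F y = R y + (\<Sum>i<m. \<eta> i y *\<^sub>R E y)"
        using y by (simp add: R_def algebra_simps scaleR_sum_left)
    qed
    also have "\<dots> = divergence R x + divergence (\<lambda>x. \<Sum>i<m. \<eta> i x *\<^sub>R E x) x"
      using R d by (intro divergence_add differentiable_sum) (auto simp: C1_on_def)
    also have "divergence (\<lambda>x. \<Sum>i<m. \<eta> i x *\<^sub>R E x) x = (\<Sum>i<m. divergence (\<lambda>x. \<eta> i x *\<^sub>R E x) x)"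
      using d by (intro divergence_sum) auto
    finally show ?thesis using True by simp
  qed (simp add: divR)
  have "(LBINT x. indicator W x * divergence F x)
      = (LBINT x. divergence R x) + (\<Sum>i<m. LBINT x. indicator W x * divergence (\<lambda>x. \<eta> i x *\<^sub>R E x) x)"
  proof -
    have "integrable lborel (\<lambda>x. \<Sum>i<m. indicator W x * divergence (\<lambda>x. \<eta> i x *\<^sub>R E x) x)"
      by (intro Bochner_Integration.integrable_sum int) auto
    from Bochner_Integration.integral_add[OF iR this] show ?thesis
      unfolding split by (subst (asm) Bochner_Integration.integral_sum) (use int in auto)
  qed
  also have "(LBINT x. divergence R x) = 0"
    by (rule integral_divergence_compact_support[OF R C R0])
  finally show ?thesis by (simp add: I piece)
qed

section \<open>Regularity of flows\<close>

text \<open>The norm is not differentiable at 0, so the squared norm is used. Its derivative is at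
  most 2 * L * (norm w)^2 + 2 * e * norm w, and the last term is at most (norm w)^2 + e^2. This is
  the origin of the rate 2 * L + 1 and of the summand e^2 in the weighted function \<open>v\<close>,
  which is nonincreasing.\<close>

lemma gronwall_norm:
  fixes w w' :: "real \<Rightarrow> 'a::real_inner"
  assumes t: "0 \<le> t" and L: "0 \<le> L" and e: "0 \<le> e"
    and deriv: "\<And>s. 0 \<le> s \<Longrightarrow> s \<le> t \<Longrightarrow> (w has_vector_derivative w' s) (at s)"
    and bound: "\<And>s. 0 \<le> s \<Longrightarrow> s \<le> t \<Longrightarrow> norm (w' s) \<le> L * norm (w s) + e"
  shows "norm (w t) \<le> (norm (w 0) + e) * exp ((2 * L + 1) * t)"
proof -
  let ?c = "2 * L + 1"
  define v where "v s = (w s \<bullet> w s + e\<^sup>2) * exp (- ?c * s)" for s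
  have "v t \<le> v 0"
  proof (rule DERIV_nonpos_imp_nonincreasing[OF t])
    fix s assume s: "0 \<le> s" "s \<le> t"
    have "(v has_real_derivative (2 * (w s \<bullet> w' s) - ?c * (w s \<bullet> w s + e\<^sup>2)) * exp (- ?c * s)) (at s)"
    proof -
      have "((\<lambda>s. w s \<bullet> w s) has_derivative (\<lambda>h. w s \<bullet> (h *\<^sub>R w' s) + (h *\<^sub>R w' s) \<bullet> w s)) (at s)"
        using deriv[OF s] unfolding has_vector_derivative_def by (intro has_derivative_inner)
      then have "((\<lambda>s. w s \<bullet> w s) has_real_derivative 2 * (w s \<bullet> w' s)) (at s)"
        unfolding has_field_derivative_def
        by (rule has_derivative_eq_rhs) (auto simp: inner_commute)
      then show ?thesis
        unfolding v_def by (auto intro!: derivative_eq_intros simp: algebra_simps)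
    qed
    moreover have "2 * (w s \<bullet> w' s) - ?c * (w s \<bullet> w s + e\<^sup>2) \<le> 0"
    proof -
      have "w s \<bullet> w' s \<le> norm (w s) * (L * norm (w s) + e)"
        using norm_cauchy_schwarz[of "w s" "w' s"] mult_left_mono[OF bound[OF s], of "norm (w s)"] by simp
      then have "2 * (w s \<bullet> w' s) \<le> 2 * L * (norm (w s))\<^sup>2 + 2 * norm (w s) * e"
        by (simp add: power2_eq_square algebra_simps)
      also have "2 * norm (w s) * e \<le> (norm (w s))\<^sup>2 + e\<^sup>2" by (rule sum_squares_bound)
      finally have "2 * (w s \<bullet> w' s) \<le> ?c * (norm (w s))\<^sup>2 + e\<^sup>2" by (simp add: algebra_simps)
      moreover have "0 \<le> 2 * L * e\<^sup>2" using L by simp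
      ultimately show ?thesis by (simp add: power2_norm_eq_inner algebra_simps)
    qed
    ultimately show "\<exists>y. (v has_real_derivative y) (at s) \<and> y \<le> 0"
      by (meson exp_ge_zero mult_nonpos_nonneg)
  qed
  then have "(w t \<bullet> w t + e\<^sup>2) * exp (- ?c * t) \<le> w 0 \<bullet> w 0 + e\<^sup>2" by (simp add: v_def)
  then have "(w t \<bullet> w t + e\<^sup>2) * exp (- ?c * t) * exp (?c * t) \<le> (w 0 \<bullet> w 0 + e\<^sup>2) * exp (?c * t)"
    by (rule mult_right_mono) simp
  moreover have "exp (- ?c * t) * exp (?c * t) = 1"
    unfolding mult_exp_exp by (simp add: algebra_simps)
  ultimately have "w t \<bullet> w t + e\<^sup>2 \<le> (w 0 \<bullet> w 0 + e\<^sup>2) * exp (?c * t)"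
    by (simp only: mult.assoc mult_1_right)
  then have "(norm (w t))\<^sup>2 \<le> ((norm (w 0))\<^sup>2 + e\<^sup>2) * exp (?c * t)"
    using add_increasing2[OF zero_le_power2[of e] order_refl, of "w t \<bullet> w t"] by (simp only: power2_norm_eq_inner)
  \<comment> \<open>The bound is weakened to a perfect square so that a root can be taken; the
    exponential is at least 1, hence at most its square.\<close>
  also have "\<dots> \<le> (norm (w 0) + e)\<^sup>2 * (exp (?c * t))\<^sup>2"
  proof (rule mult_mono)
    show "(norm (w 0))\<^sup>2 + e\<^sup>2 \<le> (norm (w 0) + e)\<^sup>2" using e by (simp add: power2_sum)
    have "1 \<le> exp (?c * t)" using L t by simp
    then show "exp (?c * t) \<le> (exp (?c * t))\<^sup>2" by (simp add: self_le_power)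
  qed auto
  finally have "(norm (w t))\<^sup>2 \<le> ((norm (w 0) + e) * exp (?c * t))\<^sup>2" by (simp add: power_mult_distrib)
  then show ?thesis by (rule power2_le_imp_le) (use e in simp)
qed

section \<open>Uniform estimates from a continuous derivative\<close>

lemma linear_norm_le_sum_Basis:
  fixes f :: "'a::euclidean_space \<Rightarrow> 'b::real_normed_vector"
  assumes "linear f"
  shows "norm (f v) \<le> (\<Sum>b\<in>Basis. norm (f b)) * norm v"
proof -
  have "f v = f (\<Sum>b\<in>Basis. (v \<bullet> b) *\<^sub>R b)" by (simp add: euclidean_representation)
  also have "\<dots> = (\<Sum>b\<in>Basis. (v \<bullet> b) *\<^sub>R f b)" by (simp add: linear_sum[OF assms] linear_cmul[OF assms])
  also have "norm \<dots> \<le> (\<Sum>b\<in>Basis. norm (f b) * norm v)"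
  proof (rule sum_norm_le)
    fix b :: 'a assume "b \<in> Basis"
    then have "\<bar>v \<bullet> b\<bar> * norm (f b) \<le> norm v * norm (f b)"
      by (intro mult_right_mono Basis_le_norm) auto
    then show "norm ((v \<bullet> b) *\<^sub>R f b) \<le> norm (f b) * norm v" by (simp add: mult.commute)
  qed
  finally show ?thesis by (simp add: sum_distrib_right)
qed

lemma C1_on_linear_frechet: "C1_on S f \<Longrightarrow> x \<in> S \<Longrightarrow> linear (frechet_derivative f (at x))"
  using C1_on_has_derivative has_derivative_linear by blast

text \<open>The derivatives in the finitely many basis directions are uniformly continuous on
  \<open>K\<close>. The mean value inequality for \<open>f\<close> minus its linearisation at
  \<open>a\<close>, on the convex set of points of \<open>K\<close> near \<open>a\<close>, turns
  this into an error bound that is uniform in \<open>a\<close>.\<close>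

lemma C1_on_uniformly_differentiable:
  fixes f :: "'a::euclidean_space \<Rightarrow> 'b::real_normed_vector"
  assumes f: "C1_on UNIV f" and K: "compact K" "convex K" and e: "0 < e"
  obtains d where "0 < d" "\<And>a b. a \<in> K \<Longrightarrow> b \<in> K \<Longrightarrow> dist b a < d \<Longrightarrow>
    norm (f b - f a - frechet_derivative f (at a) (b - a)) \<le> e * norm (b - a)"
proof -
  let ?f = "\<lambda>x. frechet_derivative f (at x)"
  \<comment> \<open>The operator norm is estimated by a sum over the basis, so each direction gets
    an equal share of \<open>e\<close>.\<close>
  let ?e = "e / DIM('a)"
  have e': "0 < ?e" using e by simp
  have "\<exists>d>0. \<forall>x\<in>K. \<forall>y\<in>K. dist y x < d \<longrightarrow> dist (?f y i) (?f x i) < ?e" for i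
  proof -
    have "uniformly_continuous_on K (\<lambda>x. ?f x i)"
      using f K(1) by (intro compact_uniformly_continuous) (auto simp: C1_on_def intro: continuous_on_subset)
    then show ?thesis using e' unfolding uniformly_continuous_on_def by blast
  qed
  then obtain d where d: "\<And>i. 0 < d i" "\<And>i x y. x \<in> K \<Longrightarrow> y \<in> K \<Longrightarrow> dist y x < d i \<Longrightarrow> dist (?f y i) (?f x i) < ?e"
    by metis
  define D where "D = Min (d ` Basis)"
  have D: "0 < D" "D \<le> d i" if "i \<in> Basis" for i using that d(1) by (auto simp: D_def)
  show ?thesis
  proof (rule that[of D])
    show "0 < D" using D(1) by (metis SOME_Basis)
    fix a b assume ab: "a \<in> K" "b \<in> K" "dist b a < D"
    have "norm ((\<lambda>x. f x - ?f a x) b - (\<lambda>x. f x - ?f a x) a) \<le> e * norm (b - a)"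
    proof (rule differentiable_bound[where S="K \<inter> ball a D" and f'="\<lambda>x h. ?f x h - ?f a h"])
      show "convex (K \<inter> ball a D)" using K(2) by (intro convex_Int) auto
      show "b \<in> K \<inter> ball a D" "a \<in> K \<inter> ball a D" using ab \<open>0 < D\<close> by (auto simp: dist_commute)
    next
      fix x assume x: "x \<in> K \<inter> ball a D"
      show "((\<lambda>x. f x - ?f a x) has_derivative (\<lambda>h. ?f x h - ?f a h)) (at x within K \<inter> ball a D)"
        using C1_on_has_derivative[OF f] has_derivative_at_withinI
        by (intro has_derivative_diff bounded_linear_imp_has_derivative)
          (auto intro: has_derivative_bounded_linear has_derivative_at_withinI)
      show "onorm (\<lambda>h. ?f x h - ?f a h) \<le> e"
      proof (rule onorm_le)
        fix h
        have "linear (\<lambda>h. ?f x h - ?f a h)" using C1_on_linear_frechet[OF f] by (intro linear_compose_sub) auto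
        from linear_norm_le_sum_Basis[OF this, of h]
        have "norm (?f x h - ?f a h) \<le> (\<Sum>i\<in>Basis. norm (?f x i - ?f a i)) * norm h" .
        also have "(\<Sum>i\<in>Basis. norm (?f x i - ?f a i)) \<le> (\<Sum>i\<in>(Basis::'a set). ?e)"
        proof (rule sum_mono)
          fix i :: 'a assume "i \<in> Basis"
          then have "dist x a < d i" using x D(2)[of i] by (simp add: dist_commute)
          then show "norm (?f x i - ?f a i) \<le> ?e" using d(2)[of a x i] x ab by (simp add: dist_norm)
        qed
        then have "(\<Sum>i\<in>Basis. norm (?f x i - ?f a i)) * norm h \<le> e * norm h"
          by (intro mult_right_mono) auto
        finally show "norm (?f x h - ?f a h) \<le> e * norm h" .
      qed
    qed
    moreover have "f b - ?f a b - (f a - ?f a a) = f b - f a - ?f a (b - a)"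
      using linear_diff[OF C1_on_linear_frechet[OF f, of a]] by simp
    ultimately show "norm (f b - f a - ?f a (b - a)) \<le> e * norm (b - a)" by simp
  qed
qed

lemma C1_on_lipschitz_bound:
  fixes f :: "'a::euclidean_space \<Rightarrow> 'b::real_normed_vector"
  assumes f: "C1_on UNIV f" and K: "compact K" "convex K"
  obtains L where "0 \<le> L" "\<And>x h. x \<in> K \<Longrightarrow> norm (frechet_derivative f (at x) h) \<le> L * norm h"
    "\<And>a b. a \<in> K \<Longrightarrow> b \<in> K \<Longrightarrow> norm (f b - f a) \<le> L * norm (b - a)"
proof -
  let ?f = "\<lambda>x. frechet_derivative f (at x)"
  have "\<exists>B\<ge>0. \<forall>x\<in>K. norm (?f x i) \<le> B" for i
  proof -
    have "compact ((\<lambda>x. ?f x i) ` K)"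
      using f K(1) by (intro compact_continuous_image) (auto simp: C1_on_def intro: continuous_on_subset)
    from compact_imp_bounded[OF this] obtain B where "0 < B" "\<forall>y\<in>(\<lambda>x. ?f x i) ` K. norm y \<le> B"
      unfolding bounded_pos by blast
    then show ?thesis by (intro exI[of _ B]) auto
  qed
  then obtain B where B: "\<And>i. 0 \<le> B i" "\<And>i x. x \<in> K \<Longrightarrow> norm (?f x i) \<le> B i" by metis
  define L where "L = (\<Sum>i\<in>Basis. B i)"
  have L: "norm (?f x h) \<le> L * norm h" if "x \<in> K" for x h
  proof -
    have "norm (?f x h) \<le> (\<Sum>i\<in>Basis. norm (?f x i)) * norm h"
      by (rule linear_norm_le_sum_Basis[OF C1_on_linear_frechet[OF f]]) simp
    also have "\<dots> \<le> L * norm h"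
      unfolding L_def using B(2)[OF that] by (intro mult_right_mono sum_mono) auto
    finally show ?thesis .
  qed
  show ?thesis
  proof (rule that[of L])
    show "0 \<le> L" unfolding L_def using B(1) by (intro sum_nonneg) auto
    fix a b assume "a \<in> K" "b \<in> K"
    then show "norm (f b - f a) \<le> L * norm (b - a)"
      by (intro differentiable_bound[OF K(2), where f'="?f"])
        (auto intro: has_derivative_at_withinI C1_on_has_derivative[OF f] onorm_le L)
  qed (rule L)
qed

section \<open>Differentiability from difference quotients\<close>

definition diff_quotient :: "('a::real_vector \<Rightarrow> 'a) \<Rightarrow> real \<Rightarrow> 'a \<Rightarrow> 'a \<Rightarrow> 'a" where
  "diff_quotient f \<epsilon> y h = (1 / \<epsilon>) *\<^sub>R (f (y + \<epsilon> *\<^sub>R h) - f y)"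

text \<open>
  Difference quotients with small steps nearly respect linear relations between the directions,
  uniformly in the base point; the Cauchy property, additivity and homogeneity of their limit are
  all instances of this.
\<close>

definition nearly_linear_quotients ::
    "('a::real_normed_vector \<Rightarrow> 'a) \<Rightarrow> 'a set \<Rightarrow> real \<Rightarrow> real \<Rightarrow> real \<Rightarrow> bool" where
  "nearly_linear_quotients f B H e \<delta> \<longleftrightarrow> (\<forall>y\<in>B. \<forall>a b c \<epsilon> \<epsilon>' \<epsilon>'' h h' h''.
     0 < \<epsilon> \<and> \<epsilon> < \<delta> \<and> 0 < \<epsilon>' \<and> \<epsilon>' < \<delta> \<and> 0 < \<epsilon>'' \<and> \<epsilon>'' < \<delta> \<and>
     norm h \<le> H \<and> norm h' \<le> H \<and> norm h'' \<le> H \<and> a *\<^sub>R h + b *\<^sub>R h' + c *\<^sub>R h'' = 0 \<longrightarrow>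
     norm (a *\<^sub>R diff_quotient f \<epsilon> y h + b *\<^sub>R diff_quotient f \<epsilon>' y h' + c *\<^sub>R diff_quotient f \<epsilon>'' y h'')
       \<le> (\<bar>a\<bar> + \<bar>b\<bar> + \<bar>c\<bar>) * e)"

text \<open>No candidate for the derivative is given: completeness provides it as the limit
  \<open>D\<close>. The rate of convergence is uniform over bounded directions, which turns
  directional derivatives into a Frechet derivative, and uniform over base points, which makes
  \<open>D\<close> continuous as a uniform limit.\<close>

lemma C1_on_of_difference_quotients:
  fixes f :: "'a::euclidean_space \<Rightarrow> 'a" and x0 :: 'a
  assumes r: "0 < r" and cont: "continuous_on (ball x0 (2 * r)) f"
    and rel: "\<And>H e. 0 < H \<Longrightarrow> 0 < e \<Longrightarrow> \<exists>\<delta>>0. nearly_linear_quotients f (ball x0 r) H e \<delta>"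
  shows "C1_on (ball x0 r) f"
proof -
  define q where "q = diff_quotient f"
  define s where "s n = inverse (real (Suc n))" for n
  have s0: "0 < s n" for n by (simp add: s_def)
  have sl: "\<forall>\<^sub>F n in sequentially. s n < \<delta>" if "0 < \<delta>" for \<delta>
    using order_tendstoD(2)[OF LIMSEQ_inverse_real_of_nat that] by (simp add: s_def)
  let ?G = "nearly_linear_quotients f (ball x0 r)"
  have GD: "norm (a *\<^sub>R q \<epsilon> y h + b *\<^sub>R q \<epsilon>' y h' + c *\<^sub>R q \<epsilon>'' y h'') \<le> (\<bar>a\<bar> + \<bar>b\<bar> + \<bar>c\<bar>) * e"
    if "?G H e \<delta>" "y \<in> ball x0 r" "0 < \<epsilon> \<and> \<epsilon> < \<delta>" "0 < \<epsilon>' \<and> \<epsilon>' < \<delta>" "0 < \<epsilon>'' \<and> \<epsilon>'' < \<delta>"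
       "norm h \<le> H \<and> norm h' \<le> H \<and> norm h'' \<le> H" "a *\<^sub>R h + b *\<^sub>R h' + c *\<^sub>R h'' = 0"
     for H e \<delta> y a b c \<epsilon> \<epsilon>' \<epsilon>'' h h' h''
    unfolding q_def
    by (rule that(1)[unfolded nearly_linear_quotients_def, rule_format, OF that(2)]) (use that in simp)
  have rel3: "\<forall>\<^sub>F n in sequentially. norm (a *\<^sub>R q (s n) y h + b *\<^sub>R q (s n) y h' + c *\<^sub>R q (s n) y h'') \<le> e"
    if "y \<in> ball x0 r" "0 < e" "a *\<^sub>R h + b *\<^sub>R h' + c *\<^sub>R h'' = 0" for a b c h h' h'' y e
  proof -
    define A where "A = \<bar>a\<bar> + \<bar>b\<bar> + \<bar>c\<bar> + 1"
    define H where "H = norm h + norm h' + norm h'' + 1"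
    have A: "0 < A" by (simp add: A_def)
    have H: "0 < H" "norm h \<le> H" "norm h' \<le> H" "norm h'' \<le> H" by (auto simp: H_def intro: add_nonneg_pos)
    obtain \<delta> where \<delta>0: "\<delta> > 0" and G: "?G H (e / A) \<delta>"
      using rel[OF H(1), of "e / A"] A \<open>0 < e\<close> by auto
    have \<delta>: "norm (a *\<^sub>R q (s n) y h + b *\<^sub>R q (s n) y h' + c *\<^sub>R q (s n) y h'') \<le> (\<bar>a\<bar> + \<bar>b\<bar> + \<bar>c\<bar>) * (e / A)"
      if "s n < \<delta>" for n
      using GD[OF G \<open>y \<in> ball x0 r\<close>, of "s n" "s n" "s n"] that H s0 \<open>a *\<^sub>R h + b *\<^sub>R h' + c *\<^sub>R h'' = 0\<close> by blast
    have "(\<bar>a\<bar> + \<bar>b\<bar> + \<bar>c\<bar>) * (e / A) \<le> A * (e / A)"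
      using A \<open>0 < e\<close> by (intro mult_right_mono) (auto simp: A_def)
    then have le: "(\<bar>a\<bar> + \<bar>b\<bar> + \<bar>c\<bar>) * (e / A) \<le> e" using A by simp
    show ?thesis
      using sl[OF \<delta>0] by (rule eventually_mono) (use order_trans[OF \<delta> le] in blast)
  qed
  have cau: "\<exists>\<delta>>0. \<forall>y\<in>ball x0 r. \<forall>\<epsilon> \<epsilon>' h. 0 < \<epsilon> \<and> \<epsilon> < \<delta> \<and> 0 < \<epsilon>' \<and> \<epsilon>' < \<delta> \<and> norm h \<le> H \<longrightarrow>
      norm (q \<epsilon> y h - q \<epsilon>' y h) \<le> e" if "0 < H" "0 < e" for H e
  proof -
    \<comment> \<open>The trivial relation h - h = 0 compares two step sizes in one direction. Its
      coefficients have total size 2, hence the tolerance e / 2.\<close>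
    obtain \<delta> where \<delta>: "\<delta> > 0" "?G H (e / 2) \<delta>"
      using rel[OF \<open>0 < H\<close>, of "e / 2"] \<open>0 < e\<close> by auto
    show ?thesis
    proof (intro exI[of _ \<delta>] conjI \<delta>(1) ballI allI impI)
      fix y :: 'a and \<epsilon> \<epsilon>' :: real and h :: 'a assume "y \<in> ball x0 r" "0 < \<epsilon> \<and> \<epsilon> < \<delta> \<and> 0 < \<epsilon>' \<and> \<epsilon>' < \<delta> \<and> norm h \<le> H"
      then show "norm (q \<epsilon> y h - q \<epsilon>' y h) \<le> e"
        using GD[OF \<delta>(2), of y \<epsilon> \<epsilon>' \<epsilon> h h h 1 "-1" 0] by simp
    qed
  qed
  define D where "D y h = lim (\<lambda>n. q (s n) y h)" for y h
  have conv: "(\<lambda>n. q (s n) y h) \<longlonglongrightarrow> D y h" if y: "y \<in> ball x0 r" for y h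
  proof -
    have "Cauchy (\<lambda>n. q (s n) y h)"
    proof (rule metric_CauchyI)
      fix e :: real assume "0 < e"
      then obtain \<delta> where \<delta>: "\<delta> > 0" "\<And>\<epsilon> \<epsilon>'. 0 < \<epsilon> \<Longrightarrow> \<epsilon> < \<delta> \<Longrightarrow> 0 < \<epsilon>' \<Longrightarrow> \<epsilon>' < \<delta> \<Longrightarrow> norm (q \<epsilon> y h - q \<epsilon>' y h) \<le> e / 2"
        using cau[of "norm h + 1" "e / 2"] y by (auto simp: add_nonneg_pos)
      obtain N where "\<And>n. n \<ge> N \<Longrightarrow> s n < \<delta>" using sl[OF \<delta>(1)] unfolding eventually_sequentially by blast
      then have "dist (q (s m) y h) (q (s n) y h) < e" if "m \<ge> N" "n \<ge> N" for m n
        using \<delta>(2)[of "s m" "s n"] s0 that \<open>0 < e\<close> by (fastforce simp: dist_norm)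
      then show "\<exists>M. \<forall>m\<ge>M. \<forall>n\<ge>M. dist (q (s m) y h) (q (s n) y h) < e" by blast
    qed
    then show ?thesis unfolding D_def by (metis Cauchy_convergent convergent_LIMSEQ_iff)
  qed
  have unif: "\<exists>\<delta>>0. \<forall>y\<in>ball x0 r. \<forall>\<epsilon> h. 0 < \<epsilon> \<and> \<epsilon> < \<delta> \<and> norm h \<le> H \<longrightarrow> norm (q \<epsilon> y h - D y h) \<le> e"
    if He: "0 < H" "0 < e" for H e
  proof -
    obtain \<delta> where \<delta>: "\<delta> > 0" "\<And>y \<epsilon> \<epsilon>' h. y \<in> ball x0 r \<Longrightarrow> 0 < \<epsilon> \<and> \<epsilon> < \<delta> \<and> 0 < \<epsilon>' \<and> \<epsilon>' < \<delta> \<and> norm h \<le> H \<Longrightarrow>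
      norm (q \<epsilon> y h - q \<epsilon>' y h) \<le> e" using cau[OF He] by blast
    show ?thesis
    proof (intro exI[of _ \<delta>] conjI \<delta>(1) ballI allI impI)
      fix y :: 'a and \<epsilon> :: real and h :: 'a assume y: "y \<in> ball x0 r" and a: "0 < \<epsilon> \<and> \<epsilon> < \<delta> \<and> norm h \<le> H"
      have "(\<lambda>n. norm (q \<epsilon> y h - q (s n) y h)) \<longlonglongrightarrow> norm (q \<epsilon> y h - D y h)"
        by (intro tendsto_intros conv y)
      moreover have "\<forall>\<^sub>F n in sequentially. norm (q \<epsilon> y h - q (s n) y h) \<le> e"
        using sl[OF \<delta>(1)] by eventually_elim (use \<delta>(2)[OF y] a s0 in blast)
      ultimately show "norm (q \<epsilon> y h - D y h) \<le> e"
        by (rule tendsto_upperbound) simp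
    qed
  qed
  have D3: "a *\<^sub>R D y h + b *\<^sub>R D y h' + c *\<^sub>R D y h'' = 0"
    if y: "y \<in> ball x0 r" and z: "a *\<^sub>R h + b *\<^sub>R h' + c *\<^sub>R h'' = 0" for a b c h h' h'' y
  proof -
    have "norm (a *\<^sub>R D y h + b *\<^sub>R D y h' + c *\<^sub>R D y h'') \<le> e" if "0 < e" for e
    proof (rule tendsto_upperbound)
      show "(\<lambda>n. norm (a *\<^sub>R q (s n) y h + b *\<^sub>R q (s n) y h' + c *\<^sub>R q (s n) y h''))
          \<longlonglongrightarrow> norm (a *\<^sub>R D y h + b *\<^sub>R D y h' + c *\<^sub>R D y h'')"
        by (intro tendsto_intros conv y)
    qed (use rel3[OF y that z] in auto)
    then have "norm (a *\<^sub>R D y h + b *\<^sub>R D y h' + c *\<^sub>R D y h'') \<le> 0" by (rule dense_ge)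
    then show ?thesis by simp
  qed
  have lin: "linear (D y)" if y: "y \<in> ball x0 r" for y
  proof (rule linearI)
    show "D y (h + h') = D y h + D y h'" for h h'
      using D3[OF y, of "-1" "h + h'" 1 h 1 h'] by (simp add: algebra_simps)
    show "D y (a *\<^sub>R h) = a *\<^sub>R D y h" for a h
      using D3[OF y, of "-1" "a *\<^sub>R h" a h 0 h] by simp
  qed
  show ?thesis
  proof (rule C1_onI[where f'=D])
    fix y assume y: "y \<in> ball x0 r"
    show "(f has_derivative D y) (at y)" unfolding has_derivative_at_alt
    proof (intro conjI allI impI)
      show "bounded_linear (D y)" using lin[OF y] by (simp add: linear_conv_bounded_linear)
      fix e :: real assume "0 < e"
      then obtain \<delta> where \<delta>: "\<delta> > 0" "\<And>\<epsilon> h. 0 < \<epsilon> \<Longrightarrow> \<epsilon> < \<delta> \<Longrightarrow> norm h \<le> 1 \<Longrightarrow> norm (q \<epsilon> y h - D y h) \<le> e"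
        using unif[of 1 e] y by auto
      show "\<exists>d>0. \<forall>z. norm (z - y) < d \<longrightarrow> norm (f z - f y - D y (z - y)) \<le> e * norm (z - y)"
      proof (intro exI[of _ \<delta>] conjI \<delta>(1) allI impI)
        fix z assume z: "norm (z - y) < \<delta>"
        show "norm (f z - f y - D y (z - y)) \<le> e * norm (z - y)"
        proof (cases "z = y")
          case True
          then show ?thesis using lin[OF y] by (simp add: linear_0)
        next
          case False
          \<comment> \<open>The increment is a step of length \<open>n\<close> in a unit direction,
            so the uniform rate for directions of norm at most 1 applies.\<close>
          define n where "n = norm (z - y)"
          define h where "h = (1 / n) *\<^sub>R (z - y)"
          have n: "0 < n" using False by (simp add: n_def)
          have h: "norm h \<le> 1" "z = y + n *\<^sub>R h" using n by (auto simp: h_def n_def)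
          have "f z - f y - D y (z - y) = n *\<^sub>R (q n y h - D y h)"
            using n h(2) lin[OF y] by (simp add: q_def diff_quotient_def scaleR_diff_right linear_cmul)
          then show ?thesis
            using \<delta>(2)[OF n _ h(1)] z n by (simp add: n_def mult.commute)
        qed
      qed
    qed
  next
    fix h
    have u: "uniform_limit (ball x0 r) (\<lambda>n y. q (s n) y h) (\<lambda>y. D y h) sequentially"
      unfolding uniform_limit_iff
    proof (intro allI impI)
      fix e :: real assume "0 < e"
      then obtain \<delta> where \<delta>: "\<delta> > 0" "\<forall>y\<in>ball x0 r. \<forall>\<epsilon> h'. 0 < \<epsilon> \<and> \<epsilon> < \<delta> \<and> norm h' \<le> norm h + 1 \<longrightarrow> norm (q \<epsilon> y h' - D y h') \<le> e / 2"
        using unif[OF add_nonneg_pos[OF norm_ge_zero[of h] zero_less_one] half_gt_zero[OF \<open>0 < e\<close>]] by blast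
      show "\<forall>\<^sub>F n in sequentially. \<forall>y\<in>ball x0 r. dist (q (s n) y h) (D y h) < e"
        using sl[OF \<delta>(1)]
      proof eventually_elim
        case (elim n)
        show ?case
        proof
          fix y assume "y \<in> ball x0 r"
          then have "norm (q (s n) y h - D y h) \<le> e / 2" using \<delta>(2) s0[of n] elim by simp
          then show "dist (q (s n) y h) (D y h) < e" using \<open>0 < e\<close> by (simp add: dist_norm)
        qed
      qed
    qed
    have c: "\<forall>\<^sub>F n in sequentially. continuous_on (ball x0 r) (\<lambda>y. q (s n) y h)"
    proof -
      \<comment> \<open>Steps this small keep the shifted points in the doubled ball, where
        \<open>f\<close> is continuous.\<close>
      have "0 < r / (norm h + 1)" using r by (simp add: add_nonneg_pos)
      from sl[OF this] show ?thesis
      proof eventually_elim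
        case (elim n)
        have "norm (s n *\<^sub>R h) < r"
        proof -
          have "s n * norm h \<le> s n * (norm h + 1)" using s0[of n] by (intro mult_left_mono) auto
          also have "\<dots> < r" using elim by (subst (asm) pos_less_divide_eq) (simp_all add: add_nonneg_pos)
          finally show ?thesis using s0[of n] by simp
        qed
        then have "y + s n *\<^sub>R h \<in> ball x0 (2 * r)" if "y \<in> ball x0 r" for y
          using that norm_triangle_ineq[of "y - x0" "s n *\<^sub>R h"] by (simp add: dist_norm norm_minus_commute algebra_simps)
        then have "(\<lambda>y. y + s n *\<^sub>R h) ` ball x0 r \<subseteq> ball x0 (2 * r)" by blast
        then have "continuous_on (ball x0 r) (\<lambda>y. f (y + s n *\<^sub>R h))"
          by (rule continuous_on_compose2[OF cont, rotated]) (intro continuous_intros)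
        moreover have "continuous_on (ball x0 r) f"
          by (rule continuous_on_subset[OF cont]) (use r in \<open>auto intro: subset_ball\<close>)
        ultimately show ?case
          unfolding q_def diff_quotient_def by (intro continuous_intros)
      qed
    qed
    show "continuous_on (ball x0 r) (\<lambda>y. D y h)"
      by (rule uniform_limit_theorem[OF c u]) simp
  qed
qed

section \<open>The flow of a C^1 field\<close>

locale C1_flow =
  fixes V :: "'a::euclidean_space \<Rightarrow> 'a" and \<phi> :: "real \<Rightarrow> 'a \<Rightarrow> 'a"
  assumes C1_V: "C1_on UNIV V" and flow: "is_flow V \<phi>"
begin

lemma flow_0 [simp]: "\<phi> 0 x = x"
  using flow by (simp add: is_flow_def)

lemma flow_has_vector_derivative: "((\<lambda>s. \<phi> s x) has_vector_derivative V (\<phi> t x)) (at t)"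
  using flow by (simp add: is_flow_def)

lemma continuous_on_flow_time: "continuous_on S (\<lambda>s. \<phi> s x)"
  using flow_has_vector_derivative by (meson continuous_at_imp_continuous_on has_vector_derivative_continuous)

lemma flow_trajectory_bound:
  assumes "0 \<le> t"
  obtains R where "0 < R" "\<And>s. 0 \<le> s \<Longrightarrow> s \<le> t \<Longrightarrow> norm (\<phi> s x) \<le> R"
proof -
  have "compact ((\<lambda>s. \<phi> s x) ` {0..t})"
    by (intro compact_continuous_image continuous_on_flow_time compact_Icc)
  from compact_imp_bounded[OF this] obtain R where "0 < R" "\<forall>y\<in>(\<lambda>s. \<phi> s x) ` {0..t}. norm y \<le> R"
    unfolding bounded_pos by blast
  then show ?thesis using that[of R] by auto
qed

text \<open>The Gronwall estimate with zero error for the difference of two solutions. The time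
  shift \<open>c\<close> lets it serve twice: with c = 0 for dependence on the initial point, and
  with general c for the group law.\<close>

lemma flow_dist_le:
  assumes t: "0 \<le> t" and L: "0 \<le> L" "\<And>a b. a \<in> K \<Longrightarrow> b \<in> K \<Longrightarrow> norm (V b - V a) \<le> L * norm (b - a)"
    and "\<And>s. 0 \<le> s \<Longrightarrow> s \<le> t \<Longrightarrow> \<phi> (s + c) x \<in> K" "\<And>s. 0 \<le> s \<Longrightarrow> s \<le> t \<Longrightarrow> \<phi> s y \<in> K"
  shows "norm (\<phi> t y - \<phi> (t + c) x) \<le> norm (y - \<phi> c x) * exp ((2 * L + 1) * t)"
proof -
  have "((\<lambda>s. \<phi> s y - \<phi> (s + c) x) has_vector_derivative (V (\<phi> s y) - V (\<phi> (s + c) x))) (at s)" for s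
  proof (intro has_vector_derivative_diff flow_has_vector_derivative)
    show "((\<lambda>s. \<phi> (s + c) x) has_vector_derivative V (\<phi> (s + c) x)) (at s)"
    proof -
      have "((\<lambda>s. s + c) has_vector_derivative 1) (at s)" by (auto intro!: derivative_eq_intros)
      from vector_diff_chain_at[OF this flow_has_vector_derivative] show ?thesis by (simp add: o_def)
    qed
  qed
  from gronwall_norm[OF t L(1) order_refl this] assms(3-5)
  show ?thesis by (simp add: L(2))
qed

text \<open>This is uniqueness: both sides, as functions of s, solve the equation with the same
  initial value. A Lipschitz constant exists only on bounded sets, so both trajectories are enclosed
  in a ball beforehand.\<close>

lemma flow_add_nonneg:
  assumes "0 \<le> s"
  shows "\<phi> s (\<phi> r x) = \<phi> (s + r) x"
proof -
  obtain R1 where R1: "\<And>u. 0 \<le> u \<Longrightarrow> u \<le> s \<Longrightarrow> norm (\<phi> u (\<phi> r x)) \<le> R1"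
    using flow_trajectory_bound[OF assms] by metis
  have "compact ((\<lambda>u. \<phi> (u + r) x) ` {0..s})"
    by (intro compact_continuous_image compact_Icc continuous_on_compose2[OF continuous_on_flow_time[of UNIV]]
        continuous_intros) auto
  from compact_imp_bounded[OF this] obtain R2 where R2: "\<forall>y\<in>(\<lambda>u. \<phi> (u + r) x) ` {0..s}. norm y \<le> R2"
    unfolding bounded_iff by blast
  let ?K = "cball 0 (max R1 R2)"
  obtain L where L: "0 \<le> L" "\<And>a b. a \<in> ?K \<Longrightarrow> b \<in> ?K \<Longrightarrow> norm (V b - V a) \<le> L * norm (b - a)"
    using C1_on_lipschitz_bound[OF C1_V, of ?K] by (metis compact_cball convex_cball)
  have "norm (\<phi> s (\<phi> r x) - \<phi> (s + r) x) \<le> norm (\<phi> r x - \<phi> r x) * exp ((2 * L + 1) * s)"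
  proof (rule flow_dist_le[OF assms L])
    fix u assume u: "0 \<le> u" "u \<le> s"
    show "\<phi> u (\<phi> r x) \<in> ?K" using R1[OF u] by (simp add: le_max_iff_disj)
    have "norm (\<phi> (u + r) x) \<le> R2" using R2 u by auto
    then show "\<phi> (u + r) x \<in> ?K" by (simp add: le_max_iff_disj)
  qed
  then show ?thesis by simp
qed

text \<open>The obstacle is circular: a Lipschitz constant is available only in a ball that the
  neighbouring trajectories have yet to be confined to. At the first time when the distance to the
  trajectory of \<open>x\<close> reaches 1, everything before lies in the ball, and Gronwall shows
  that the distance is still less than 1.\<close>

lemma flow_local_bound:
  assumes t: "0 \<le> t"
  obtains R \<rho> where "0 < \<rho>" "\<And>y s. y \<in> ball x \<rho> \<Longrightarrow> 0 \<le> s \<Longrightarrow> s \<le> t \<Longrightarrow> \<phi> s y \<in> cball 0 R"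
proof -
  obtain R0 where R0: "\<And>s. 0 \<le> s \<Longrightarrow> s \<le> t \<Longrightarrow> norm (\<phi> s x) \<le> R0"
    using flow_trajectory_bound[OF t] by metis
  define R where "R = R0 + 1"
  obtain L where L: "0 \<le> L" "\<And>a b. a \<in> cball 0 R \<Longrightarrow> b \<in> cball 0 R \<Longrightarrow> norm (V b - V a) \<le> L * norm (b - a)"
    using C1_on_lipschitz_bound[OF C1_V, of "cball 0 R"] by (metis compact_cball convex_cball)
  \<comment> \<open>The inverse of the Gronwall growth factor, so that an initial distance below
    \<open>\<rho>\<close> stays below 1.\<close>
  define \<rho> where "\<rho> = exp (- ((2 * L + 1) * t))"
  have "0 < \<rho>" by (simp add: \<rho>_def)
  have "norm (\<phi> s y - \<phi> s x) \<le> 1" if y: "y \<in> ball x \<rho>" and s: "0 \<le> s" "s \<le> t" for y s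
  proof (rule ccontr)
    assume gt: "\<not> norm (\<phi> s y - \<phi> s x) \<le> 1"
    define u where "u s = norm (\<phi> s y - \<phi> s x)" for s
    have cu: "continuous_on S u" for S unfolding u_def by (intro continuous_intros continuous_on_flow_time)
    have "\<rho> \<le> 1" unfolding \<rho>_def using L(1) t by simp
    then have u0: "u 0 < 1" using y by (simp add: u_def dist_norm norm_minus_commute)
    \<comment> \<open>The times at distance exactly 1; the least of them is the first exit.\<close>
    define S where "S = {0..s} \<inter> u -` {1}"
    have "compact S" unfolding S_def
      by (intro compact_Int_closed compact_Icc closed_vimage cu) auto
    have "S \<noteq> {}"
      using IVT'[of u 0 1 s] u0 gt s(1) cu by (auto simp: u_def S_def)
    with \<open>compact S\<close> obtain s0 where s0: "s0 \<in> S" "\<And>r. r \<in> S \<Longrightarrow> s0 \<le> r"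
      using compact_attains_inf[of S] by blast
    have s0': "0 \<le> s0" "s0 \<le> t" "u s0 = 1" using s0(1) s by (auto simp: S_def)
    have le1: "u r \<le> 1" if r: "0 \<le> r" "r \<le> s0" for r
    proof (rule ccontr)
      assume "\<not> u r \<le> 1"
      then obtain q where q: "0 \<le> q" "q \<le> r" "u q = 1" using IVT'[of u 0 1 r] u0 r cu by auto
      then have "q \<in> S" using s0(1) r by (auto simp: S_def)
      then have "q = r" using s0(2) q r by force
      then show False using q(3) \<open>\<not> u r \<le> 1\<close> by simp
    qed
    have "norm (\<phi> s0 y - \<phi> (s0 + 0) x) \<le> norm (y - \<phi> 0 x) * exp ((2 * L + 1) * s0)"
    proof (rule flow_dist_le[OF s0'(1) L])
      fix r assume r: "0 \<le> r" "r \<le> s0"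
      have "norm (\<phi> r x) \<le> R0" using R0 r s0' by simp
      then show "\<phi> (r + 0) x \<in> cball 0 R" by (simp add: R_def)
      show "\<phi> r y \<in> cball 0 R"
        using le1[OF r] \<open>norm (\<phi> r x) \<le> R0\<close> norm_triangle_sub[of "\<phi> r y" "\<phi> r x"] by (simp add: R_def u_def)
    qed
    also have "\<dots> \<le> norm (y - x) * exp ((2 * L + 1) * t)"
      using L(1) s0' by (auto intro!: mult_left_mono)
    also have "\<dots> < \<rho> * exp ((2 * L + 1) * t)"
      using y by (intro mult_strict_right_mono) (auto simp: dist_norm norm_minus_commute)
    also have "\<dots> = 1" unfolding \<rho>_def mult_exp_exp by simp
    finally show False using s0'(3) by (simp add: u_def)
  qed
  then have "\<phi> s y \<in> cball 0 R" if "y \<in> ball x \<rho>" "0 \<le> s" "s \<le> t" for y s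
    using R0[OF that(2,3)] that norm_triangle_sub[of "\<phi> s y" "\<phi> s x"] by (fastforce simp: R_def)
  with \<open>0 < \<rho>\<close> show ?thesis using that by blast
qed

lemma flow_local_lipschitz_nonneg:
  assumes t: "0 \<le> t"
  obtains C \<rho> where "0 < \<rho>" "0 < C" "\<And>y z s. y \<in> ball x \<rho> \<Longrightarrow> z \<in> ball x \<rho> \<Longrightarrow> 0 \<le> s \<Longrightarrow> s \<le> t \<Longrightarrow>
    norm (\<phi> s z - \<phi> s y) \<le> C * norm (z - y)"
proof -
  obtain R \<rho> where R: "0 < \<rho>" "\<And>y s. y \<in> ball x \<rho> \<Longrightarrow> 0 \<le> s \<Longrightarrow> s \<le> t \<Longrightarrow> \<phi> s y \<in> cball 0 R"
    using flow_local_bound[OF t] by metis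
  obtain L where L: "0 \<le> L" "\<And>a b. a \<in> cball 0 R \<Longrightarrow> b \<in> cball 0 R \<Longrightarrow> norm (V b - V a) \<le> L * norm (b - a)"
    using C1_on_lipschitz_bound[OF C1_V, of "cball 0 R"] by (metis compact_cball convex_cball)
  show ?thesis
  proof (rule that[of \<rho> "exp ((2 * L + 1) * t)"])
    fix y z s assume yz: "y \<in> ball x \<rho>" "z \<in> ball x \<rho>" and s: "0 \<le> s" "s \<le> t"
    have "norm (\<phi> s z - \<phi> (s + 0) y) \<le> norm (z - \<phi> 0 y) * exp ((2 * L + 1) * s)"
    proof (rule flow_dist_le[OF s(1) L])
      fix r assume r: "0 \<le> r" "r \<le> s"
      show "\<phi> (r + 0) y \<in> cball 0 R" using R(2)[OF yz(1) r(1)] r s by simp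
      show "\<phi> r z \<in> cball 0 R" using R(2)[OF yz(2) r(1)] r s by simp
    qed
    also have "\<dots> \<le> norm (z - y) * exp ((2 * L + 1) * t)"
      using L(1) s by (auto intro!: mult_left_mono)
    finally show "norm (\<phi> s z - \<phi> s y) \<le> exp ((2 * L + 1) * t) * norm (z - y)" by (simp add: mult.commute)
  qed (use R in auto)
qed

text \<open>As functions of time, the difference quotients of the flow satisfy the linearised
  equation up to a uniformly small error. A combination of quotients whose directions are linearly
  related starts at zero, and Gronwall keeps it small up to time \<open>t\<close>, which is the
  condition of \<open>C1_on_of_difference_quotients\<close>.\<close>

lemma C1_on_flow_nonneg:
  assumes t: "0 \<le> t"
  shows "C1_on UNIV (\<phi> t)"
proof (rule C1_on_local)
  fix x0 :: 'a
  obtain R \<rho>1 where R: "0 < \<rho>1" "\<And>y s. y \<in> ball x0 \<rho>1 \<Longrightarrow> 0 \<le> s \<Longrightarrow> s \<le> t \<Longrightarrow> \<phi> s y \<in> cball 0 R"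
    using flow_local_bound[OF t] by metis
  obtain C \<rho>2 where C: "0 < \<rho>2" "0 < C" "\<And>y z s. y \<in> ball x0 \<rho>2 \<Longrightarrow> z \<in> ball x0 \<rho>2 \<Longrightarrow> 0 \<le> s \<Longrightarrow> s \<le> t \<Longrightarrow>
    norm (\<phi> s z - \<phi> s y) \<le> C * norm (z - y)"
    using flow_local_lipschitz_nonneg[OF t] by metis
  define r where "r = min \<rho>1 \<rho>2 / 2"
  have r: "0 < r" using R(1) C(1) by (simp add: r_def)
  have sub: "ball x0 (2 * r) \<subseteq> ball x0 \<rho>1" "ball x0 (2 * r) \<subseteq> ball x0 \<rho>2"
    by (auto simp: r_def)
  let ?K = "cball (0::'a) R"
  let ?V = "\<lambda>x. frechet_derivative V (at x)"
  obtain L where L: "0 \<le> L" "\<And>x h. x \<in> ?K \<Longrightarrow> norm (?V x h) \<le> L * norm h"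
    using C1_on_lipschitz_bound[OF C1_V, of ?K] by (metis compact_cball convex_cball)
  define E where "E = exp ((2 * L + 1) * t)"
  have E: "0 < E" by (simp add: E_def)
  define q where "q s = diff_quotient (\<phi> s)" for s
  define q' where "q' s \<epsilon> y h = (1 / \<epsilon>) *\<^sub>R (V (\<phi> s (y + \<epsilon> *\<^sub>R h)) - V (\<phi> s y))" for s \<epsilon> y h
  have q': "((\<lambda>s. q s \<epsilon> y h) has_vector_derivative q' s \<epsilon> y h) (at s)" for s \<epsilon> y h
    unfolding q_def diff_quotient_def q'_def
    using bounded_linear.has_vector_derivative[OF bounded_linear_scaleR_right has_vector_derivative_diff[OF flow_has_vector_derivative flow_has_vector_derivative]] .
  have "C1_on (ball x0 r) (\<phi> t)"
  proof (rule C1_on_of_difference_quotients[OF r])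
    show "continuous_on (ball x0 (2 * r)) (\<phi> t)"
    proof (rule lipschitz_on_continuous_on)
      show "C-lipschitz_on (ball x0 (2 * r)) (\<phi> t)"
      proof (rule lipschitz_onI)
        fix y z assume "y \<in> ball x0 (2 * r)" "z \<in> ball x0 (2 * r)"
        then have "y \<in> ball x0 \<rho>2" "z \<in> ball x0 \<rho>2" using sub(2) by blast+
        then show "dist (\<phi> t y) (\<phi> t z) \<le> C * dist y z" using C(3)[of z y t] t by (simp add: dist_norm)
      qed (use C in simp)
    qed
  next
    fix H e :: real assume He: "0 < H" "0 < e"
    \<comment> \<open>Gronwall multiplies errors by \<open>E\<close>, and C * H bounds the size of
      the quotients; dividing by both leaves the final error \<open>e\<close>.\<close>
    define e1 where "e1 = e / (E * C * H)"
    have e1: "0 < e1" using He E C(2) by (simp add: e1_def)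
    obtain d where d: "0 < d" "\<And>a b. a \<in> ?K \<Longrightarrow> b \<in> ?K \<Longrightarrow> dist b a < d \<Longrightarrow>
        norm (V b - V a - ?V a (b - a)) \<le> e1 * norm (b - a)"
      using C1_on_uniformly_differentiable[OF C1_V compact_cball convex_cball e1] by metis
    \<comment> \<open>The first bound keeps y + \<epsilon> h in the doubled ball, the second keeps
      the two trajectories within distance \<open>d\<close>, where the linearisation estimate
      holds.\<close>
    define \<delta> where "\<delta> = min (r / H) (d / (C * H))"
    have \<delta>: "0 < \<delta>" using r He d(1) C(2) by (simp add: \<delta>_def)
    have err: "norm (q' s \<epsilon> y h - ?V (\<phi> s y) (q s \<epsilon> y h)) \<le> e / E"
      if y: "y \<in> ball x0 r" and \<epsilon>: "0 < \<epsilon> \<and> \<epsilon> < \<delta>" and h: "norm h \<le> H" and s: "0 \<le> s" "s \<le> t" for s \<epsilon> y h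
    proof -
      have "norm (\<epsilon> *\<^sub>R h) \<le> \<epsilon> * H" using \<epsilon> h by simp
      also have lt: "\<epsilon> * H < r" "C * (\<epsilon> * H) < d"
        using \<epsilon> He C(2) by (auto simp: \<delta>_def pos_less_divide_eq mult_ac)
      note lt(1)
      finally have "norm (\<epsilon> *\<^sub>R h) < r" .
      then have yh: "y + \<epsilon> *\<^sub>R h \<in> ball x0 (2 * r)"
        using y norm_triangle_ineq[of "y - x0" "\<epsilon> *\<^sub>R h"] by (simp add: dist_norm norm_minus_commute algebra_simps)
      have y2: "y \<in> ball x0 (2 * r)" using y r by simp
      let ?a = "\<phi> s y" and ?b = "\<phi> s (y + \<epsilon> *\<^sub>R h)"
      have K: "?a \<in> ?K" "?b \<in> ?K" using R(2) s sub(1) yh y2 by blast+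
      have "norm (?b - ?a) \<le> C * norm (\<epsilon> *\<^sub>R h)"
        using C(3)[OF subsetD[OF sub(2) y2] subsetD[OF sub(2) yh] s] by simp
      also have "\<dots> \<le> C * (\<epsilon> * H)" using \<open>norm (\<epsilon> *\<^sub>R h) \<le> \<epsilon> * H\<close> C(2) by simp
      finally have ba: "norm (?b - ?a) \<le> C * (\<epsilon> * H)" .
      then have "dist ?b ?a < d" using lt(2) by (simp add: dist_norm)
      from d(2)[OF K this] have "norm (V ?b - V ?a - ?V ?a (?b - ?a)) \<le> e1 * (C * (\<epsilon> * H))"
        using ba e1 by (meson mult_left_mono less_imp_le order_trans)
      also have "\<dots> = \<epsilon> * (e / E)" using He C(2) E by (simp add: e1_def field_simps)
      finally have 1: "norm (V ?b - V ?a - ?V ?a (?b - ?a)) \<le> \<epsilon> * (e / E)" .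
      have "?V ?a (q s \<epsilon> y h) = (1 / \<epsilon>) *\<^sub>R ?V ?a (?b - ?a)"
        unfolding q_def diff_quotient_def by (rule linear_cmul[OF C1_on_linear_frechet[OF C1_V UNIV_I]])
      then have "q' s \<epsilon> y h - ?V ?a (q s \<epsilon> y h) = (1 / \<epsilon>) *\<^sub>R (V ?b - V ?a - ?V ?a (?b - ?a))"
        by (simp add: q'_def scaleR_diff_right)
      then have "norm (q' s \<epsilon> y h - ?V ?a (q s \<epsilon> y h)) = (1 / \<epsilon>) * norm (V ?b - V ?a - ?V ?a (?b - ?a))"
        using \<epsilon> by simp
      also have "\<dots> \<le> (1 / \<epsilon>) * (\<epsilon> * (e / E))" using 1 \<epsilon> by (intro mult_left_mono) auto
      finally show ?thesis using \<epsilon> by simp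
    qed
    show "\<exists>\<delta>>0. nearly_linear_quotients (\<phi> t) (ball x0 r) H e \<delta>"
      unfolding nearly_linear_quotients_def q_def[symmetric]
    proof (intro exI[of _ \<delta>] conjI \<delta> ballI allI impI, elim conjE)
      fix y :: 'a and a b c \<epsilon> \<epsilon>' \<epsilon>'' :: real and h h' h'' :: 'a
      assume y: "y \<in> ball x0 r" and \<epsilon>: "0 < \<epsilon>" "\<epsilon> < \<delta>" "0 < \<epsilon>'" "\<epsilon>' < \<delta>" "0 < \<epsilon>''" "\<epsilon>'' < \<delta>"
        and h: "norm h \<le> H" "norm h' \<le> H" "norm h'' \<le> H" and z: "a *\<^sub>R h + b *\<^sub>R h' + c *\<^sub>R h'' = 0"
      define A where "A = \<bar>a\<bar> + \<bar>b\<bar> + \<bar>c\<bar>"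
      define w where "w s = a *\<^sub>R q s \<epsilon> y h + b *\<^sub>R q s \<epsilon>' y h' + c *\<^sub>R q s \<epsilon>'' y h''" for s
      define w' where "w' s = a *\<^sub>R q' s \<epsilon> y h + b *\<^sub>R q' s \<epsilon>' y h' + c *\<^sub>R q' s \<epsilon>'' y h''" for s
      have w': "(w has_vector_derivative w' s) (at s)" for s
        unfolding w_def w'_def
        by (intro has_vector_derivative_add bounded_linear.has_vector_derivative[OF bounded_linear_scaleR_right] q')
      \<comment> \<open>At time 0 the flow is the identity, so the quotients are the directions
        themselves and the relation makes the combination vanish.\<close>
      have w0: "w 0 = 0" using z \<epsilon> by (simp add: w_def q_def diff_quotient_def)
      have "norm (w t) \<le> (norm (w 0) + A * (e / E)) * exp ((2 * L + 1) * t)"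
      proof (rule gronwall_norm[OF t L(1) _ w'])
        show "0 \<le> A * (e / E)" using He E by (simp add: A_def)
        fix s assume s: "0 \<le> s" "s \<le> t"
        let ?D = "?V (\<phi> s y)"
        let ?r = "\<lambda>\<epsilon> h. q' s \<epsilon> y h - ?D (q s \<epsilon> y h)"
        have lin: "linear ?D" using C1_on_linear_frechet[OF C1_V] by simp
        have "w' s = ?D (w s) + (a *\<^sub>R ?r \<epsilon> h + b *\<^sub>R ?r \<epsilon>' h' + c *\<^sub>R ?r \<epsilon>'' h'')"
          unfolding w_def w'_def by (simp add: linear_add[OF lin] linear_cmul[OF lin] algebra_simps)
        moreover have "norm (?D (w s)) \<le> L * norm (w s)"
        proof (rule L(2))
          have "y \<in> ball x0 (2 * r)" using y r by simp
          then have "y \<in> ball x0 \<rho>1" using sub(1) by blast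
          then show "\<phi> s y \<in> ?K" using R(2) s by blast
        qed
        moreover have "norm (a *\<^sub>R ?r \<epsilon> h + b *\<^sub>R ?r \<epsilon>' h' + c *\<^sub>R ?r \<epsilon>'' h'') \<le> A * (e / E)"
        proof -
          have "norm (a *\<^sub>R ?r \<epsilon> h) \<le> \<bar>a\<bar> * (e / E)" "norm (b *\<^sub>R ?r \<epsilon>' h') \<le> \<bar>b\<bar> * (e / E)"
            "norm (c *\<^sub>R ?r \<epsilon>'' h'') \<le> \<bar>c\<bar> * (e / E)"
            unfolding norm_scaleR using \<epsilon> by (intro mult_left_mono err[OF y _ _ s] h; simp)+
          then show ?thesis unfolding A_def distrib_right
            by (intro norm_triangle_le add_mono)
        qed
        ultimately show "norm (w' s) \<le> L * norm (w s) + A * (e / E)"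
          by (metis add_mono norm_triangle_le)
      qed
      also have "\<dots> = A * e" using E by (simp add: w0 flip: E_def)
      finally show "norm (a *\<^sub>R q t \<epsilon> y h + b *\<^sub>R q t \<epsilon>' y h' + c *\<^sub>R q t \<epsilon>'' y h'') \<le> (\<bar>a\<bar> + \<bar>b\<bar> + \<bar>c\<bar>) * e"
        by (simp add: w_def A_def)
    qed
  qed
  then show "\<exists>T. open T \<and> x0 \<in> T \<and> C1_on T (\<phi> t)"
    using r by (intro exI[of _ "ball x0 r"]) auto
qed

text \<open>Gronwall estimates run forward in time; negative times are reached by applying them to
  this flow.\<close>

lemma reversed: "C1_flow (\<lambda>x. - V x) (\<lambda>t. \<phi> (- t))"
proof
  show "C1_on UNIV (\<lambda>x. - V x)" by (intro C1_intros C1_V)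
  show "is_flow (\<lambda>x. - V x) (\<lambda>t. \<phi> (- t))"
    unfolding is_flow_def
  proof (intro allI conjI)
    fix x t
    show "\<phi> (- 0) x = x" by simp
    have "(uminus has_vector_derivative - 1) (at t)" by (auto intro!: derivative_eq_intros)
    from vector_diff_chain_at[OF this, of "\<lambda>s. \<phi> s x"] flow_has_vector_derivative[of x "- t"]
    show "((\<lambda>s. \<phi> (- s) x) has_vector_derivative - V (\<phi> (- t) x)) (at t)"
      by (simp add: o_def)
  qed
qed

lemma flow_add: "\<phi> s (\<phi> r x) = \<phi> (s + r) x"
proof (cases "0 \<le> s")
  case True
  then show ?thesis by (rule flow_add_nonneg)
next
  case False
  then show ?thesis
    using C1_flow.flow_add_nonneg[OF reversed, of "- s" "- r" x] by (simp add: add.commute)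
qed

lemma C1_on_flow: "C1_on UNIV (\<phi> t)"
proof (cases "0 \<le> t")
  case True
  then show ?thesis by (rule C1_on_flow_nonneg)
next
  case False
  then show ?thesis
    using C1_flow.C1_on_flow_nonneg[OF reversed, of "- t"] by simp
qed

text \<open>Near \<open>x0\<close> the flow is Lipschitz in space with one constant for all times up
  to \<open>a\<close> in absolute value, and at \<open>x0\<close> it is continuous in time. The
  summand 1 in \<open>a\<close> makes \<open>t0\<close> an interior time.\<close>

lemma continuous_on_flow: "continuous_on UNIV (\<lambda>(t, x). \<phi> t x)"
proof -
  have "isCont (\<lambda>(t, x). \<phi> t x) (t0, x0)" for t0 x0
  proof -
    define a where "a = \<bar>t0\<bar> + 1"
    have "0 \<le> a" by (simp add: a_def)
    obtain C1 \<rho>1 where 1: "0 < \<rho>1" "0 < C1" "\<And>y z s. y \<in> ball x0 \<rho>1 \<Longrightarrow> z \<in> ball x0 \<rho>1 \<Longrightarrow> 0 \<le> s \<Longrightarrow> s \<le> a \<Longrightarrow>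
        norm (\<phi> s z - \<phi> s y) \<le> C1 * norm (z - y)"
      using flow_local_lipschitz_nonneg[OF \<open>0 \<le> a\<close>] by metis
    obtain C2 \<rho>2 where 2: "0 < \<rho>2" "0 < C2" "\<And>y z s. y \<in> ball x0 \<rho>2 \<Longrightarrow> z \<in> ball x0 \<rho>2 \<Longrightarrow> 0 \<le> s \<Longrightarrow> s \<le> a \<Longrightarrow>
        norm (\<phi> (- s) z - \<phi> (- s) y) \<le> C2 * norm (z - y)"
      using C1_flow.flow_local_lipschitz_nonneg[OF reversed \<open>0 \<le> a\<close>] by metis
    define C where "C = max C1 C2"
    have lip: "norm (\<phi> s z - \<phi> s x0) \<le> C * norm (z - x0)"
      if "z \<in> ball x0 (min \<rho>1 \<rho>2)" "\<bar>s\<bar> \<le> a" for z s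
    proof (cases "0 \<le> s")
      case True
      then have "norm (\<phi> s z - \<phi> s x0) \<le> C1 * norm (z - x0)" using 1(1) that by (intro 1(3)) auto
      also have "\<dots> \<le> C * norm (z - x0)" by (intro mult_right_mono) (auto simp: C_def)
      finally show ?thesis .
    next
      case False
      then have "norm (\<phi> (- (- s)) z - \<phi> (- (- s)) x0) \<le> C2 * norm (z - x0)" using 2(1) that by (intro 2(3)) auto
      also have "\<dots> \<le> C * norm (z - x0)" by (intro mult_right_mono) (auto simp: C_def)
      finally show ?thesis by simp
    qed
    have "((\<lambda>p. \<phi> (fst p) (snd p) - \<phi> (fst p) x0) \<longlongrightarrow> 0) (at (t0, x0))"
    proof (rule Lim_null_comparison)
      show "((\<lambda>p. C * norm (snd p - x0)) \<longlongrightarrow> 0) (at (t0, x0))"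
        by (auto intro!: tendsto_eq_intros)
      have "open ({- a<..<a} \<times> ball x0 (min \<rho>1 \<rho>2))" by (intro open_Times) auto
      moreover have "(t0, x0) \<in> {- a<..<a} \<times> ball x0 (min \<rho>1 \<rho>2)" using 1(1) 2(1) by (auto simp: a_def)
      ultimately show "\<forall>\<^sub>F p in at (t0, x0). norm (\<phi> (fst p) (snd p) - \<phi> (fst p) x0) \<le> C * norm (snd p - x0)"
        unfolding eventually_at_topological using lip by (intro exI[of _ "{- a<..<a} \<times> ball x0 (min \<rho>1 \<rho>2)"]) auto
    qed
    moreover have "((\<lambda>p. \<phi> (fst p) x0) \<longlongrightarrow> \<phi> t0 x0) (at (t0, x0))"
      by (rule continuous_on_tendsto_compose[OF continuous_on_flow_time[of UNIV]]) (auto intro!: tendsto_eq_intros)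
    ultimately have "((\<lambda>p. \<phi> (fst p) (snd p)) \<longlongrightarrow> \<phi> t0 x0) (at (t0, x0))"
      using tendsto_add by fastforce
    then show ?thesis by (simp add: isCont_def case_prod_unfold)
  qed
  then show ?thesis by (simp add: continuous_at_imp_continuous_on)
qed

lemma continuous_on_flow_compose [continuous_intros]:
  "continuous_on S f \<Longrightarrow> continuous_on S g \<Longrightarrow> continuous_on S (\<lambda>x. \<phi> (f x) (g x))"
  using continuous_on_compose2[OF continuous_on_flow, of S "\<lambda>x. (f x, g x)"]
  by (auto intro: continuous_on_Pair)

lemma flow_inverse [simp]: "\<phi> (- t) (\<phi> t x) = x" "\<phi> t (\<phi> (- t) x) = x"
  by (simp_all add: flow_add)

lemma flow_image_eq_vimage: "\<phi> t ` S = \<phi> (- t) -` S"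
  by (auto intro: rev_image_eqI[of "\<phi> (- t) _"])

lemma open_flow_image: "open S \<Longrightarrow> open (\<phi> t ` S)"
  unfolding flow_image_eq_vimage by (intro open_vimage C1_on_continuous C1_on_flow)

lemma closure_flow_image: "closure (\<phi> t ` S) = \<phi> t ` closure S"
proof
  show "closure (\<phi> t ` S) \<subseteq> \<phi> t ` closure S"
  proof (rule closure_minimal)
    show "closed (\<phi> t ` closure S)"
      unfolding flow_image_eq_vimage by (intro closed_vimage C1_on_continuous C1_on_flow) simp
  qed (use closure_subset in blast)
  show "\<phi> t ` closure S \<subseteq> closure (\<phi> t ` S)"
    by (rule image_closure_subset[OF continuous_on_subset[OF C1_on_continuous[OF C1_on_flow]]])
      (auto simp: closure_subset)
qed

lemma bounded_flow_image:
  assumes "bounded S"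
  shows "bounded (\<phi> t ` S)"
proof -
  have "compact (\<phi> t ` closure S)"
    using assms by (intro compact_continuous_image continuous_on_subset[OF C1_on_continuous[OF C1_on_flow]]) auto
  then show ?thesis
    by (rule bounded_subset[OF compact_imp_bounded]) (use closure_subset in blast)
qed

text \<open>The flow carries \<open>V\<close> to itself: differentiate \<phi> t (\<phi> s x) =
  \<phi> s (\<phi> t x) at s = 0. This identifies the derivative along \<open>V\<close> of a weight
  transported by the flow.\<close>

lemma frechet_derivative_flow_field: "frechet_derivative (\<phi> t) (at x) (V x) = V (\<phi> t x)"
proof -
  have "(\<phi> t has_derivative frechet_derivative (\<phi> t) (at (\<phi> 0 x))) (at (\<phi> 0 x))"
    by (rule C1_on_has_derivative[OF C1_on_flow]) simp
  from vector_derivative_diff_chain_within[OF has_vector_derivative_at_within[OF flow_has_vector_derivative] has_derivative_at_withinI[OF this], of UNIV]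
  have "((\<lambda>s. \<phi> t (\<phi> s x)) has_vector_derivative frechet_derivative (\<phi> t) (at x) (V x)) (at 0)"
    by (simp add: o_def)
  moreover have "((\<lambda>s. \<phi> t (\<phi> s x)) has_vector_derivative V (\<phi> t x)) (at 0)"
    using flow_has_vector_derivative[of "\<phi> t x" 0] by (simp add: flow_add add.commute)
  ultimately show ?thesis by (rule vector_derivative_unique_at)
qed

end

section \<open>Boundary charts of moving domains\<close>

text \<open>
  The implicit function theorem for one equation, obtained from the inverse function theorem for
  the map that replaces the \<open>k\<close>-coordinate of \<open>y\<close> by \<open>r y\<close>.
\<close>

lemma level_set_chart:
  fixes r :: "'a::euclidean_space \<Rightarrow> real"
  assumes O: "open O'" "p \<in> O'" and r: "C1_on O' r" "r p = 0" and v: "frechet_derivative r (at p) v \<noteq> 0"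
  obtains U k g where "open U" "p \<in> U" "U \<subseteq> O'" "k \<in> Basis \<or> - k \<in> Basis"
    "\<And>x c. g (x + c *\<^sub>R k) = g x" "C1_on U g" "\<And>x. x \<in> U \<Longrightarrow> r x < 0 \<longleftrightarrow> x \<bullet> k < (g x :: real)"
proof -
  define D where "D x = frechet_derivative r (at x)" for x
  have lin: "linear (D x)" if "x \<in> O'" for x unfolding D_def using C1_on_linear_frechet[OF r(1) that] .
  have "\<exists>b\<in>Basis. D p b \<noteq> 0"
  proof (rule ccontr)
    assume "\<not> ?thesis"
    then have "norm (D p v) \<le> 0" using linear_norm_le_sum_Basis[OF lin[OF O(2)], of v] by simp
    then show False using v by (simp add: D_def)
  qed
  then obtain b where b: "b \<in> Basis" "D p b \<noteq> 0" by blast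
  \<comment> \<open>The sign is chosen so that \<open>r\<close> increases along \<open>k\<close>;
    then r < 0 describes the side below the graph.\<close>
  define k where "k = (if D p b > 0 then b else - b)"
  have kB: "k \<in> Basis \<or> - k \<in> Basis" using b(1) by (simp add: k_def)
  then have kk: "k \<bullet> k = 1" by (rule signed_Basis_inner_same)
  have Dk: "D p k > 0" using b(2) linear_neg[OF lin[OF O(2)]] by (simp add: k_def)
  have Dcont: "continuous_on O' (\<lambda>x. D x h)" for h using r(1) by (simp add: C1_on_def D_def)
  define Q where "Q = {x \<in> O'. D x k > 0}"
  have "Q = O' \<inter> (\<lambda>x. D x k) -` {0<..}" by (auto simp: Q_def)
  then have Q: "open Q" using continuous_open_preimage[OF Dcont O(1), of "{0<..}" k] by simp
  have pQ: "p \<in> Q" using O(2) Dk by (simp add: Q_def)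
  define \<Theta> where "\<Theta> y = y + (r y - y \<bullet> k) *\<^sub>R k" for y
  define A where "A x h = h + (D x h - h \<bullet> k) *\<^sub>R k" for x h
  \<comment> \<open>The inverse of the derivative \<open>A x\<close> of \<open>\<Theta>\<close>, in
    closed form so that its continuity is visible; it exists where \<open>D x k\<close> is
    nonzero.\<close>
  define E where "E x u = u + ((u \<bullet> k - D x u) / D x k) *\<^sub>R k" for x u
  have AE: "A x (E x u) = u" "E x (A x u) = u" if "x \<in> Q" for x u
  proof -
    have l: "linear (D x)" and k: "D x k \<noteq> 0" using that lin by (auto simp: Q_def)
    have 1: "D x (E x u) = u \<bullet> k" using k by (simp add: E_def linear_add[OF l] linear_cmul[OF l])
    have 2: "A x u \<bullet> k = D x u" by (simp add: A_def inner_add_left kk)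
    show "A x (E x u) = u"
    proof -
      define s where "s = (u \<bullet> k - D x u) / D x k"
      have "E x u = u + s *\<^sub>R k" by (simp add: E_def s_def)
      then show ?thesis unfolding A_def[of x "E x u"] 1 by (simp add: inner_add_left kk algebra_simps)
    qed
    have 3: "D x (A x u) = D x u + (D x u - u \<bullet> k) * D x k"
      by (simp add: A_def linear_add[OF l] linear_cmul[OF l])
    show "E x (A x u) = u"
    proof -
      have q: "(D x u - (D x u + (D x u - u \<bullet> k) * D x k)) / D x k = - (D x u - u \<bullet> k)"
        using k by (simp add: field_simps)
      show ?thesis unfolding E_def[of x "A x u"] 2 3 q by (simp add: A_def algebra_simps)
    qed
  qed
  have blA: "bounded_linear (A x)" and blE: "bounded_linear (E x)" if "x \<in> Q" for x
  proof -
    have l: "linear (D x)" using that lin by (auto simp: Q_def)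
    have "linear (A x)" by (rule linearI) (auto simp: A_def linear_add[OF l] linear_cmul[OF l] inner_add_left algebra_simps)
    moreover have "linear (E x)"
      by (rule linearI) (auto simp: E_def linear_add[OF l] linear_cmul[OF l] inner_add_left algebra_simps diff_divide_distrib add_divide_distrib)
    ultimately show "bounded_linear (A x)" "bounded_linear (E x)" by (simp_all add: linear_conv_bounded_linear)
  qed
  have app: "blinfun_apply (Blinfun (A x)) = A x" "blinfun_apply (Blinfun (E x)) = E x" if "x \<in> Q" for x
    using blA[OF that] blE[OF that] by (simp_all add: bounded_linear_Blinfun_apply)
  have d: "(\<Theta> has_derivative blinfun_apply (Blinfun (A x))) (at x)" if "x \<in> Q" for x
  proof -
    have "(r has_derivative D x) (at x)" unfolding D_def
      by (rule C1_on_has_derivative[OF r(1)]) (use that in \<open>simp add: Q_def\<close>)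
    then have "(\<Theta> has_derivative A x) (at x)"
      unfolding \<Theta>_def[abs_def] A_def[abs_def] by (auto intro!: derivative_eq_intros)
    then show ?thesis by (simp add: app[OF that])
  qed
  have cA: "continuous_on Q (\<lambda>x. Blinfun (A x))"
  proof (rule continuous_on_blinfun_componentwise)
    fix i :: 'a
    have "continuous_on Q (\<lambda>x. A x i)"
      unfolding A_def by (intro continuous_intros continuous_on_subset[OF Dcont]) (auto simp: Q_def)
    then show "continuous_on Q (\<lambda>x. blinfun_apply (Blinfun (A x)) i)"
      by (rule continuous_on_eq) (simp add: app)
  qed
  have inv: "Blinfun (E p) o\<^sub>L Blinfun (A p) = id_blinfun"
    by (rule blinfun_eqI) (simp add: app[OF pQ] AE[OF pQ])
  obtain U' V' g1 g1' where g1: "open U'" "U' \<subseteq> Q" "p \<in> U'" "open V'" "\<Theta> p \<in> V'" "homeomorphism U' V' \<Theta> g1"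
      and dg1: "\<And>y. y \<in> V' \<Longrightarrow> (g1 has_derivative g1' y) (at y)"
        "\<And>y. y \<in> V' \<Longrightarrow> g1' y = inv (blinfun_apply (Blinfun (A (g1 y))))"
    using inverse_function_theorem[OF Q d cA pQ inv] by metis
  have g1Q: "g1 y \<in> U'" "\<Theta> (g1 y) = y" if "y \<in> V'" for y
    using g1(6) that by (auto simp: homeomorphism_def)
  have g1cont: "continuous_on V' g1" using g1(6) by (auto simp: homeomorphism_def)
  have C1g1: "C1_on V' g1"
  proof (rule C1_onI)
    fix y assume y: "y \<in> V'"
    have q: "g1 y \<in> Q" using g1Q(1)[OF y] g1(2) by blast
    have "inv (A (g1 y)) = E (g1 y)"
      by (rule inv_unique_comp) (auto simp: AE[OF q])
    then show "(g1 has_derivative E (g1 y)) (at y)" using dg1[OF y] app[OF q] by simp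
  next
    fix h
    have im: "g1 ` V' \<subseteq> O'" using g1Q g1(2) by (auto simp: Q_def)
    have "continuous_on V' (\<lambda>y. D (g1 y) h)" for h
      by (rule continuous_on_compose2[OF Dcont g1cont im])
    moreover have "D (g1 y) k \<noteq> 0" if "y \<in> V'" for y
      using g1Q(1)[OF that] g1(2) by (auto simp: Q_def)
    ultimately show "continuous_on V' (\<lambda>y. E (g1 y) h)"
      unfolding E_def by (intro continuous_intros) auto
  qed
  obtain \<delta> where \<delta>: "\<delta> > 0" "ball p \<delta> \<subseteq> U'" using g1(1,3) open_contains_ball by blast
  define \<pi> where "\<pi> y = y - (y \<bullet> k) *\<^sub>R k" for y
  have \<pi>k: "\<pi> (y + c *\<^sub>R k) = \<pi> y" for y c
    by (simp add: \<pi>_def inner_add_left kk algebra_simps)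
  have c\<pi>: "continuous_on UNIV \<pi>" unfolding \<pi>_def by (intro continuous_intros)
  have \<Theta>p: "\<Theta> p = \<pi> p" by (simp add: \<Theta>_def \<pi>_def r(2) algebra_simps)
  \<comment> \<open>Both y and the zero of \<open>r\<close> on its \<open>k\<close>-line, namely
    \<open>g1 (\<pi> y)\<close>, are kept in one ball inside \<open>Q\<close>. By convexity the
    segment between them stays in \<open>Q\<close>, where \<open>r\<close> is strictly increasing
    along \<open>k\<close>, so the sign of \<open>r y\<close> tells on which side of the zero y
    lies.\<close>
  define U where "U = ball p \<delta> \<inter> \<pi> -` (V' \<inter> g1 -` ball p \<delta>)"
  define g where "g y = g1 (\<pi> y) \<bullet> k" for y
  show ?thesis
  proof (rule that[of U k g])
    have "open (V' \<inter> g1 -` ball p \<delta>)" by (rule continuous_open_preimage[OF g1cont g1(4)]) simp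
    from open_Int[OF open_ball open_vimage[OF this c\<pi>]] show "open U" unfolding U_def .
    have "g1 (\<Theta> p) = p" using g1(3,6) by (auto simp: homeomorphism_def)
    then show "p \<in> U" using \<delta>(1) g1(5) by (simp add: U_def \<Theta>p[symmetric])
    show "U \<subseteq> O'" using \<delta>(2) g1(2) by (auto simp: U_def Q_def)
    show "g (x + c *\<^sub>R k) = g x" for x c by (simp add: g_def \<pi>k)
    have "C1_on U (\<lambda>y. g1 (\<pi> y))"
      by (rule C1_on_compose[OF _ C1g1]) (auto simp: \<pi>_def[abs_def] U_def intro!: C1_intros)
    then show "C1_on U g" unfolding g_def[abs_def] by (intro C1_intros)
    fix y assume y: "y \<in> U"
    define z where "z = g1 (\<pi> y)"
    have \<pi>y: "\<pi> y \<in> V'" and zB: "z \<in> ball p \<delta>" and yB: "y \<in> ball p \<delta>" using y by (auto simp: U_def z_def)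
    have \<Theta>z: "\<Theta> z = \<pi> y" using g1Q(2)[OF \<pi>y] by (simp add: z_def)
    have "\<Theta> z \<bullet> k = r z" by (simp add: \<Theta>_def inner_add_left kk)
    moreover have "\<pi> y \<bullet> k = 0" by (simp add: \<pi>_def inner_diff_left kk)
    ultimately have rz: "r z = 0" using \<Theta>z by simp
    define s where "s = y \<bullet> k - z \<bullet> k"
    have ys: "y = z + s *\<^sub>R k" using \<Theta>z by (simp add: \<Theta>_def rz \<pi>_def s_def algebra_simps)
    define \<rho> where "\<rho> \<tau> = r (z + \<tau> *\<^sub>R k)" for \<tau>
    have \<rho>': "\<exists>d. (\<rho> has_real_derivative d) (at \<tau>) \<and> 0 < d" if \<tau>: "\<tau> \<in> closed_segment 0 s" for \<tau>
    proof -
      obtain u where u: "0 \<le> u" "u \<le> 1" "\<tau> = u * s" using \<tau> by (auto simp: closed_segment_def)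
      have "z + \<tau> *\<^sub>R k = (1 - u) *\<^sub>R z + u *\<^sub>R y" by (simp add: ys u algebra_simps)
      also have "\<dots> \<in> ball p \<delta>" using convexD_alt[OF convex_ball zB yB u(1,2)] .
      finally have q: "z + \<tau> *\<^sub>R k \<in> Q" using \<delta>(2) g1(2) by blast
      then have "(r has_derivative D (z + \<tau> *\<^sub>R k)) (at (z + \<tau> *\<^sub>R k))"
        unfolding D_def by (intro C1_on_has_derivative[OF r(1)]) (simp add: Q_def)
      moreover have "((\<lambda>\<tau>. z + \<tau> *\<^sub>R k) has_derivative (\<lambda>h. h *\<^sub>R k)) (at \<tau>)"
        by (auto intro!: derivative_eq_intros)
      ultimately have "(\<rho> has_derivative (\<lambda>h. D (z + \<tau> *\<^sub>R k) (h *\<^sub>R k))) (at \<tau>)"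
        unfolding \<rho>_def[abs_def] using diff_chain_at[of "\<lambda>\<tau>. z + \<tau> *\<^sub>R k"] by (simp add: o_def)
      moreover have "linear (D (z + \<tau> *\<^sub>R k))" using q lin by (simp add: Q_def)
      ultimately have "(\<rho> has_real_derivative D (z + \<tau> *\<^sub>R k) k) (at \<tau>)"
        unfolding has_field_derivative_def by (elim has_derivative_eq_rhs) (simp add: fun_eq_iff linear_cmul)
      then show ?thesis using q by (auto simp: Q_def)
    qed
    have "r y < 0 \<longleftrightarrow> s < 0"
    proof (cases s "0::real" rule: linorder_cases)
      case less
      have "\<rho> s < \<rho> 0" by (rule DERIV_pos_imp_increasing[OF less]) (use \<rho>' less in \<open>auto simp: closed_segment_eq_real_ivl\<close>)
      then show ?thesis using less rz ys by (simp add: \<rho>_def)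
    next
      case equal
      then show ?thesis using rz ys by simp
    next
      case greater
      have "\<rho> 0 < \<rho> s" by (rule DERIV_pos_imp_increasing[OF greater]) (use \<rho>' greater in \<open>auto simp: closed_segment_eq_real_ivl\<close>)
      then show ?thesis using greater rz ys by (simp add: \<rho>_def)
    qed
    then show "r y < 0 \<longleftrightarrow> y \<bullet> k < g y" by (simp add: s_def g_def z_def)
  qed (rule kB)
qed

text \<open>The boundary regularity that is carried over to images under the flow, and the one that
  the charts in \<open>has_flux\<close> ask for.\<close>

definition C1_boundary :: "'a::euclidean_space set \<Rightarrow> bool" where
  "C1_boundary W \<longleftrightarrow> (\<forall>p\<in>frontier W. \<exists>U k g. p \<in> U \<and> boundary_graph W U k g \<and> C1_on U g)"

lemma smooth_domain_C1_boundary: "smooth_domain W \<Longrightarrow> C1_boundary W"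
  unfolding smooth_domain_def C1_boundary_def Cinf_on_def by (metis Ck_on_1_iff)

text \<open>A point below the graph lies in the open set \<open>W\<close>, and a point above it has
  a neighbourhood disjoint from \<open>W\<close>; neither is on the frontier.\<close>

lemma boundary_graph_frontier:
  assumes chart: "boundary_graph W U k g" and g: "continuous_on U g" and W: "open W" and p: "p \<in> U" "p \<in> frontier W"
  shows "p \<bullet> k = g p"
proof (rule ccontr)
  have U: "open U" and WU: "\<And>x. x \<in> U \<Longrightarrow> x \<in> W \<longleftrightarrow> x \<bullet> k < g x"
    using chart unfolding boundary_graph_def by blast+
  assume "p \<bullet> k \<noteq> g p"
  moreover have "p \<notin> W" using p(2) W by (simp add: frontier_def interior_open)
  ultimately have "g p - p \<bullet> k < 0" using WU[OF p(1)] by simp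
  let ?N = "U \<inter> (\<lambda>x. g x - x \<bullet> k) -` {..<0}"
  have "open ?N" by (intro continuous_open_preimage U continuous_intros g)
  moreover have "p \<in> ?N" using p(1) \<open>g p - p \<bullet> k < 0\<close> by simp
  moreover have "?N \<inter> W = {}" using WU by auto
  ultimately show False
    using p(2) by (metis (no_types, lifting) DiffD1 disjoint_iff frontier_def open_Int_closure_eq_empty)
qed

text \<open>Inside a chart the frontier lies in the image of part of a hyperplane under the
  differentiable map x -> x + g x k of the space to itself, and such maps preserve null
  sets.\<close>

lemma negligible_C1_boundary:
  fixes W :: "'a::euclidean_space set"
  assumes W: "open W" "C1_boundary W"
  shows "negligible (frontier W)"
  unfolding locally_negligible_alt[of "frontier W"]
proof
  fix p assume p: "p \<in> frontier W"
  obtain U k g where c: "p \<in> U" "boundary_graph W U k g" "C1_on U g"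
    using W(2) p unfolding C1_boundary_def by blast
  have U: "open U" and k: "k \<in> Basis \<or> - k \<in> Basis" and gk: "\<And>x c. g (x + c *\<^sub>R k) = g x"
    using c(2) unfolding boundary_graph_def by blast+
  have kk: "k \<bullet> k = 1" using boundary_graph_axis[OF c(2)] .
  \<comment> \<open>The shadow of \<open>U\<close> on the hyperplane. Its points may lie outside
    \<open>U\<close>, but \<open>g\<close> is differentiable at them because it is constant along
    \<open>k\<close>.\<close>
  define H where "H = {x. k \<bullet> x = 0} \<inter> {x. \<exists>c. x + c *\<^sub>R k \<in> U}"
  have "negligible {x. k \<bullet> x = 0}" using kk by (intro negligible_hyperplane) auto
  then have "negligible H" by (rule negligible_subset) (auto simp: H_def)
  moreover have "(\<lambda>x. x + g x *\<^sub>R k) differentiable_on H"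
    unfolding differentiable_on_def
  proof
    fix x assume "x \<in> H"
    then obtain c' where "x + c' *\<^sub>R k \<in> U" by (auto simp: H_def)
    then have "g differentiable at (x + c' *\<^sub>R k)" using c(3) by (simp add: C1_on_def)
    moreover have "(\<lambda>x. x + c' *\<^sub>R k) differentiable at x" by simp
    ultimately have "(g \<circ> (\<lambda>x. x + c' *\<^sub>R k)) differentiable at x" by (intro differentiable_chain_at)
    then have "g differentiable at x" by (simp add: o_def gk)
    then obtain g' where "(g has_derivative g') (at x)" unfolding differentiable_def by blast
    then have "((\<lambda>x. x + g x *\<^sub>R k) has_derivative (\<lambda>h. h + g' h *\<^sub>R k)) (at x)"
      by (intro has_derivative_add has_derivative_ident has_derivative_scaleR_left)
    then show "(\<lambda>x. x + g x *\<^sub>R k) differentiable at x within H"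
      using has_derivative_at_withinI unfolding differentiable_def by blast
  qed
  ultimately have "negligible ((\<lambda>x. x + g x *\<^sub>R k) ` H)"
    by (intro negligible_differentiable_image_negligible) auto
  moreover have "frontier W \<inter> U \<subseteq> (\<lambda>x. x + g x *\<^sub>R k) ` H"
  proof
    fix x assume x: "x \<in> frontier W \<inter> U"
    then have "x \<bullet> k = g x"
      using boundary_graph_frontier[OF c(2) C1_on_continuous[OF c(3)] W(1)] by blast
    moreover have "g (x + (- (x \<bullet> k)) *\<^sub>R k) = g x" by (rule gk)
    moreover have "x - (x \<bullet> k) *\<^sub>R k \<in> H"
      using x kk by (auto simp: H_def inner_diff_right inner_commute[of k x] intro!: exI[of _ "x \<bullet> k"])
    ultimately show "x \<in> (\<lambda>x. x + g x *\<^sub>R k) ` H"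
      by (intro image_eqI[of _ _ "x - (x \<bullet> k) *\<^sub>R k"]) auto
  qed
  ultimately have "negligible (frontier W \<inter> U)" by (rule negligible_subset)
  then show "\<exists>T. openin (top_of_set (frontier W)) T \<and> p \<in> T \<and> negligible T"
    using U p c(1) by (intro exI[of _ "frontier W \<inter> U"]) auto
qed

theorem flux_eq_integral_divergence:
  fixes F :: "'a::euclidean_space \<Rightarrow> 'a"
  assumes W: "open W" "bounded W" "C1_boundary W"
    and O: "open O'" "closure W \<subseteq> O'" and F: "C1_on O' F"
  shows "flux W F = (LBINT x. indicator W x * divergence F x)"
proof -
  have "\<forall>p. \<exists>U k g. p \<in> frontier W \<longrightarrow> p \<in> U \<and> boundary_graph W U k g \<and> C1_on U g"
    using W(3) unfolding C1_boundary_def by blast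
  then obtain U k g where c: "\<And>p. p \<in> frontier W \<Longrightarrow> p \<in> U p \<and> boundary_graph W (U p) (k p) (g p) \<and> C1_on (U p) (g p)"
    by metis
  have "\<exists>I. has_flux W F I"
  proof (rule partition_of_unity[of "frontier W" U])
    show "compact (frontier W)" using W(2) by (simp add: compact_frontier_bounded)
    show "open (U p) \<and> p \<in> U p" if "p \<in> frontier W" for p
      using c[OF that] unfolding boundary_graph_def by blast
    fix m :: nat and p :: "nat \<Rightarrow> 'a" and \<eta> :: "nat \<Rightarrow> 'a \<Rightarrow> real" and S
    assume P: "\<And>i. i < m \<Longrightarrow> p i \<in> frontier W \<and> C1_on UNIV (\<eta> i) \<and> (\<forall>x. 0 \<le> \<eta> i x) \<and>
       compact (closure {x. \<eta> i x \<noteq> 0}) \<and> closure {x. \<eta> i x \<noteq> 0} \<subseteq> U (p i)"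
      and S: "open S" "frontier W \<subseteq> S" "\<And>x. x \<in> S \<Longrightarrow> (\<Sum>i<m. \<eta> i x) = 1"
    have "has_flux W F (\<Sum>i<m. graph_flux (\<lambda>y. \<eta> i y *\<^sub>R F y) (k (p i)) (g (p i)))"
      unfolding has_flux_def Ck_on_1_iff
    proof (intro exI conjI allI impI)
      fix i assume i: "i < m"
      show "boundary_graph W (U (p i)) (k (p i)) (g (p i))" "C1_on (U (p i)) (g (p i))"
        using c P[OF i] by blast+
      show "C1_on UNIV (\<eta> i)" "\<And>x. 0 \<le> \<eta> i x" "compact (closure {x. \<eta> i x \<noteq> 0})"
        "closure {x. \<eta> i x \<noteq> 0} \<subseteq> U (p i)" using P[OF i] by blast+
    next
      show "open S" "frontier W \<subseteq> S" "\<forall>x\<in>S. (\<Sum>i<m. \<eta> i x) = 1" using S by blast+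
    qed (rule refl)
    then show ?thesis by blast
  qed
  then obtain I where I: "has_flux W F I" by blast
  then have "flux W F = I"
    unfolding flux_def using has_flux_imp_eq_integral_divergence[OF _ W(1,2) O F] by (intro the_equality) auto
  then show ?thesis using has_flux_imp_eq_integral_divergence[OF I W(1,2) O F] by simp
qed

context C1_flow
begin

text \<open>A chart of \<open>W\<close> composed with the inverse flow describes the image locally
  as r < 0. This is not yet a graph over coordinate axes, since the flow tilts the direction
  \<open>k\<close>; \<open>level_set_chart\<close> restores that form.\<close>

lemma C1_boundary_flow_image:
  assumes W: "open W" "C1_boundary W"
  shows "C1_boundary (\<phi> t ` W)"
  unfolding C1_boundary_def
proof
  fix p' assume "p' \<in> frontier (\<phi> t ` W)"
  moreover have W': "open (\<phi> t ` W)" by (rule open_flow_image[OF W(1)])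
  ultimately have "p' \<in> \<phi> t ` closure W - \<phi> t ` W"
    by (simp add: frontier_def interior_open closure_flow_image)
  then obtain p where p': "p' = \<phi> t p" and p: "p \<in> frontier W"
    using W(1) by (auto simp: frontier_def interior_open)
  obtain U k g where c: "p \<in> U" "boundary_graph W U k g" "C1_on U g"
    using W(2) p unfolding C1_boundary_def by blast
  have U: "open U" and gk: "\<And>x c. g (x + c *\<^sub>R k) = g x"
    and WU: "\<And>x. x \<in> U \<Longrightarrow> x \<in> W \<longleftrightarrow> x \<bullet> k < g x"
    using c(2) unfolding boundary_graph_def by blast+
  have kk: "k \<bullet> k = 1" using boundary_graph_axis[OF c(2)] .
  define O' where "O' = \<phi> (- t) -` U"
  define r where "r y = \<phi> (- t) y \<bullet> k - g (\<phi> (- t) y)" for y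
  have O: "open O'" unfolding O'_def by (intro open_vimage U C1_on_continuous C1_on_flow)
  have pO: "p' \<in> O'" using c(1) by (simp add: O'_def p')
  have r: "C1_on O' r"
    unfolding r_def[abs_def] by (intro C1_intros C1_on_compose[OF _ c(3)] C1_on_subset[OF C1_on_flow]) (auto simp: O'_def)
  have pk: "p \<bullet> k = g p" using boundary_graph_frontier[OF c(2) C1_on_continuous[OF c(3)] W(1) c(1) p] .
  then have r0: "r p' = 0" by (simp add: r_def p')
  \<comment> \<open>The image of the line through \<open>p\<close> in direction \<open>k\<close>.
    Along it \<open>r\<close> equals the parameter, so the derivative of \<open>r\<close> at
    \<open>p'\<close> cannot vanish.\<close>
  define \<gamma> where "\<gamma> s = \<phi> t (p + s *\<^sub>R k)" for s :: real
  have "((\<lambda>s. p + s *\<^sub>R k) has_derivative (\<lambda>s. s *\<^sub>R k)) (at 0)" by (auto intro!: derivative_eq_intros)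
  from diff_chain_at[OF this C1_on_has_derivative[OF C1_on_flow UNIV_I]]
  have \<gamma>: "(\<gamma> has_derivative (\<lambda>s. frechet_derivative (\<phi> t) (at p) (s *\<^sub>R k))) (at 0)"
    by (simp add: \<gamma>_def[abs_def] o_def)
  let ?v = "frechet_derivative (\<phi> t) (at p) (1 *\<^sub>R k)"
  have "((\<lambda>s. r (\<gamma> s)) has_derivative (\<lambda>s. frechet_derivative r (at p') (frechet_derivative (\<phi> t) (at p) (s *\<^sub>R k)))) (at 0)"
    using diff_chain_at[OF \<gamma>, of r] C1_on_has_derivative[OF r pO] by (simp add: \<gamma>_def p' o_def)
  moreover have "r (\<gamma> s) = s" for s
    using pk by (simp add: r_def \<gamma>_def gk inner_add_left kk)
  ultimately have "((\<lambda>s. s) has_derivative (\<lambda>s. frechet_derivative r (at p') (frechet_derivative (\<phi> t) (at p) (s *\<^sub>R k)))) (at 0)"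
    by simp
  from fun_cong[OF has_derivative_unique[OF this has_derivative_ident], of 1]
  have "frechet_derivative r (at p') ?v \<noteq> 0" by simp
  from level_set_chart[OF O pO r r0 this]
  obtain U' k' g' where u: "open U'" "p' \<in> U'" "U' \<subseteq> O'" "k' \<in> Basis \<or> - k' \<in> Basis"
    "\<And>x c. g' (x + c *\<^sub>R k') = g' x" "C1_on U' g'" "\<And>x. x \<in> U' \<Longrightarrow> r x < 0 \<longleftrightarrow> x \<bullet> k' < g' x"
    by metis
  have "x \<in> \<phi> t ` W \<longleftrightarrow> x \<bullet> k' < g' x" if "x \<in> U'" for x
    using u(3) that WU[of "\<phi> (- t) x"] u(7)[OF that] by (auto simp: flow_image_eq_vimage O'_def r_def)
  then have "boundary_graph (\<phi> t ` W) U' k' g'"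
    unfolding boundary_graph_def using u(1,4,5) by blast
  then show "\<exists>U k g. p' \<in> U \<and> boundary_graph (\<phi> t ` W) U k g \<and> C1_on U g"
    using u(2,6) by blast
qed

end

section \<open>The transport theorem\<close>

lemma frechet_derivative_compose:
  assumes "C1_on S f" "x \<in> S" "C1_on S' g" "f x \<in> S'"
  shows "frechet_derivative (\<lambda>x. g (f x)) (at x) h = frechet_derivative g (at (f x)) (frechet_derivative f (at x) h)"
  using frechet_derivative_at[OF diff_chain_at[OF C1_on_has_derivative[OF assms(1,2)] C1_on_has_derivative[OF assms(3,4)]]]
  by (simp add: o_def) (metis comp_apply)

locale moving_domain = C1_flow V \<phi>
  for V :: "'a::euclidean_space \<Rightarrow> 'a" and \<phi> :: "real \<Rightarrow> 'a \<Rightarrow> 'a" +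
  fixes \<Omega>\<^sub>0 :: "'a set" and T :: "'a \<Rightarrow> real \<Rightarrow> real"
  assumes open_\<Omega>\<^sub>0: "open \<Omega>\<^sub>0"
    and C1_T: "C1_on {(y, t). t > 0 \<and> y \<in> \<phi> t ` \<Omega>\<^sub>0} (\<lambda>(y, t). T y t)"
begin

abbreviation spacetime :: "('a \<times> real) set" where
  "spacetime \<equiv> {(y, t). t > 0 \<and> y \<in> \<phi> t ` \<Omega>\<^sub>0}"

lemma spacetime_iff: "(y, t) \<in> spacetime \<longleftrightarrow> t > 0 \<and> \<phi> (- t) y \<in> \<Omega>\<^sub>0"
  by (simp add: flow_image_eq_vimage)

lemma open_spacetime: "open spacetime"
proof -
  have "spacetime = {p. snd p > 0} \<inter> (\<lambda>p. \<phi> (- snd p) (fst p)) -` \<Omega>\<^sub>0"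
    by (auto simp: flow_image_eq_vimage)
  also have "open \<dots>"
    by (intro open_Int open_Collect_less open_vimage open_\<Omega>\<^sub>0 continuous_intros)
  finally show ?thesis .
qed

text \<open>Time derivative, space derivative and derivative along a trajectory are all values of
  this total derivative, so the relations between them reduce to linearity.\<close>

abbreviation T' :: "'a \<Rightarrow> real \<Rightarrow> 'a \<times> real \<Rightarrow> real" where
  "T' y t \<equiv> frechet_derivative (\<lambda>(y, t). T y t) (at (y, t))"

lemma T_has_derivative:
  "(y, t) \<in> spacetime \<Longrightarrow> ((\<lambda>(y, t). T y t) has_derivative T' y t) (at (y, t))"
  by (rule C1_on_has_derivative[OF C1_T])

lemma T_has_derivative_along:
  assumes "(y, t) \<in> spacetime" "(c has_vector_derivative c') (at t)" "c t = y"
  shows "((\<lambda>s. T (c s) s) has_real_derivative T' y t (c', 1)) (at t)"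
proof -
  have "((\<lambda>s. (c s, s)) has_derivative (\<lambda>h. (h *\<^sub>R c', h))) (at t)"
    using assms(2) unfolding has_vector_derivative_def by (intro has_derivative_Pair has_derivative_ident)
  from diff_chain_at[OF this, of "\<lambda>(y, t). T y t" "T' y t"] assms
  have "((\<lambda>s. T (c s) s) has_derivative (\<lambda>h. T' y t (h *\<^sub>R c', h))) (at t)"
    using T_has_derivative[OF assms(1)] by (simp add: o_def)
  moreover have "T' y t (h *\<^sub>R c', h) = T' y t (c', 1) * h" for h
    using linear_cmul[OF has_derivative_linear[OF T_has_derivative[OF assms(1)]], of h "(c', 1)"]
    by (simp add: mult.commute)
  ultimately show ?thesis unfolding has_field_derivative_def by (simp only:)
qed

lemma T_has_time_derivative:
  "(y, t) \<in> spacetime \<Longrightarrow> ((\<lambda>s. T y s) has_real_derivative T' y t (0, 1)) (at t)"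
  using T_has_derivative_along[of y t "\<lambda>s. y" 0] by simp

lemma T_has_space_derivative:
  assumes "(y, t) \<in> spacetime"
  shows "((\<lambda>z. T z t) has_derivative (\<lambda>h. T' y t (h, 0))) (at y)"
proof -
  have "((\<lambda>z. (z, t)) has_derivative (\<lambda>h. (h, 0))) (at y)"
    by (intro has_derivative_Pair has_derivative_ident has_derivative_const)
  from diff_chain_at[OF this T_has_derivative[OF assms]] show ?thesis by (simp add: o_def)
qed

lemma C1_on_T_space:
  assumes "t > 0"
  shows "C1_on (\<phi> t ` \<Omega>\<^sub>0) (\<lambda>z. T z t)"
proof (rule C1_onI)
  show "((\<lambda>z. T z t) has_derivative (\<lambda>h. T' y t (h, 0))) (at y)" if "y \<in> \<phi> t ` \<Omega>\<^sub>0" for y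
    using assms that by (intro T_has_space_derivative) auto
  show "continuous_on (\<phi> t ` \<Omega>\<^sub>0) (\<lambda>y. T' y t (h, 0))" for h
    using assms by (intro C1_on_frechet_continuous[OF C1_T] continuous_intros) auto
qed

text \<open>The integrand of the transport theorem. It is the left side of the Eulerian equation
  and, evaluated at \<phi> t x, that of the pulled-back one.\<close>

definition rate :: "'a \<Rightarrow> real \<Rightarrow> real" where
  "rate y t = deriv (\<lambda>s. T y s) t + divergence (\<lambda>z. T z t *\<^sub>R V z) y"

lemma rate_eq:
  assumes "(y, t) \<in> spacetime"
  shows "rate y t = T' y t (0, 1) + T y t * divergence V y + T' y t (V y, 0)"
proof -
  have "(\<lambda>z. T z t) differentiable (at y)" "V differentiable (at y)"
    using T_has_space_derivative[OF assms] C1_V by (auto simp: differentiable_def C1_on_def)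
  from divergence_scaleR[OF this] show ?thesis
    unfolding rate_def DERIV_imp_deriv[OF T_has_time_derivative[OF assms]]
      frechet_derivative_at[OF T_has_space_derivative[OF assms], symmetric] by simp
qed

lemma continuous_on_rate: "continuous_on spacetime (\<lambda>(y, t). rate y t)"
proof -
  have c: "continuous_on spacetime (\<lambda>p. divergence V (fst p))" "continuous_on spacetime (\<lambda>p. V (fst p))"
    by (rule continuous_on_compose2[OF _ continuous_on_fst[OF continuous_on_id], of UNIV];
        simp add: continuous_on_divergence C1_V C1_on_continuous)+
  have T': "continuous_on spacetime (\<lambda>p. T' (fst p) (snd p) (v p))" if "continuous_on spacetime v" for v
    by (rule C1_on_frechet_continuous[OF C1_T _ _ that]) (auto intro!: continuous_intros)
  have "continuous_on spacetime (\<lambda>p. T (fst p) (snd p))"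
    using C1_on_continuous[OF C1_T] by (simp add: case_prod_unfold)
  then have "continuous_on spacetime (\<lambda>p. T' (fst p) (snd p) (0, 1) + T (fst p) (snd p) * divergence V (fst p)
      + T' (fst p) (snd p) (V (fst p), 0))"
    using c by (intro continuous_intros T')
  then show ?thesis
    by (rule continuous_on_eq) (auto simp: rate_eq)
qed

lemma continuous_on_slice:
  assumes G: "continuous_on spacetime (\<lambda>(y, t). G y t)" and t: "t > 0"
  shows "continuous_on (\<phi> t ` \<Omega>\<^sub>0) (\<lambda>y. G y t)"
proof -
  have "continuous_on (\<phi> t ` \<Omega>\<^sub>0) (\<lambda>y. case (y, t) of (y, t) \<Rightarrow> G y t)"
    by (rule continuous_on_compose2[OF G])
      (use t in \<open>auto intro!: continuous_intros continuous_on_Pair continuous_on_const\<close>)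
  then show ?thesis by simp
qed

lemma transport_compact_support:
  assumes t: "t > 0" and \<psi>: "C1_on UNIV \<psi>" and K: "compact K" "K \<subseteq> \<Omega>\<^sub>0" and zero: "\<And>x. x \<notin> K \<Longrightarrow> \<psi> x = (0::real)"
  shows "((\<lambda>s. LBINT y. \<psi> (\<phi> (- s) y) * T y s) has_real_derivative
    (LBINT y. \<psi> (\<phi> (- t) y) * rate y t)) (at t)"
proof -
  let ?\<psi> = "\<lambda>x. frechet_derivative \<psi> (at x)"
  have cK: "closed K" using K(1) by (rule compact_imp_closed)
  have zero': "?\<psi> x = (\<lambda>h. 0)" if "x \<notin> K" for x
    by (rule frechet_derivative_zero_outside[OF cK zero that])
  \<comment> \<open>These times are bounded away from 0, where nothing is known about
    \<open>T\<close>, and from infinity, which makes the region swept by \<open>K\<close>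
    compact.\<close>
  define U where "U = {t / 2<..<2 * t}"
  have U: "open U" "convex U" "t \<in> U" "\<And>s. s \<in> U \<Longrightarrow> s > 0" using t by (auto simp: U_def)
  define P' where "P' s y = - ?\<psi> (\<phi> (- s) y) (V (\<phi> (- s) y)) * T y s + \<psi> (\<phi> (- s) y) * T' y s (0, 1)" for s y
  define K' where "K' = (\<lambda>(s, x). \<phi> s x) ` ({t / 2..2 * t} \<times> K)"
  have K': "compact K'"
    unfolding K'_def by (intro compact_continuous_image compact_Times compact_Icc K(1)
        continuous_on_subset[OF continuous_on_flow]) auto
  have outK': "\<phi> (- s) y \<notin> K" if "s \<in> U" "y \<notin> K'" for s y
  proof
    assume "\<phi> (- s) y \<in> K"
    then have "y \<in> K'" unfolding K'_def using that(1)
      by (intro image_eqI[of _ _ "(s, \<phi> (- s) y)"]) (auto simp: U_def)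
    with that show False by simp
  qed
  have "((\<lambda>s. LBINT y. \<psi> (\<phi> (- s) y) * T y s) has_real_derivative (LBINT y. P' t y)) (at t)"
  proof (rule lborel_integral_leibniz[OF K' U(1-3)])
    fix s y assume s: "s \<in> U"
    show "((\<lambda>s. \<psi> (\<phi> (- s) y) * T y s) has_real_derivative P' s y) (at s)"
    proof (cases "\<phi> (- s) y \<in> K")
      case True
      then have yE: "(y, s) \<in> spacetime" using U(4)[OF s] K(2) unfolding spacetime_iff by blast
      have "(uminus has_vector_derivative - 1) (at s)" by (auto intro!: derivative_eq_intros)
      from vector_diff_chain_at[OF this flow_has_vector_derivative[of y]]
      have "((\<lambda>s. \<phi> (- s) y) has_derivative (\<lambda>h. h *\<^sub>R - V (\<phi> (- s) y))) (at s)"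
        by (simp add: o_def has_vector_derivative_def)
      from diff_chain_at[OF this C1_on_has_derivative[OF \<psi> UNIV_I]]
      have "((\<lambda>s. \<psi> (\<phi> (- s) y)) has_derivative (\<lambda>h. ?\<psi> (\<phi> (- s) y) (h *\<^sub>R - V (\<phi> (- s) y)))) (at s)"
        by (simp add: o_def)
      then have "((\<lambda>s. \<psi> (\<phi> (- s) y)) has_real_derivative - ?\<psi> (\<phi> (- s) y) (V (\<phi> (- s) y))) (at s)"
        unfolding has_field_derivative_def
        using C1_on_linear_frechet[OF \<psi> UNIV_I, of "\<phi> (- s) y"]
        by (elim has_derivative_eq_rhs) (simp only: fun_eq_iff linear_cmul linear_neg real_scaleR_def mult.commute, simp)
      from DERIV_mult[OF this T_has_time_derivative[OF yE]] show ?thesis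
        unfolding P'_def by (simp add: add.commute mult.commute)
    next
      \<comment> \<open>For nearby times the backward trajectory stays off \<open>K\<close>, so the
        product vanishes there whatever the values of \<open>T\<close> are.\<close>
      case False
      then have P0: "P' s y = 0" by (simp add: P'_def zero zero')
      show ?thesis
        unfolding P0
      proof (rule has_field_derivative_transform_within_open[OF DERIV_const])
        show "open ((\<lambda>s. \<phi> (- s) y) -` (- K))"
          using cK by (intro open_vimage continuous_intros) auto
        show "s \<in> (\<lambda>s. \<phi> (- s) y) -` (- K)" using False by simp
        show "0 = \<psi> (\<phi> (- u) y) * T y u" if "u \<in> (\<lambda>s. \<phi> (- s) y) -` (- K)" for u
          using that zero by simp
      qed
    qed
  next
    fix s assume s: "s \<in> U"
    have "continuous_on (\<phi> s ` \<Omega>\<^sub>0) (\<lambda>y. \<psi> (\<phi> (- s) y) * T y s)"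
      using C1_on_continuous[OF C1_on_T_space[OF U(4)[OF s]]]
      by (intro continuous_intros continuous_on_compose2[OF C1_on_continuous[OF \<psi>]]) auto
    moreover have "closed (\<phi> s ` K)"
      using cK closure_flow_image[of s K] by (metis closed_closure closure_closed)
    ultimately show "continuous_on UNIV (\<lambda>y. \<psi> (\<phi> (- s) y) * T y s)"
    proof (rule continuous_on_extend_zero[OF open_flow_image[OF open_\<Omega>\<^sub>0]])
      show "\<phi> s ` K \<subseteq> \<phi> s ` \<Omega>\<^sub>0" using K(2) by blast
      show "\<psi> (\<phi> (- s) y) * T y s = 0" if "y \<notin> \<phi> s ` K" for y
        using that zero by (simp add: flow_image_eq_vimage)
    qed
  next
    \<comment> \<open>On \<open>?A\<close> the fields are regular, on \<open>?B\<close> the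
      integrand is zero, and the two open sets cover \<open>U \<times> UNIV\<close>.\<close>
    let ?A = "{p. fst p \<in> U} \<inter> (\<lambda>p. \<phi> (- fst p) (snd p)) -` \<Omega>\<^sub>0"
    let ?B = "{p. fst p \<in> U} \<inter> (\<lambda>p. \<phi> (- fst p) (snd p)) -` (- K)"
    have oU: "open {p :: real \<times> 'a. fst p \<in> U}"
      using open_vimage[OF U(1) continuous_on_fst[OF continuous_on_id]] by (simp add: vimage_def)
    have oA: "open ?A" by (intro open_Int oU open_vimage open_\<Omega>\<^sub>0 continuous_intros)
    have oB: "open ?B" using cK by (intro open_Int oU open_vimage continuous_intros) auto
    have AE: "(\<lambda>p. (snd p, fst p)) ` ?A \<subseteq> spacetime"
    proof
      fix q assume "q \<in> (\<lambda>p. (snd p, fst p)) ` ?A"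
      then obtain s y where "q = (y, s)" "s \<in> U" "\<phi> (- s) y \<in> \<Omega>\<^sub>0" by auto
      then show "q \<in> spacetime" using U(4) spacetime_iff[of y s] by simp
    qed
    have "continuous_on ?A (\<lambda>p. case (snd p, fst p) of (y, t) \<Rightarrow> T y t)"
      using C1_on_continuous[OF C1_T] _ AE by (rule continuous_on_compose2) (intro continuous_intros)
    then have cT: "continuous_on ?A (\<lambda>p. T (snd p) (fst p))" by simp
    have cT': "continuous_on ?A (\<lambda>p. T' (snd p) (fst p) (0, 1))"
      by (intro C1_on_frechet_continuous[OF C1_T _ AE] continuous_intros)
    have "continuous_on ?A (\<lambda>p. P' (fst p) (snd p))"
      unfolding P'_def
      by (intro continuous_intros cT cT' C1_on_frechet_continuous[OF \<psi>]
          continuous_on_compose2[OF C1_on_continuous[OF \<psi>]] continuous_on_compose2[OF C1_on_continuous[OF C1_V]]) auto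
    moreover have "continuous_on ?B (\<lambda>p. P' (fst p) (snd p))"
      by (rule continuous_on_eq[OF continuous_on_const[of _ 0]]) (auto simp: P'_def zero zero')
    ultimately have "continuous_on (?A \<union> ?B) (\<lambda>p. P' (fst p) (snd p))"
      by (rule continuous_on_open_Un[OF oA oB])
    moreover have "?A \<union> ?B = U \<times> UNIV" using K(2) by auto
    ultimately show "continuous_on (U \<times> UNIV) (\<lambda>(s, y). P' s y)" by (simp add: case_prod_unfold)
  qed (use outK' zero in auto)
  moreover have "(LBINT y. P' t y) = (LBINT y. \<psi> (\<phi> (- t) y) * rate y t)"
  proof -
    let ?S = "\<phi> t ` \<Omega>\<^sub>0" and ?K = "\<phi> t ` K"
    let ?w = "\<lambda>y. \<psi> (\<phi> (- t) y)"
    \<comment> \<open>The product rule for this field produces the derivative of the weight along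
      \<open>V\<close>, which is what the time derivative of the transported weight contributes with
      the opposite sign. Hence the two integrands differ by the divergence of \<open>?G\<close>
      only.\<close>
    let ?G = "\<lambda>y. ?w y *\<^sub>R (T y t *\<^sub>R V y)"
    have S: "open ?S" by (rule open_flow_image[OF open_\<Omega>\<^sub>0])
    have Kc: "compact ?K"
      by (intro compact_continuous_image K(1) continuous_on_subset[OF C1_on_continuous[OF C1_on_flow]]) auto
    have KS: "?K \<subseteq> ?S" using K(2) by blast
    have w0: "?w y = 0" if "y \<notin> ?K" for y using that zero by (simp add: flow_image_eq_vimage)
    have C1w: "C1_on UNIV ?w" by (rule C1_on_compose[OF C1_on_flow \<psi>]) simp
    have C1TV: "C1_on ?S (\<lambda>y. T y t *\<^sub>R V y)"
      by (intro C1_intros C1_on_T_space[OF t] C1_on_subset[OF C1_V]) simp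
    have G: "C1_on UNIV ?G"
      by (rule C1_on_extend_zero[OF S _ compact_imp_closed[OF Kc] KS])
        (rule C1_on_scaleR[OF C1_on_subset[OF C1w] C1TV], simp, simp add: w0)
    have G0: "?G y = 0" if "y \<notin> ?K" for y using w0[OF that] by simp
    have cR: "continuous_on UNIV (\<lambda>y. ?w y * rate y t)"
    proof (rule continuous_on_extend_zero[OF S _ compact_imp_closed[OF Kc] KS])
      show "continuous_on ?S (\<lambda>y. ?w y * rate y t)"
        using continuous_on_slice[OF continuous_on_rate t]
        by (intro continuous_intros continuous_on_subset[OF C1_on_continuous[OF C1w]]) auto
    qed (simp add: w0)
    have "P' t y = ?w y * rate y t - divergence ?G y" for y
    proof (cases "y \<in> ?K")
      case True
      then have y: "y \<in> ?S" "(y, t) \<in> spacetime" using KS t by auto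
      have "divergence ?G y = ?w y * divergence (\<lambda>y. T y t *\<^sub>R V y) y + frechet_derivative ?w (at y) (T y t *\<^sub>R V y)"
        by (rule divergence_scaleR) (use C1w C1TV y in \<open>auto simp: C1_on_def\<close>)
      also have "frechet_derivative ?w (at y) (T y t *\<^sub>R V y) = T y t * frechet_derivative ?w (at y) (V y)"
        using linear_cmul[OF C1_on_linear_frechet[OF C1w UNIV_I]] by simp
      also have "frechet_derivative ?w (at y) (V y) = ?\<psi> (\<phi> (- t) y) (V (\<phi> (- t) y))"
        by (simp add: frechet_derivative_compose[OF C1_on_flow UNIV_I \<psi> UNIV_I] frechet_derivative_flow_field)
      finally show ?thesis
        unfolding P'_def rate_def DERIV_imp_deriv[OF T_has_time_derivative[OF y(2)]] by (simp add: algebra_simps)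
    next
      case False
      have "divergence ?G y = 0"
        by (rule divergence_zero_outside[OF compact_imp_closed[OF Kc] G0 False])
      moreover have "\<phi> (- t) y \<notin> K" using False by (simp add: flow_image_eq_vimage)
      ultimately show ?thesis by (simp add: P'_def zero zero')
    qed
    moreover have "integrable lborel (divergence ?G)"
      by (rule integrable_compact_support[OF continuous_on_divergence[OF G] Kc])
        (rule divergence_zero_outside[OF compact_imp_closed[OF Kc] G0])
    moreover have "integrable lborel (\<lambda>y. ?w y * rate y t)"
      by (rule integrable_compact_support[OF cR Kc]) (simp add: w0)
    ultimately have "(LBINT y. P' t y) = (LBINT y. ?w y * rate y t) - (LBINT y. divergence ?G y)"
      by simp
    then show ?thesis using integral_divergence_compact_support[OF G Kc G0] by simp
  qed
  ultimately show ?thesis by simp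
qed

end

section \<open>From weights of class C^1 to indicator functions\<close>

lemma integrable_indicator_continuous:
  fixes u :: "'a::euclidean_space \<Rightarrow> real"
  assumes "open A" "bounded A" "closure A \<subseteq> S" "continuous_on S u"
  shows "integrable lborel (\<lambda>y. indicator A y * u y)"
proof -
  have "integrable lborel (\<lambda>y. indicator (closure A) y *\<^sub>R u y)"
    using assms by (intro borel_integrable_compact continuous_on_subset[OF assms(4)]) auto
  moreover have "A \<in> sets lborel" using assms(1) by (simp add: borel_open)
  ultimately have "integrable lborel (\<lambda>y. indicator A y *\<^sub>R (indicator (closure A) y *\<^sub>R u y))"
    by (rule integrable_mult_indicator[rotated])
  moreover have "indicator A y *\<^sub>R (indicator (closure A) y *\<^sub>R u y) = indicator A y * u y" for y
    using closure_subset[of A] by (auto simp: indicator_def)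
  ultimately show ?thesis by (simp only:)
qed

lemma indicator_C1_approximation:
  fixes W :: "'a::euclidean_space set"
  assumes W: "open W" "bounded W"
  obtains \<psi> :: "nat \<Rightarrow> 'a \<Rightarrow> real" and K where
    "\<And>n. C1_on UNIV (\<psi> n)" "\<And>n x. 0 \<le> \<psi> n x" "\<And>n x. \<psi> n x \<le> 1"
    "\<And>n. compact (K n)" "\<And>n. K n \<subseteq> W" "\<And>n x. x \<notin> K n \<Longrightarrow> \<psi> n x = 0"
    "\<And>x. (\<lambda>n. \<psi> n x) \<longlonglongrightarrow> indicator W x"
proof -
  \<comment> \<open>By convention \<open>infdist\<close> to the empty set is 0, so the complement
    has to be nonempty for the distance to detect membership in \<open>W\<close>.\<close>
  have ne: "- W \<noteq> {}" using W(2) by (metis Compl_empty_eq double_compl not_bounded_UNIV)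
  have cl: "closed (- W)" using W(1) by auto
  \<comment> \<open>A compact exhaustion: each point of \<open>W\<close> lies in \<open>C n\<close>
    for all large n, and there the cutoff is 1.\<close>
  define C where "C n = cball 0 (real n) \<inter> {x. inverse (real (Suc n)) \<le> infdist x (- W)}" for n
  have C: "compact (C n)" for n
    unfolding C_def by (intro compact_Int_closed compact_cball closed_Collect_le continuous_intros)
  have CW: "C n \<subseteq> W" for n
  proof
    fix x assume "x \<in> C n"
    then have "infdist x (- W) > 0" by (auto simp: C_def intro: less_le_trans[rotated])
    then show "x \<in> W" using in_closed_iff_infdist_zero[OF cl ne, of x] by auto
  qed
  have "\<exists>\<psi> K. C1_on UNIV \<psi> \<and> (\<forall>x. 0 \<le> \<psi> x) \<and> (\<forall>x. \<psi> x \<le> (1::real)) \<and> compact K \<and> K \<subseteq> W \<and>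
      (\<forall>x. x \<notin> K \<longrightarrow> \<psi> x = 0) \<and> (\<forall>x\<in>C n. \<psi> x = 1)" for n
  proof (rule cutoff_exists[OF C W(1) CW, of n])
    fix \<psi> :: "'a \<Rightarrow> real" and S
    assume *: "C1_on UNIV \<psi>" "\<And>x. 0 \<le> \<psi> x" "\<And>x. \<psi> x \<le> 1" "compact (closure {x. \<psi> x \<noteq> 0})"
      "closure {x. \<psi> x \<noteq> 0} \<subseteq> W" "open S" "C n \<subseteq> S" "\<And>x. x \<in> S \<Longrightarrow> \<psi> x = 1"
    show ?thesis
    proof (intro exI conjI allI impI ballI)
      show "\<psi> x = 0" if "x \<notin> closure {x. \<psi> x \<noteq> 0}" for x
        using that closure_subset[of "{x. \<psi> x \<noteq> 0}"] by auto
      show "\<psi> x = 1" if "x \<in> C n" for x using *(7) that by (intro *(8)) blast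
    qed (fact *)+
  qed
  then obtain \<psi> :: "nat \<Rightarrow> 'a \<Rightarrow> real" and K where P: "\<And>n. C1_on UNIV (\<psi> n)" "\<And>n x. 0 \<le> \<psi> n x" "\<And>n x. \<psi> n x \<le> 1"
    "\<And>n. compact (K n)" "\<And>n. K n \<subseteq> W" "\<And>n x. x \<notin> K n \<Longrightarrow> \<psi> n x = 0" "\<And>n x. x \<in> C n \<Longrightarrow> \<psi> n x = 1"
    by metis
  have "(\<lambda>n. \<psi> n x) \<longlonglongrightarrow> indicator W x" for x
  proof (cases "x \<in> W")
    case True
    then have "infdist x (- W) \<noteq> 0" using in_closed_iff_infdist_zero[OF cl ne, of x] by auto
    then have "infdist x (- W) > 0" using infdist_nonneg[of x "- W"] by linarith
    then have "\<forall>\<^sub>F n in sequentially. inverse (real (Suc n)) < infdist x (- W)"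
      using order_tendstoD(2)[OF LIMSEQ_inverse_real_of_nat] by blast
    moreover have "\<forall>\<^sub>F n in sequentially. norm x \<le> real n"
      using real_arch_simple[of "norm x"] eventually_sequentially by (meson of_nat_mono order_trans)
    ultimately have "\<forall>\<^sub>F n in sequentially. \<psi> n x = 1"
      by eventually_elim (intro P(7), auto simp: C_def)
    then show ?thesis using True by (simp add: tendsto_eventually)
  next
    case False
    then have "\<psi> n x = 0" for n using P(5,6) by blast
    then show ?thesis using False by simp
  qed
  with P(1-6) show ?thesis by (rule that)
qed

context moving_domain
begin

text \<open>The region of space-time swept by \<open>C\<close> over a compact interval of positive
  times is compact. It supplies the dominating function when the domain of integration
  moves.\<close>

lemma moving_region_bounds:
  assumes G: "continuous_on spacetime (\<lambda>(y, t). G y t)" and C: "compact C" "C \<subseteq> \<Omega>\<^sub>0" and a: "0 < a"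
  obtains K B where "compact K" "0 \<le> (B::real)"
    "\<And>r y. a \<le> r \<Longrightarrow> r \<le> b \<Longrightarrow> \<phi> (- r) y \<in> C \<Longrightarrow> y \<in> K \<and> \<bar>G y r\<bar> \<le> B"
proof -
  let ?f = "\<lambda>(r, x). (\<phi> r x, r)"
  let ?D = "?f ` ({a..b} \<times> C)"
  have D: "compact ?D"
    by (intro compact_continuous_image compact_Times compact_Icc C(1))
      (auto intro!: continuous_intros simp: case_prod_unfold)
  have "?D \<subseteq> spacetime" using a C(2) by auto
  then have "continuous_on ?D (\<lambda>(y, t). G y t)" using G by (rule continuous_on_subset[rotated])
  from compact_imp_bounded[OF compact_continuous_image[OF this D]]
  obtain B where B: "0 < B" "\<forall>z\<in>(\<lambda>(y, t). G y t) ` ?D. norm z \<le> B"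
    unfolding bounded_pos by blast
  have "compact (fst ` ?D)" by (intro compact_continuous_image D continuous_intros)
  moreover have "y \<in> fst ` ?D \<and> \<bar>G y r\<bar> \<le> B" if "a \<le> r" "r \<le> b" "\<phi> (- r) y \<in> C" for r y
  proof -
    have p: "(y, r) \<in> ?D" using that by (intro image_eqI[of _ _ "(r, \<phi> (- r) y)"]) auto
    from bspec[OF B(2) imageI[OF p]] have "\<bar>G y r\<bar> \<le> B" by simp
    moreover from imageI[OF p, of fst] have "y \<in> fst ` ?D" by simp
    ultimately show ?thesis by blast
  qed
  ultimately show ?thesis using B(1) by (intro that[of "fst ` ?D" B]) (assumption, simp, blast)
qed

lemma integrable_moving:
  assumes G: "continuous_on spacetime (\<lambda>(y, t). G y t)" and W: "open W" "bounded W" "closure W \<subseteq> \<Omega>\<^sub>0" and r: "0 < r"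
  shows "integrable lborel (\<lambda>y. indicator (\<phi> r ` W) y * (G y r :: real))"
proof (rule integrable_indicator_continuous)
  show "closure (\<phi> r ` W) \<subseteq> \<phi> r ` \<Omega>\<^sub>0"
    unfolding closure_flow_image using W(3) by (rule image_mono)
qed (intro open_flow_image bounded_flow_image continuous_on_slice G W r)+

text \<open>Dominated convergence. A point off the frontier of the image at time t is either inside
  or outside the images at all nearby times, so the integrand converges there; the frontier is a
  null set.\<close>

lemma continuous_on_moving_integral:
  assumes G: "continuous_on spacetime (\<lambda>(y, t). G y t)"
    and W: "open W" "bounded W" "closure W \<subseteq> \<Omega>\<^sub>0" "C1_boundary W" and a: "0 < a"
  shows "continuous_on {a..b} (\<lambda>r. LBINT y. indicator (\<phi> r ` W) y * (G y r :: real))"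
proof -
  have cW: "compact (closure W)" using W(2) by simp
  have W': "W \<subseteq> \<Omega>\<^sub>0" using W(3) closure_subset by blast
  obtain K B where K: "compact K" "0 \<le> B"
    "\<And>r y. a \<le> r \<Longrightarrow> r \<le> b \<Longrightarrow> \<phi> (- r) y \<in> closure W \<Longrightarrow> y \<in> K \<and> \<bar>G y r\<bar> \<le> B"
    using moving_region_bounds[OF G cW W(3) a] by metis
  show ?thesis
  proof (rule continuous_on_sequentiallyI)
    fix s :: "nat \<Rightarrow> real" and t assume s: "\<forall>n. s n \<in> {a..b}" "t \<in> {a..b}" "s \<longlonglongrightarrow> t"
    have s0: "s n > 0" for n using s(1) a by (metis atLeastAtMost_iff less_le_trans)
    have t0: "t > 0" using s(2) a by simp
    show "(\<lambda>n. LBINT y. indicator (\<phi> (s n) ` W) y * G y (s n)) \<longlonglongrightarrow> (LBINT y. indicator (\<phi> t ` W) y * G y t)"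
    proof (rule integral_dominated_convergence[where w="\<lambda>y. indicator K y *\<^sub>R B"])
      show "integrable lborel (\<lambda>y. indicator K y *\<^sub>R B)"
        by (rule borel_integrable_compact[OF K(1)]) (rule continuous_on_const)
      show "(\<lambda>y. indicator (\<phi> t ` W) y * G y t) \<in> borel_measurable lborel"
        by (rule borel_measurable_integrable[OF integrable_moving[OF G W(1-3) t0]])
      show "(\<lambda>y. indicator (\<phi> (s n) ` W) y * G y (s n)) \<in> borel_measurable lborel" for n
        by (rule borel_measurable_integrable[OF integrable_moving[OF G W(1-3) s0]])
      show "AE y in lborel. norm (indicator (\<phi> (s n) ` W) y * G y (s n)) \<le> indicator K y *\<^sub>R B" for n
      proof (rule AE_I2)
        fix y
        show "norm (indicator (\<phi> (s n) ` W) y * G y (s n)) \<le> indicator K y *\<^sub>R B"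
        proof (cases "y \<in> \<phi> (s n) ` W")
          case True
          then have "\<phi> (- s n) y \<in> closure W" using closure_subset by (auto simp: flow_image_eq_vimage)
          with K(3)[of "s n" y] s(1) True show ?thesis by simp
        qed (use K(2) in simp)
      qed
      have "negligible (frontier (\<phi> t ` W))"
        by (intro negligible_C1_boundary open_flow_image C1_boundary_flow_image W)
      then have "frontier (\<phi> t ` W) \<in> null_sets lborel"
        by (simp add: negligible_iff_null_sets null_sets_completion_iff)
      then have "AE y in lborel. y \<notin> frontier (\<phi> t ` W)" by (rule AE_not_in)
      then show "AE y in lborel. (\<lambda>n. indicator (\<phi> (s n) ` W) y * G y (s n)) \<longlonglongrightarrow> indicator (\<phi> t ` W) y * G y t"
      proof (rule AE_mp, intro AE_I2 impI)
        fix y assume y: "y \<notin> frontier (\<phi> t ` W)"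
        have lim: "(\<lambda>n. \<phi> (- s n) y) \<longlonglongrightarrow> \<phi> (- t) y"
          by (rule continuous_on_tendsto_compose[OF continuous_on_flow_time[of UNIV] tendsto_minus[OF s(3)]]) auto
        show "(\<lambda>n. indicator (\<phi> (s n) ` W) y * G y (s n)) \<longlonglongrightarrow> indicator (\<phi> t ` W) y * G y t"
        proof (cases "y \<in> \<phi> t ` W")
          case True
          then have yW: "\<phi> (- t) y \<in> W" by (simp add: flow_image_eq_vimage)
          have "\<forall>\<^sub>F n in sequentially. \<phi> (- s n) y \<in> W" by (rule topological_tendstoD[OF lim W(1) yW])
          then have "\<forall>\<^sub>F n in sequentially. indicator (\<phi> (s n) ` W) y = (1::real)"
            by eventually_elim (simp add: flow_image_eq_vimage)
          then have "(\<lambda>n. indicator (\<phi> (s n) ` W) y) \<longlonglongrightarrow> (1::real)" by (rule tendsto_eventually)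
          moreover have "(\<lambda>n. case (y, s n) of (y, t) \<Rightarrow> G y t) \<longlonglongrightarrow> (case (y, t) of (y, t) \<Rightarrow> G y t)"
          proof (rule continuous_on_tendsto_compose[OF G])
            show "(\<lambda>n. (y, s n)) \<longlonglongrightarrow> (y, t)" by (intro tendsto_intros s(3))
            show yt: "(y, t) \<in> spacetime" using yW W' t0 unfolding spacetime_iff by blast
            show "\<forall>\<^sub>F n in sequentially. (y, s n) \<in> spacetime"
              by (rule topological_tendstoD[OF _ open_spacetime yt]) (intro tendsto_intros s(3))
          qed
          ultimately show ?thesis using True tendsto_mult by fastforce
        next
          case False
          then have "y \<notin> closure (\<phi> t ` W)" using y by (simp add: frontier_def interior_open open_flow_image W(1))
          then have "y \<notin> \<phi> t ` closure W" by (simp only: closure_flow_image not_False_eq_True)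
          then have "\<phi> (- t) y \<in> - closure W" by (simp add: flow_image_eq_vimage)
          then have "\<forall>\<^sub>F n in sequentially. \<phi> (- s n) y \<in> - closure W"
            by (intro topological_tendstoD[OF lim]) auto
          then have "\<forall>\<^sub>F n in sequentially. indicator (\<phi> (s n) ` W) y * G y (s n) = 0"
            by eventually_elim (use closure_subset in \<open>auto simp: flow_image_eq_vimage indicator_def\<close>)
          then have "(\<lambda>n. indicator (\<phi> (s n) ` W) y * G y (s n)) \<longlonglongrightarrow> 0" by (rule tendsto_eventually)
          then show ?thesis using False by simp
        qed
      qed
    qed
  qed
qed

text \<open>The first claim is the limit at a fixed time. The second bounds all approximants
  independently of n, as dominated convergence in the time variable demands.\<close>

lemma moving_integral_approx:
  assumes G: "continuous_on spacetime (\<lambda>(y, t). G y t)"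
    and W: "open W" "bounded W" "closure W \<subseteq> \<Omega>\<^sub>0" and r: "0 < r"
    and \<psi>: "\<And>n. C1_on UNIV (\<psi> n)" "\<And>n x. 0 \<le> \<psi> n x" "\<And>n x. \<psi> n x \<le> 1" "\<And>n x. x \<notin> W \<Longrightarrow> \<psi> n x = 0"
      "\<And>x. (\<lambda>n. \<psi> n x) \<longlonglongrightarrow> indicator W x"
  shows "(\<lambda>n. LBINT y. \<psi> n (\<phi> (- r) y) * (G y r :: real)) \<longlonglongrightarrow> (LBINT y. indicator (\<phi> r ` W) y * G y r)"
    and "norm (LBINT y. \<psi> n (\<phi> (- r) y) * G y r) \<le> (LBINT y. norm (indicator (\<phi> r ` W) y * G y r))"
proof -
  have W': "W \<subseteq> \<Omega>\<^sub>0" using W(3) closure_subset by blast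
  have eq: "\<psi> n (\<phi> (- r) y) * G y r = \<psi> n (\<phi> (- r) y) * (indicator (\<phi> r ` W) y * G y r)" for n y
    using \<psi>(4)[of "\<phi> (- r) y" n] by (auto simp: indicator_def flow_image_eq_vimage)
  have i: "integrable lborel (\<lambda>y. indicator (\<phi> r ` W) y * G y r)" by (rule integrable_moving[OF G W r])
  have m: "(\<lambda>y. \<psi> n (\<phi> (- r) y) * G y r) \<in> borel_measurable lborel" for n
  proof -
    have "(\<lambda>y. \<psi> n (\<phi> (- r) y)) \<in> borel_measurable borel"
      by (intro borel_measurable_continuous_onI C1_on_continuous C1_on_compose[OF C1_on_flow \<psi>(1)]) auto
    then have "(\<lambda>y. \<psi> n (\<phi> (- r) y)) \<in> borel_measurable lborel" by simp
    from borel_measurable_times[OF this borel_measurable_integrable[OF i]] show ?thesis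
      by (simp only: eq[symmetric])
  qed
  have b: "norm (\<psi> n (\<phi> (- r) y) * G y r) \<le> norm (indicator (\<phi> r ` W) y * G y r)" for n y
    unfolding eq norm_mult using \<psi>(2,3) by (intro mult_left_le_one_le) (auto simp: mult_nonneg_nonneg)
  show "(\<lambda>n. LBINT y. \<psi> n (\<phi> (- r) y) * G y r) \<longlonglongrightarrow> (LBINT y. indicator (\<phi> r ` W) y * G y r)"
  proof (rule integral_dominated_convergence[OF _ m integrable_norm[OF i]])
    show "(\<lambda>y. indicator (\<phi> r ` W) y * G y r) \<in> borel_measurable lborel" using i by (rule borel_measurable_integrable)
    show "AE y in lborel. (\<lambda>n. \<psi> n (\<phi> (- r) y) * G y r) \<longlonglongrightarrow> indicator (\<phi> r ` W) y * G y r"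
    proof (rule AE_I2)
      fix y
      have "indicator (\<phi> r ` W) y = (indicator W (\<phi> (- r) y) :: real)" by (simp add: indicator_def flow_image_eq_vimage)
      then show "(\<lambda>n. \<psi> n (\<phi> (- r) y) * G y r) \<longlonglongrightarrow> indicator (\<phi> r ` W) y * G y r"
        using tendsto_mult_right[OF \<psi>(5)] by simp
    qed
  qed (use b in auto)
  show "norm (LBINT y. \<psi> n (\<phi> (- r) y) * G y r) \<le> (LBINT y. norm (indicator (\<phi> r ` W) y * G y r))"
  proof (rule Bochner_Integration.integral_norm_bound_integral)
    show "integrable lborel (\<lambda>y. \<psi> n (\<phi> (- r) y) * G y r)"
      by (rule Bochner_Integration.integrable_bound[OF i m]) (use b in auto)
  qed (use i b in auto)
qed

text \<open>The identity for weights is integrated over a time interval from \<open>a\<close>, the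
  limit in n is taken in this integrated form, and the result is differentiated at \<open>t\<close>
  by the fundamental theorem of calculus, which uses the continuity of \<open>h\<close>.\<close>

theorem reynolds_transport:
  assumes W: "open W" "bounded W" "closure W \<subseteq> \<Omega>\<^sub>0" "C1_boundary W" and t: "0 < t"
  shows "((\<lambda>s. LBINT y. indicator (\<phi> s ` W) y * T y s) has_real_derivative
    (LBINT y. indicator (\<phi> t ` W) y * rate y t)) (at t)"
proof -
  obtain \<psi> :: "nat \<Rightarrow> 'a \<Rightarrow> real" and K where \<psi>:
    "\<And>n. C1_on UNIV (\<psi> n)" "\<And>n x. 0 \<le> \<psi> n x" "\<And>n x. \<psi> n x \<le> 1"
    "\<And>n. compact (K n)" "\<And>n. K n \<subseteq> W" "\<And>n x. x \<notin> K n \<Longrightarrow> \<psi> n x = 0"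
    "\<And>x. (\<lambda>n. \<psi> n x) \<longlonglongrightarrow> indicator W x"
    using indicator_C1_approximation[OF W(1,2)] by blast
  have \<psi>W: "\<psi> n x = 0" if "x \<notin> W" for n x using \<psi>(5,6) that by blast
  have K\<Omega>: "K n \<subseteq> \<Omega>\<^sub>0" for n using \<psi>(5) closure_subset W(3) by blast
  have cT: "continuous_on spacetime (\<lambda>(y, t). T y t)" by (rule C1_on_continuous[OF C1_T])
  define M where "M n s = (LBINT y. \<psi> n (\<phi> (- s) y) * T y s)" for n s
  define N where "N n s = (LBINT y. \<psi> n (\<phi> (- s) y) * rate y s)" for n s
  define m where "m s = (LBINT y. indicator (\<phi> s ` W) y * T y s)" for s
  define h where "h s = (LBINT y. indicator (\<phi> s ` W) y * rate y s)" for s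
  have M': "(M n has_real_derivative N n s) (at s)" if "0 < s" for n s
    unfolding M_def N_def by (rule transport_compact_support[OF that \<psi>(1,4) K\<Omega> \<psi>(6)])
  define a where "a = t / 2"
  define b where "b = 2 * t"
  have ab: "0 < a" "a < t" "t < b" using t by (auto simp: a_def b_def)
  have absG: "continuous_on spacetime (\<lambda>(y, t). \<bar>rate y t\<bar>)"
    using continuous_on_rate by (auto simp: case_prod_unfold intro!: continuous_intros)
  have m_eq: "m s = m a + integral {a..s} h" if s: "s \<in> {a..b}" for s
  proof -
    have N: "(N n has_integral (M n s - M n a)) {a..s}" for n
    proof (rule fundamental_theorem_of_calculus)
      show "(M n has_vector_derivative N n r) (at r within {a..s})" if "r \<in> {a..s}" for r
        using M'[of r n] that ab(1)
        by (auto simp flip: has_real_derivative_iff_has_vector_derivative intro: has_field_derivative_at_within)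
    qed (use s in auto)
    have "(\<lambda>n. integral {a..s} (N n)) \<longlonglongrightarrow> integral {a..s} h"
    proof (rule dominated_convergence(2))
      show "N n integrable_on {a..s}" for n using N by blast
      have "continuous_on {a..s} (\<lambda>r. LBINT y. indicator (\<phi> r ` W) y * \<bar>rate y r\<bar>)"
        by (rule continuous_on_moving_integral[OF absG W ab(1)])
      then show "(\<lambda>r. LBINT y. norm (indicator (\<phi> r ` W) y * rate y r)) integrable_on {a..s}"
        by (intro integrable_continuous_real) (simp add: abs_mult)
      show "norm (N n r) \<le> (LBINT y. norm (indicator (\<phi> r ` W) y * rate y r))" if "r \<in> {a..s}" for n r
        unfolding N_def
        by (rule moving_integral_approx(2)[OF continuous_on_rate W(1-3) _ \<psi>(1-3) \<psi>W \<psi>(7)]) (use that ab(1) in auto)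
      show "(\<lambda>n. N n r) \<longlonglongrightarrow> h r" if "r \<in> {a..s}" for r
        unfolding N_def h_def
        by (rule moving_integral_approx(1)[OF continuous_on_rate W(1-3) _ \<psi>(1-3) \<psi>W \<psi>(7)]) (use that ab(1) in auto)
    qed
    moreover have "integral {a..s} (N n) = M n s - M n a" for n using N by (rule integral_unique)
    moreover have "(\<lambda>n. M n r) \<longlonglongrightarrow> m r" if "r > 0" for r
      unfolding M_def m_def by (rule moving_integral_approx(1)[OF cT W(1-3) that \<psi>(1-3) \<psi>W \<psi>(7)])
    then have "(\<lambda>n. M n s - M n a) \<longlonglongrightarrow> m s - m a" using s ab by (intro tendsto_diff) auto
    ultimately have "integral {a..s} h = m s - m a" using LIMSEQ_unique by force
    then show ?thesis by simp
  qed
  have "continuous_on {a..b} h"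
    unfolding h_def by (rule continuous_on_moving_integral[OF continuous_on_rate W ab(1)])
  then have "((\<lambda>s. integral {a..s} h) has_real_derivative h t) (at t within {a..b})"
    using ab by (intro integral_has_real_derivative) auto
  then have "((\<lambda>s. integral {a..s} h) has_real_derivative h t) (at t)"
    using ab at_within_interior[of t "{a..b}"] by (simp add: interior_atLeastAtMost_real)
  then have "((\<lambda>s. m a + integral {a..s} h) has_real_derivative h t) (at t)"
    using DERIV_add[OF DERIV_const] by fastforce
  then have "(m has_real_derivative h t) (at t)"
  proof (rule has_field_derivative_transform_within_open)
    show "m a + integral {a..s} h = m s" if "s \<in> {a<..<b}" for s using m_eq[of s] that by simp
  qed (use ab in auto)
  then show ?thesis by (simp add: m_def[abs_def] h_def)
qed

end

section \<open>Balls are smooth domains\<close>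

lemma Ck_on_cong_open:
  assumes "open S" "\<And>x. x \<in> S \<Longrightarrow> f x = g x" "Ck_on k S f"
  shows "Ck_on k S g"
  using assms(2,3)
proof (induction k arbitrary: f g)
  case 0
  then show ?case by (simp cong: continuous_on_cong)
next
  case (Suc k)
  have "g differentiable (at x)" if "x \<in> S" for x
  proof -
    have "f differentiable (at x)" using Suc.prems(2) that by simp
    then obtain f' where "(f has_derivative f') (at x)" unfolding differentiable_def by blast
    then have "(g has_derivative f') (at x)"
      using that Suc.prems(1) by (rule has_derivative_transform_within_open[OF _ \<open>open S\<close>])
    then show ?thesis unfolding differentiable_def by blast
  qed
  moreover have "Ck_on k S (\<lambda>x. frechet_derivative g (at x) h)" for h
  proof (rule Suc.IH)
    show "frechet_derivative f (at x) h = frechet_derivative g (at x) h" if "x \<in> S" for x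
      using frechet_derivative_cong_open[OF \<open>open S\<close> that Suc.prems(1)] by simp
    show "Ck_on k S (\<lambda>x. frechet_derivative f (at x) h)" using Suc.prems(2) by simp
  qed
  ultimately show ?case by simp
qed

lemma Ck_on_SucI:
  assumes S: "open S" and f: "\<And>x. x \<in> S \<Longrightarrow> (f has_derivative f' x) (at x)"
    and f': "\<And>h. Ck_on k S (\<lambda>x. f' x h)"
  shows "Ck_on (Suc k) S f"
proof -
  have "Ck_on k S (\<lambda>x. frechet_derivative f (at x) h)" for h
    by (rule Ck_on_cong_open[OF S _ f'[of h]]) (simp add: frechet_derivative_at[OF f, symmetric])
  moreover have "f differentiable (at x)" if "x \<in> S" for x
    using f[OF that] unfolding differentiable_def by blast
  ultimately show ?thesis by simp
qed

lemma Ck_on_Suc_has_derivative: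
  "Ck_on (Suc k) S f \<Longrightarrow> x \<in> S \<Longrightarrow> (f has_derivative frechet_derivative f (at x)) (at x)"
  by (simp add: frechet_derivative_works)

lemma Ck_on_Suc_imp: "Ck_on (Suc k) S f \<Longrightarrow> Ck_on k S f"
proof (induction k arbitrary: f)
  case 0
  then have "\<forall>x\<in>S. isCont f x" by (auto intro: differentiable_imp_continuous_within)
  then show ?case by (simp add: continuous_at_imp_continuous_on)
next
  case (Suc k)
  have "f differentiable (at x)" if "x \<in> S" for x using Suc.prems that by simp
  moreover have "Ck_on k S (\<lambda>x. frechet_derivative f (at x) h)" for h
    using Suc.prems by (intro Suc.IH) simp
  ultimately show ?case by simp
qed

lemma Ck_on_const: "open S \<Longrightarrow> Ck_on k S (\<lambda>x. c)"
proof (induction k arbitrary: c)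
  case (Suc k)
  show ?case by (rule Ck_on_SucI[OF Suc.prems has_derivative_const Suc.IH[OF Suc.prems]])
qed simp

lemma Ck_on_inner_right: "open S \<Longrightarrow> Ck_on k S (\<lambda>x. x \<bullet> v)"
proof (induction k)
  case (Suc k)
  show ?case
    by (rule Ck_on_SucI[OF Suc.prems, where f'="\<lambda>x h. h \<bullet> v"])
      (auto intro!: derivative_eq_intros Ck_on_const[OF Suc.prems])
qed (auto intro!: continuous_intros)

lemma Ck_on_add:
  assumes S: "open S"
  shows "Ck_on k S f \<Longrightarrow> Ck_on k S g \<Longrightarrow> Ck_on k S (\<lambda>x. f x + g x)"
proof (induction k arbitrary: f g)
  case (Suc k)
  show ?case
  proof (rule Ck_on_SucI[OF S])
    show "((\<lambda>x. f x + g x) has_derivative (\<lambda>h. frechet_derivative f (at x) h + frechet_derivative g (at x) h)) (at x)"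
      if "x \<in> S" for x
      by (intro has_derivative_add Ck_on_Suc_has_derivative[OF Suc.prems(1) that] Ck_on_Suc_has_derivative[OF Suc.prems(2) that])
    show "Ck_on k S (\<lambda>x. frechet_derivative f (at x) h + frechet_derivative g (at x) h)" for h
      using Suc.prems by (intro Suc.IH) simp_all
  qed
qed (auto intro: continuous_intros)

text \<open>The derivative of a product contains undifferentiated factors, so the induction step
  lowers their order by \<open>Ck_on_Suc_imp\<close>.\<close>

lemma Ck_on_mult:
  fixes f g :: "'a::real_normed_vector \<Rightarrow> real"
  assumes S: "open S"
  shows "Ck_on k S f \<Longrightarrow> Ck_on k S g \<Longrightarrow> Ck_on k S (\<lambda>x. f x * g x)"
proof (induction k arbitrary: f g)
  case (Suc k)
  show ?case
  proof (rule Ck_on_SucI[OF S])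
    show "((\<lambda>x. f x * g x) has_derivative (\<lambda>h. f x * frechet_derivative g (at x) h + frechet_derivative f (at x) h * g x)) (at x)"
      if "x \<in> S" for x
      by (intro has_derivative_mult Ck_on_Suc_has_derivative[OF Suc.prems(1) that] Ck_on_Suc_has_derivative[OF Suc.prems(2) that])
    show "Ck_on k S (\<lambda>x. f x * frechet_derivative g (at x) h + frechet_derivative f (at x) h * g x)" for h
      by (rule Ck_on_add[OF S Suc.IH[OF Ck_on_Suc_imp[OF Suc.prems(1)]] Suc.IH[OF _ Ck_on_Suc_imp[OF Suc.prems(2)]]])
        (use Suc.prems in simp_all)
  qed
qed (auto intro: continuous_intros)

lemma Ck_on_sum:
  assumes S: "open S"
  shows "(\<And>i. i \<in> I \<Longrightarrow> Ck_on k S (f i)) \<Longrightarrow> Ck_on k S (\<lambda>x. \<Sum>i\<in>I. f i x)"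
  by (induction I rule: infinite_finite_induct) (simp_all add: Ck_on_const[OF S] Ck_on_add[OF S])

text \<open>The exponent is arbitrary in the induction because differentiation lowers it by 1. This
  is why the chart of a sphere uses the exponent 1 / 2 instead of \<open>sqrt\<close>.\<close>

lemma Ck_on_powr:
  fixes q :: "'a::real_normed_vector \<Rightarrow> real"
  assumes S: "open S"
  shows "Ck_on k S q \<Longrightarrow> (\<And>x. x \<in> S \<Longrightarrow> 0 < q x) \<Longrightarrow> Ck_on k S (\<lambda>x. q x powr a)"
proof (induction k arbitrary: a)
  case 0
  then have "\<forall>x\<in>S. q x \<noteq> 0" by fastforce
  with 0 show ?case by (auto intro!: continuous_on_powr continuous_intros)
next
  case (Suc k)
  show ?case
  proof (rule Ck_on_SucI[OF S])
    fix x assume x: "x \<in> S"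
    have "((\<lambda>u. u powr a) has_derivative (*) (a * q x powr (a - 1))) (at (q x))"
      using has_real_derivative_powr[OF Suc.prems(2)[OF x], of a] unfolding has_field_derivative_def .
    from diff_chain_at[OF Ck_on_Suc_has_derivative[OF Suc.prems(1) x] this]
    show "((\<lambda>x. q x powr a) has_derivative (\<lambda>h. (a * q x powr (a - 1)) * frechet_derivative q (at x) h)) (at x)"
      by (simp add: o_def)
  next
    fix h
    show "Ck_on k S (\<lambda>x. (a * q x powr (a - 1)) * frechet_derivative q (at x) h)"
      by (rule Ck_on_mult[OF S Ck_on_mult[OF S Ck_on_const[OF S] Suc.IH[OF Ck_on_Suc_imp[OF Suc.prems(1)] Suc.prems(2)]]])
        (use Suc.prems(1) in simp_all)
  qed
qed

text \<open>Some coordinate of \<open>p - c\<close> is nonzero; \<open>k\<close> is that axis,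
  pointing to the side of \<open>p\<close>. On the open half-space beyond the centre, the ball is
  the region below the hemisphere.\<close>

lemma smooth_domain_ball:
  fixes c :: "'a::euclidean_space"
  assumes r: "0 < r"
  shows "smooth_domain (ball c r)"
  unfolding smooth_domain_def
proof (intro conjI ballI open_ball)
  fix p assume "p \<in> frontier (ball c r)"
  then have p: "norm (p - c) = r" using r by (simp add: dist_norm norm_minus_commute)
  then have "p - c \<noteq> 0" using r by auto
  then obtain b where b: "b \<in> Basis" "(p - c) \<bullet> b \<noteq> 0" using euclidean_eqI[of "p - c" 0] by auto
  define k where "k = (if (p - c) \<bullet> b > 0 then b else - b)"
  have kB: "k \<in> Basis \<or> - k \<in> Basis" using b(1) by (simp add: k_def)
  then have kk: "k \<bullet> k = 1" by (rule signed_Basis_inner_same)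
  have pk: "0 < (p - c) \<bullet> k" using b(2) by (simp add: k_def inner_minus_right)
  \<comment> \<open>The squared height of the hemisphere: r^2 minus the squared length of the
    component of x - c orthogonal to \<open>k\<close>. It is therefore constant along
    \<open>k\<close>.\<close>
  define q where "q x = r\<^sup>2 - (x - c) \<bullet> (x - c) + ((x - c) \<bullet> k)\<^sup>2" for x
  \<comment> \<open>The first condition excludes the opposite hemisphere, the second keeps the
    square root away from its singularity.\<close>
  define U where "U = {x. 0 < (x - c) \<bullet> k} \<inter> {x. 0 < q x}"
  define g where "g x = c \<bullet> k + q x powr (1 / 2)" for x
  have U: "open U" unfolding U_def q_def by (intro open_Int open_Collect_less continuous_intros)
  have pU: "p \<in> U"
    using p pk by (simp add: U_def q_def flip: power2_norm_eq_inner)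
  have qk: "q (x + s *\<^sub>R k) = q x" for x s
    by (simp add: q_def kk inner_commute[of k x] inner_commute[of k c] power2_eq_square algebra_simps)
  have "Ck_on n U g" for n
  proof -
    have aff: "Ck_on n U (\<lambda>x. (x - c) \<bullet> v)" for v
      using Ck_on_add[OF U Ck_on_inner_right[OF U, of n v] Ck_on_const[OF U, of n "- (c \<bullet> v)"]]
      by (simp add: inner_diff_left)
    have "Ck_on n U (\<lambda>x. (r\<^sup>2 + (- 1) * (\<Sum>b\<in>Basis. ((x - c) \<bullet> b) * ((x - c) \<bullet> b))) + ((x - c) \<bullet> k) * ((x - c) \<bullet> k))"
      by (intro Ck_on_add[OF U] Ck_on_mult[OF U] Ck_on_sum[OF U] Ck_on_const[OF U] aff)
    then have "Ck_on n U q"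
      by (rule Ck_on_cong_open[OF U, rotated]) (simp add: q_def euclidean_inner[of "x - c" "x - c" for x] power2_eq_square)
    then show ?thesis
      unfolding g_def by (intro Ck_on_add[OF U] Ck_on_const[OF U] Ck_on_powr[OF U]) (auto simp: U_def)
  qed
  moreover have "ball c r \<inter> U = {x \<in> U. x \<bullet> k < g x}"
  proof -
    have "x \<in> ball c r \<longleftrightarrow> x \<bullet> k < g x" if "x \<in> U" for x
    proof -
      have x: "0 < (x - c) \<bullet> k" "0 < q x" using that by (auto simp: U_def)
      have "x \<in> ball c r \<longleftrightarrow> (norm (x - c))\<^sup>2 < r\<^sup>2"
        using r power_strict_mono[of "norm (x - c)" r 2] power2_less_imp_less[of "norm (x - c)" r]
        by (auto simp: dist_norm norm_minus_commute)
      also have "\<dots> \<longleftrightarrow> ((x - c) \<bullet> k)\<^sup>2 < q x" by (auto simp: q_def power2_norm_eq_inner)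
      also have "\<dots> \<longleftrightarrow> (x - c) \<bullet> k < sqrt (q x)"
        using x by (metis less_imp_le real_less_rsqrt real_sqrt_less_iff real_sqrt_abs abs_of_pos)
      also have "\<dots> \<longleftrightarrow> x \<bullet> k < g x" using x(2) by (auto simp: g_def powr_half_sqrt inner_diff_left)
      finally show ?thesis .
    qed
    then show ?thesis by auto
  qed
  then have "boundary_graph (ball c r) U k g"
    unfolding boundary_graph_def using U kB by (simp add: g_def qk)
  ultimately show "\<exists>U k g. p \<in> U \<and> boundary_graph (ball c r) U k g \<and> Cinf_on U g"
    using pU unfolding Cinf_on_def by blast
qed

section \<open>Balance equations\<close>

text \<open>If the integral were 0, the integrand would vanish almost everywhere and
  \<open>A\<close> would be a null set, which no nonempty open set is.\<close>

lemma integral_pos_on_open: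
  fixes u :: "'a::euclidean_space \<Rightarrow> real"
  assumes A: "open A" "A \<noteq> {}" and i: "integrable lborel (\<lambda>y. indicator A y * u y)" and pos: "\<And>y. y \<in> A \<Longrightarrow> 0 < u y"
  shows "(LBINT y. indicator A y * u y) \<noteq> 0"
proof
  assume "(LBINT y. indicator A y * u y) = 0"
  then have "AE y in lborel. indicator A y * u y = 0"
    using i pos by (subst (asm) integral_nonneg_eq_0_iff_AE) (auto simp: indicator_def less_imp_le)
  then have "AE y in lborel. y \<notin> A"
    by (rule AE_mp) (rule AE_I2, use pos in \<open>fastforce simp: indicator_def\<close>)
  then have "A \<in> null_sets lborel"
    using A(1) by (simp add: AE_iff_null_sets borel_open)
  then have "negligible A" using A(1) by (simp add: negligible_iff_null_sets null_sets_completion_iff borel_open)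
  then show False using open_not_negligible[OF A] by simp
qed

context moving_domain
begin

lemma eulerian_iff_pulled_back:
  "eulerian_balance V \<phi> \<Omega>\<^sub>0 T f J \<longleftrightarrow> pulled_back_balance V \<phi> \<Omega>\<^sub>0 T f J"
proof -
  have "deriv (\<lambda>s. T (\<phi> s x) s) t + T (\<phi> t x) t * divergence V (\<phi> t x) = rate (\<phi> t x) t"
    if "t > 0" "x \<in> \<Omega>\<^sub>0" for t x
  proof -
    have s: "(\<phi> t x, t) \<in> spacetime" using that by auto
    have "deriv (\<lambda>s. T (\<phi> s x) s) t = T' (\<phi> t x) t (V (\<phi> t x), 1)"
      by (rule DERIV_imp_deriv[OF T_has_derivative_along[OF s flow_has_vector_derivative refl]])
    \<comment> \<open>The derivative along a trajectory splits into its transport part and its time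
      part.\<close>
    also have "(V (\<phi> t x), 1 :: real) = (V (\<phi> t x), 0) + (0, 1)" by simp
    also have "T' (\<phi> t x) t \<dots> = T' (\<phi> t x) t (V (\<phi> t x), 0) + T' (\<phi> t x) t (0, 1)"
      by (rule linear_add[OF has_derivative_linear[OF T_has_derivative[OF s]]])
    finally show ?thesis by (simp add: rate_eq[OF s])
  qed
  then show ?thesis
    unfolding eulerian_balance_def pulled_back_balance_def pull_back_def rate_def[symmetric] by simp
qed

lemma balance_iff_eulerian:
  assumes f: "\<And>t. t > 0 \<Longrightarrow> continuous_on (\<phi> t ` \<Omega>\<^sub>0) (\<lambda>y. f y t)"
    and J: "\<And>t. t > 0 \<Longrightarrow> C1_on (\<phi> t ` \<Omega>\<^sub>0) (\<lambda>y. J y t)"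
  shows "satisfies_balance \<phi> \<Omega>\<^sub>0 T f J \<longleftrightarrow> eulerian_balance V \<phi> \<Omega>\<^sub>0 T f J"
proof -
  define e where "e t y = rate y t - (f y t - divergence (\<lambda>z. J z t) y)" for t y
  note cR = continuous_on_slice[OF continuous_on_rate]
  have cJ: "continuous_on (\<phi> t ` \<Omega>\<^sub>0) (divergence (\<lambda>z. J z t))" if t: "t > 0" for t
    by (rule continuous_on_divergence[OF J[OF t]])
  have ce: "continuous_on (\<phi> t ` \<Omega>\<^sub>0) (e t)" if t: "t > 0" for t
    unfolding e_def by (intro continuous_intros cR cJ f t)
  \<comment> \<open>Uniqueness of derivatives turns the balance for one domain at one time into an
    equation between integrals.\<close>
  have main: "((\<lambda>s. LBINT y:\<phi> s ` W. T y s) has_real_derivative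
        ((LBINT y:\<phi> t ` W. f y t) - flux (\<phi> t ` W) (\<lambda>y. J y t))) (at t) \<longleftrightarrow>
      (LBINT y. indicator (\<phi> t ` W) y * e t y) = 0"
    and int: "integrable lborel (\<lambda>y. indicator (\<phi> t ` W) y * e t y)"
    if W: "smooth_subdomain W \<Omega>\<^sub>0" and t: "t > 0" for W t
  proof -
    have sd: "smooth_domain W" and W0: "bounded W" "closure W \<subseteq> \<Omega>\<^sub>0"
      using W unfolding smooth_subdomain_def by blast+
    have "open W" using sd unfolding smooth_domain_def by blast
    note W0 = this W0 smooth_domain_C1_boundary[OF sd]
    let ?W = "\<phi> t ` W" and ?S = "\<phi> t ` \<Omega>\<^sub>0"
    have oW: "open ?W" by (rule open_flow_image[OF W0(1)])
    have cW: "closure ?W \<subseteq> ?S" unfolding closure_flow_image using W0(3) by (rule image_mono)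
    have bW: "bounded ?W" by (rule bounded_flow_image[OF W0(2)])
    note ii = integrable_indicator_continuous[OF oW bW cW]
    have fl: "flux ?W (\<lambda>y. J y t) = (LBINT y. indicator ?W y * divergence (\<lambda>z. J z t) y)"
      by (rule flux_eq_integral_divergence[OF oW bW C1_boundary_flow_image[OF W0(1,4)] open_flow_image[OF open_\<Omega>\<^sub>0] cW J[OF t]])
    have "(LBINT y. indicator ?W y * e t y)
        = (LBINT y. indicator ?W y * rate y t - (indicator ?W y * f y t - indicator ?W y * divergence (\<lambda>z. J z t) y))"
      by (simp add: e_def algebra_simps)
    also have "\<dots> = (LBINT y. indicator ?W y * rate y t) - ((LBINT y:?W. f y t) - flux ?W (\<lambda>y. J y t))"
      using ii[OF cR[OF t]] ii[OF f[OF t]] ii[OF cJ[OF t]] by (simp add: fl set_lebesgue_integral_def)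
    finally have eq: "(LBINT y. indicator ?W y * e t y)
        = (LBINT y. indicator ?W y * rate y t) - ((LBINT y:?W. f y t) - flux ?W (\<lambda>y. J y t))" .
    have d: "((\<lambda>s. LBINT y:\<phi> s ` W. T y s) has_real_derivative (LBINT y. indicator ?W y * rate y t)) (at t)"
      using reynolds_transport[OF W0 t] by (simp add: set_lebesgue_integral_def)
    show "((\<lambda>s. LBINT y:\<phi> s ` W. T y s) has_real_derivative
        ((LBINT y:?W. f y t) - flux ?W (\<lambda>y. J y t))) (at t) \<longleftrightarrow> (LBINT y. indicator ?W y * e t y) = 0"
      unfolding eq right_minus_eq
    proof
      assume "(LBINT y. indicator ?W y * rate y t) = (LBINT y:?W. f y t) - flux ?W (\<lambda>y. J y t)"
      then show "((\<lambda>s. LBINT y:\<phi> s ` W. T y s) has_real_derivative ((LBINT y:?W. f y t) - flux ?W (\<lambda>y. J y t))) (at t)"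
        using d by (simp only:)
    qed (rule DERIV_unique[OF d])
    show "integrable lborel (\<lambda>y. indicator ?W y * e t y)" by (rule ii[OF ce[OF t]])
  qed
  have eul: "eulerian_balance V \<phi> \<Omega>\<^sub>0 T f J \<longleftrightarrow> (\<forall>t>0. \<forall>y\<in>\<phi> t ` \<Omega>\<^sub>0. e t y = 0)"
    unfolding eulerian_balance_def e_def rate_def right_minus_eq ..
  show ?thesis
  proof
    assume bal: "satisfies_balance \<phi> \<Omega>\<^sub>0 T f J"
    show "eulerian_balance V \<phi> \<Omega>\<^sub>0 T f J"
      unfolding eul
    proof (intro allI impI ballI, rule ccontr)
      fix t y0 assume t: "0 < t" and y0: "y0 \<in> \<phi> t ` \<Omega>\<^sub>0" and ne: "e t y0 \<noteq> 0"
      then obtain x0 where x0: "x0 \<in> \<Omega>\<^sub>0" "y0 = \<phi> t x0" by blast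
      \<comment> \<open>Multiplying by the value at \<open>y0\<close> makes the function positive
        near \<open>y0\<close> whichever sign that value has.\<close>
      let ?u = "\<lambda>y. e t y0 * e t y"
      \<comment> \<open>The neighbourhood is chosen in the reference domain, since test domains are
        images of subdomains of \<open>\<Omega>\<^sub>0\<close>; a closed ball is fitted into it
        because the closure of a test domain has to lie in \<open>\<Omega>\<^sub>0\<close>.\<close>
      have "open (\<Omega>\<^sub>0 \<inter> (\<lambda>x. ?u (\<phi> t x)) -` {0<..})"
        by (intro continuous_open_preimage open_\<Omega>\<^sub>0 continuous_intros continuous_on_compose2[OF ce[OF t]]) auto
      moreover have "x0 \<in> \<Omega>\<^sub>0 \<inter> (\<lambda>x. ?u (\<phi> t x)) -` {0<..}" using x0 ne by (auto simp: zero_less_mult_iff)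
      ultimately obtain r where r: "0 < r" "cball x0 r \<subseteq> \<Omega>\<^sub>0 \<inter> (\<lambda>x. ?u (\<phi> t x)) -` {0<..}"
        unfolding open_contains_cball by blast
      let ?W = "ball x0 r"
      have W: "smooth_subdomain ?W \<Omega>\<^sub>0"
        unfolding smooth_subdomain_def using r smooth_domain_ball[OF r(1)] by auto
      have "(LBINT y. indicator (\<phi> t ` ?W) y * e t y) = 0"
        using bal W t main[OF W t] unfolding satisfies_balance_def by blast
      then have "(LBINT y. indicator (\<phi> t ` ?W) y * ?u y) = 0"
        by (simp add: mult.left_commute)
      moreover have "(LBINT y. indicator (\<phi> t ` ?W) y * ?u y) \<noteq> 0"
      proof (rule integral_pos_on_open[OF open_flow_image[OF open_ball]])
        show "\<phi> t ` ?W \<noteq> {}" using r(1) by simp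
        show "integrable lborel (\<lambda>y. indicator (\<phi> t ` ?W) y * ?u y)"
          using integrable_mult_right[OF int[OF W t], of "e t y0"] by (simp add: mult.left_commute)
        show "0 < ?u y" if "y \<in> \<phi> t ` ?W" for y using that r(2) ball_subset_cball by blast
      qed
      ultimately show False by simp
    qed
  next
    assume "eulerian_balance V \<phi> \<Omega>\<^sub>0 T f J"
    then have e0: "e t y = 0" if "t > 0" "y \<in> \<phi> t ` \<Omega>\<^sub>0" for t y using that unfolding eul by blast
    show "satisfies_balance \<phi> \<Omega>\<^sub>0 T f J"
      unfolding satisfies_balance_def
    proof (intro allI impI)
      fix W t assume W: "smooth_subdomain W \<Omega>\<^sub>0" and t: "(0::real) < t"
      have "W \<subseteq> \<Omega>\<^sub>0" using W closure_subset unfolding smooth_subdomain_def by blast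
      then have "indicator (\<phi> t ` W) y * e t y = 0" for y using e0[OF t] by (auto simp: indicator_def)
      then have "(LBINT y. indicator (\<phi> t ` W) y * e t y) = 0"
        by (simp only: Bochner_Integration.integral_zero)
      then show "((\<lambda>s. LBINT y:\<phi> s ` W. T y s) has_real_derivative
        ((LBINT y:\<phi> t ` W. f y t) - flux (\<phi> t ` W) (\<lambda>y. J y t))) (at t)"
        using main[OF W t] by blast
    qed
  qed
qed

end

theorem proposition3p3:
  fixes V :: "real ^ 'n \<Rightarrow> real ^ 'n"
    and \<phi> :: "real \<Rightarrow> real ^ 'n \<Rightarrow> real ^ 'n"
    and \<Omega>\<^sub>0 :: "(real ^ 'n) set"
    and T f :: "real ^ 'n \<Rightarrow> real \<Rightarrow> real"
    and J :: "real ^ 'n \<Rightarrow> real \<Rightarrow> real ^ 'n"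
  assumes "smooth_domain \<Omega>\<^sub>0"
    and "Cinf_on UNIV V"
    and "is_flow V \<phi>"
    and "Ck_on 1 {(y, t). t > 0 \<and> y \<in> \<phi> t ` \<Omega>\<^sub>0} (\<lambda>(y, t). T y t)"
    and "\<And>t. t > 0 \<Longrightarrow> continuous_on (\<phi> t ` \<Omega>\<^sub>0) (\<lambda>y. f y t)"
    and "\<And>t. t > 0 \<Longrightarrow> Ck_on 1 (\<phi> t ` \<Omega>\<^sub>0) (\<lambda>y. J y t)"
  shows "(satisfies_balance \<phi> \<Omega>\<^sub>0 T f J \<longleftrightarrow> eulerian_balance V \<phi> \<Omega>\<^sub>0 T f J) \<and>
    (eulerian_balance V \<phi> \<Omega>\<^sub>0 T f J \<longleftrightarrow> pulled_back_balance V \<phi> \<Omega>\<^sub>0 T f J)"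
proof -
  interpret moving_domain V \<phi> \<Omega>\<^sub>0 T
  proof
    show "C1_on UNIV V" using assms(2) unfolding Cinf_on_def by (metis Ck_on_1_iff)
    show "open \<Omega>\<^sub>0" using assms(1) unfolding smooth_domain_def by blast
    show "C1_on {(y, t). t > 0 \<and> y \<in> \<phi> t ` \<Omega>\<^sub>0} (\<lambda>(y, t). T y t)"
      using assms(4) unfolding Ck_on_1_iff .
  qed (rule assms(3))
  show ?thesis
    using balance_iff_eulerian[OF assms(5) assms(6)[unfolded Ck_on_1_iff]] eulerian_iff_pulled_back by blast
qed

end
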